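(* Let $A,B$ be unital C*-algebras and $\theta:U(A)\to U(B)$ be a contractive injective homomorphism such that $\theta(\mathbb{T})=\mathbb{T}$. Suppose that $T(A)\neq\emptyset$. If $$\pi_i(U(A))\simeq K_{i-1}(A)\quad\text{and}\quad \pi_i(U(B))\simeq K_{i-1}(B)\quad\text{for } i=0,1,$$ via the canonical maps, then there is an induced map $KT_u(\theta):KT_u(A)\to KT_u(B)$.
   Context: For a unital C*-algebra $A$, $U(A)$ is the unitary group (norm topology); $\mathbb{T}$ is the unit circle, identified with $\mathbb{T}\cdot 1$; $\pi_1$ is the fundamental group based at $1$ and $\pi_0$ is the group of connected components. Homomorphism means group homomorphism, and contractive means $\|\theta(u)-\theta(v)\|\le\|u-v\|$ for all $u,v$. $K_0,K_1$ are the topological $K$-groups, with $K_{-1}$ read as $K_1$. $T(A)$ is the set of tracial states, and $\operatorname{Aff}T(A)$ is the partially ordered real Banach space (sup norm, pointwise order, order unit the constant function $1$) of continuous affine functions $T(A)\to\mathbb{R}$ (the zero space if $T(A)=\emptyset$, in which case any map into it counts as unital and positive). The pairing $\rho_A:K_0(A)\to\operatorname{Aff}T(A)$ is $\rho_A([p]-[q])(\tau)=\tau(p-q)$ for projections $p,q$ in matrices over $A$ (traces extended to matrices unnormalized). $KT_u(A)=(K_0(A),[1_A]_0,K_1(A),\rho_A,\operatorname{Aff}T(A))$. A map (that is, a $KT_u$-morphism) $KT_u(A)\to KT_u(B)$ is a triple $(\alpha_0,\alpha_1,\gamma)$ consisting of a group homomorphism $\alpha_0:K_0(A)\to K_0(B)$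 with $\alpha_0([1_A]_0)=[1_B]_0$, a group homomorphism $\alpha_1:K_1(A)\to K_1(B)$, and a unital positive map $\gamma:\operatorname{Aff}T(A)\to\operatorname{Aff}T(B)$ such that $\gamma\circ\rho_A=\rho_B\circ\alpha_0$. $KT_u(\theta)$ is the notation for the $KT_u$-morphism induced by $\theta$. Canonical maps: $\pi_0(U(A))\to K_1(A)$ is $[u]\mapsto[u]_1$; $\pi_1(U(A))\to K_0(A)$ is the map induced by $U(A)\to U_\infty(A)=\varinjlim U(M_n(A))$ (connecting maps $u\mapsto u\oplus1$) followed by the identification $\pi_1(U_\infty(A))\cong K_0(A)$ under which the class of the loop $t\mapsto pe^{2\pi i t}+(1-p)$ corresponds to $[p]$ for a projection $p$. *)

theory Defs
  imports "HOL-Analysis.Analysis" "HOL-Algebra.Coset" "HOL-Library.Groups_Big_Fun"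
begin

section \<open>Unital C*-algebras\<close>

text \<open>
  The class axiom \<open>norm 1 = 1\<close> excludes the zero algebra. Nothing is lost when there is a tracial
  state on \<open>A\<close> and an injective map \<open>U(A) \<rightarrow> U(B)\<close>: then \<open>A \<noteq> 0\<close>, so
  \<open>U(A)\<close> is not a singleton, so \<open>B \<noteq> 0\<close>.
\<close>

class cstar_algebra = real_normed_algebra_1 + banach +
  fixes scaleC :: "complex \<Rightarrow> 'a \<Rightarrow> 'a"
    and star :: "'a \<Rightarrow> 'a"
  assumes scaleC_add_right: "scaleC c (x + y) = scaleC c x + scaleC c y"
    and scaleC_add_left: "scaleC (c + d) x = scaleC c x + scaleC d x"
    and scaleC_scaleC: "scaleC c (scaleC d x) = scaleC (c * d) x"
    and scaleC_of_real: "scaleC (of_real r) x = r *\<^sub>R x"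
    and scaleC_mult_left: "scaleC c x * y = scaleC c (x * y)"
    and scaleC_mult_right: "x * scaleC c y = scaleC c (x * y)"
    and norm_scaleC: "norm (scaleC c x) = cmod c * norm x"
    and star_add: "star (x + y) = star x + star y"
    and star_scaleC: "star (scaleC c x) = scaleC (cnj c) (star x)"
    and star_mult: "star (x * y) = star y * star x"
    and star_star: "star (star x) = x"
    and cstar_identity: "norm (star x * x) = norm x * norm x"

instantiation complex :: cstar_algebra
begin

definition "scaleC_complex (c :: complex) (x :: complex) = c * x"
definition "star_complex (x :: complex) = cnj x"

instance
  by standard
    (simp_all add: scaleC_complex_def star_complex_def algebra_simps norm_mult scaleR_conv_of_real)

end

definition selfadjoint :: "'a::cstar_algebra set" where
  "selfadjoint = {a. star a = a}"

definition unitaries :: "'a::cstar_algebra set" where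
  "unitaries = {u. star u * u = 1 \<and> u * star u = 1}"

definition unitary_group :: "'a::cstar_algebra monoid" where
  "unitary_group = \<lparr>carrier = unitaries, mult = (*), one = 1\<rparr>"

definition scalar_circle :: "'a::cstar_algebra set" where
  "scalar_circle = {scaleC z 1 | z. cmod z = 1}"


section \<open>Component groups and fundamental groups\<close>

definition pi0 :: "'a monoid \<Rightarrow> 'a topology \<Rightarrow> 'a set monoid" where
  "pi0 G X = G Mod connected_component_of_set X \<one>\<^bsub>G\<^esub>"

definition loops :: "'a topology \<Rightarrow> 'a \<Rightarrow> (real \<Rightarrow> 'a) set" where
  "loops X x = {g. pathin X g \<and> g 0 = x \<and> g 1 = x}"

definition loop_homotopy :: "'a topology \<Rightarrow> 'a \<Rightarrow> ((real \<Rightarrow> 'a) \<times> (real \<Rightarrow> 'a)) set" where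
  "loop_homotopy X x = {(g, h). g \<in> loops X x \<and> h \<in> loops X x \<and>
     homotopic_with (\<lambda>k. k 0 = x \<and> k 1 = x) (top_of_set {0..1}) X g h}"

definition loop_class :: "'a topology \<Rightarrow> 'a \<Rightarrow> (real \<Rightarrow> 'a) \<Rightarrow> (real \<Rightarrow> 'a) set" where
  "loop_class X x g = loop_homotopy X x `` {g}"

text \<open>
  Operations on quotients are written as unions over all representatives; whenever the class
  obtained does not depend on the representatives, the union is that class.
\<close>

definition pi1 :: "'a::topological_space topology \<Rightarrow> 'a \<Rightarrow> (real \<Rightarrow> 'a) set monoid" where
  "pi1 X x = \<lparr>carrier = loops X x // loop_homotopy X x,
     mult = (\<lambda>C D. \<Union>g\<in>C. \<Union>h\<in>D. loop_class X x (g +++ h)),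
     one = loop_class X x (\<lambda>_. x)\<rparr>"

definition pi1_map ::
  "'b topology \<Rightarrow> 'b \<Rightarrow> ('a \<Rightarrow> 'b) \<Rightarrow> (real \<Rightarrow> 'a) set \<Rightarrow> (real \<Rightarrow> 'b) set" where
  "pi1_map Y y f C = (\<Union>g\<in>C. loop_class Y y (f \<circ> g))"

definition coset_map :: "'b monoid \<Rightarrow> 'b set \<Rightarrow> ('a \<Rightarrow> 'b) \<Rightarrow> 'a set \<Rightarrow> 'b set" where
  "coset_map H N f C = (\<Union>u\<in>C. N #>\<^bsub>H\<^esub> f u)"

abbreviation unitary_top :: "'a::cstar_algebra topology" where
  "unitary_top \<equiv> top_of_set unitaries"

abbreviation pi0_U :: "'a::cstar_algebra set monoid" where
  "pi0_U \<equiv> pi0 unitary_group unitary_top"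

abbreviation pi1_U :: "(real \<Rightarrow> 'a::cstar_algebra) set monoid" where
  "pi1_U \<equiv> pi1 unitary_top 1"


section \<open>Matrices\<close>

text \<open>
  An \<open>n \<times> n\<close> matrix is an infinite matrix supported in the upper left \<open>n \<times> n\<close> corner.
  Invertible matrices are instead continued by the identity outside the corner, which turns the
  connecting maps \<open>u \<mapsto> u \<oplus> 1\<close> into inclusions. The products used below have finitely supported
  rows, so that \<open>Sum_any\<close> is a finite sum.
\<close>

type_synonym 'a nmat = "nat \<Rightarrow> nat \<Rightarrow> 'a"

definition mmult :: "'a::cstar_algebra nmat \<Rightarrow> 'a nmat \<Rightarrow> 'a nmat" where
  "mmult x y = (\<lambda>i j. Sum_any (\<lambda>k. x i k * y k j))"

definition mstar :: "'a::cstar_algebra nmat \<Rightarrow> 'a nmat" where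
  "mstar x = (\<lambda>i j. star (x j i))"

definition mone :: "'a::cstar_algebra nmat" where
  "mone = (\<lambda>i j. if i = j then 1 else 0)"

definition U_mat :: "nat \<Rightarrow> 'a::cstar_algebra nmat set" where
  "U_mat n = {u. (\<forall>i j. i \<ge> n \<or> j \<ge> n \<longrightarrow> u i j = mone i j) \<and>
     mmult (mstar u) u = mone \<and> mmult u (mstar u) = mone}"

definition U_inf :: "'a::cstar_algebra nmat set" where
  "U_inf = (\<Union>n. U_mat n)"

definition U_inf_group :: "'a::cstar_algebra nmat monoid" where
  "U_inf_group = \<lparr>carrier = U_inf, mult = mmult, one = mone\<rparr>"

text \<open>
  The inductive limit topology. On \<open>U_mat n\<close>, the topology of the function space (entrywise
  convergence) is the topology of the C*-norm of \<open>M\<^sub>n(A)\<close>.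
\<close>

definition U_inf_top :: "'a::cstar_algebra nmat topology" where
  "U_inf_top = topology (\<lambda>W. W \<subseteq> U_inf \<and> (\<forall>n. openin (top_of_set (U_mat n)) (W \<inter> U_mat n)))"

lemma openin_U_inf_top:
  "openin U_inf_top W \<longleftrightarrow> W \<subseteq> U_inf \<and> (\<forall>n. openin (top_of_set (U_mat n)) (W \<inter> U_mat n))"
proof -
  let ?P = "\<lambda>W :: 'a nmat set. W \<subseteq> U_inf \<and> (\<forall>n. openin (top_of_set (U_mat n)) (W \<inter> U_mat n))"
  have "?P (S \<inter> T)" if "?P S" "?P T" for S T
  proof -
    have "openin (top_of_set (U_mat n)) ((S \<inter> U_mat n) \<inter> (T \<inter> U_mat n))" for n
      using that by (blast intro: openin_Int)
    moreover have "(S \<inter> U_mat n) \<inter> (T \<inter> U_mat n) = S \<inter> T \<inter> U_mat n" for n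
      by blast
    ultimately show ?thesis
      using that by auto
  qed
  moreover have "?P (\<Union>K)" if "\<forall>S\<in>K. ?P S" for K
  proof -
    have "openin (top_of_set (U_mat n)) (\<Union>S\<in>K. S \<inter> U_mat n)" for n
      using that by (blast intro: openin_Union)
    moreover have "(\<Union>S\<in>K. S \<inter> U_mat n) = \<Union>K \<inter> U_mat n" for n
      by blast
    ultimately show ?thesis
      using that by auto
  qed
  ultimately have "istopology ?P"
    unfolding istopology_def by blast
  then show ?thesis
    by (simp add: U_inf_top_def)
qed

definition U_embed :: "'a::cstar_algebra \<Rightarrow> 'a nmat" where
  "U_embed u = (\<lambda>i j. if i = 0 \<and> j = 0 then u else mone i j)"


section \<open>Topological K-theory\<close>

definition U_inf_0 :: "'a::cstar_algebra nmat set" where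
  "U_inf_0 = path_component_of_set U_inf_top mone"

definition K1 :: "'a::cstar_algebra nmat set monoid" where
  "K1 = U_inf_group Mod U_inf_0"

definition corner :: "nat \<Rightarrow> nat \<Rightarrow> 'a::cstar_algebra nmat set" where
  "corner m n = {x. \<forall>i j. i \<ge> m \<or> j \<ge> n \<longrightarrow> x i j = 0}"

definition projections :: "nat \<Rightarrow> 'a::cstar_algebra nmat set" where
  "projections n = {p \<in> corner n n. mstar p = p \<and> mmult p p = p}"

text \<open>A matrix projection is a pair of its size and its entries.\<close>

definition P_inf :: "(nat \<times> 'a::cstar_algebra nmat) set" where
  "P_inf = (SIGMA n:UNIV. projections n)"

definition mvn_equiv :: "nat \<times> 'a::cstar_algebra nmat \<Rightarrow> nat \<times> 'a nmat \<Rightarrow> bool" where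
  "mvn_equiv P Q \<longleftrightarrow>
     (\<exists>v \<in> corner (fst Q) (fst P). mmult (mstar v) v = snd P \<and> mmult v (mstar v) = snd Q)"

definition dsum :: "nat \<times> 'a::cstar_algebra nmat \<Rightarrow> nat \<times> 'a nmat \<Rightarrow> nat \<times> 'a nmat" where
  "dsum P Q = (fst P + fst Q,
     (\<lambda>i j. if i < fst P \<and> j < fst P then snd P i j
            else if fst P \<le> i \<and> fst P \<le> j then snd Q (i - fst P) (j - fst P)
            else 0))"

text \<open>
  \<open>K0\<close> is the Grothendieck group of Murray-von Neumann classes of matrix projections; the pair
  \<open>(p, q)\<close> represents the formal difference \<open>[p] - [q]\<close>.
\<close>

type_synonym 'a k0 = "((nat \<times> 'a nmat) \<times> (nat \<times> 'a nmat)) set"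

definition K0_rel ::
  "(((nat \<times> 'a::cstar_algebra nmat) \<times> (nat \<times> 'a nmat)) \<times>
    ((nat \<times> 'a nmat) \<times> (nat \<times> 'a nmat))) set" where
  "K0_rel = {((p, q), (p', q')). {p, q, p', q'} \<subseteq> P_inf \<and>
     (\<exists>r \<in> P_inf. mvn_equiv (dsum (dsum p q') r) (dsum (dsum p' q) r))}"

definition K0_diff :: "nat \<times> 'a::cstar_algebra nmat \<Rightarrow> nat \<times> 'a nmat \<Rightarrow> 'a k0" where
  "K0_diff p q = K0_rel `` {(p, q)}"

definition zero_proj :: "nat \<times> 'a::cstar_algebra nmat" where
  "zero_proj = (0, (\<lambda>i j. 0))"

definition one_proj :: "nat \<times> 'a::cstar_algebra nmat" where
  "one_proj = (1, (\<lambda>i j. if i = 0 \<and> j = 0 then 1 else 0))"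

definition K0_class :: "nat \<times> 'a::cstar_algebra nmat \<Rightarrow> 'a k0" where
  "K0_class p = K0_diff p zero_proj"

definition K0 :: "'a::cstar_algebra k0 monoid" where
  "K0 = \<lparr>carrier = (P_inf \<times> P_inf) // K0_rel,
     mult = (\<lambda>C D. \<Union>(p, q)\<in>C. \<Union>(p', q')\<in>D. K0_diff (dsum p p') (dsum q q')),
     one = K0_class zero_proj\<rparr>"


section \<open>The canonical maps\<close>

definition canonical_pi0 :: "'a::cstar_algebra set \<Rightarrow> 'a nmat set" where
  "canonical_pi0 = coset_map U_inf_group U_inf_0 U_embed"

definition projection_loop :: "'a::cstar_algebra nmat \<Rightarrow> real \<Rightarrow> 'a nmat" where
  "projection_loop p t = (\<lambda>i j. scaleC (cis (2 * pi * t)) (p i j) + (mone i j - p i j))"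

text \<open>
  The identification \<open>\<pi>\<^sub>1(U\<^sub>\<infinity>(A)) \<cong> K\<^sub>0(A)\<close> of Bott periodicity. It is unique, on the carrier of
  \<open>\<pi>\<^sub>1\<close>, because the classes of projections generate \<open>K\<^sub>0(A)\<close>.
\<close>

definition bott_identification ::
  "((real \<Rightarrow> 'a::cstar_algebra nmat) set \<Rightarrow> 'a k0) \<Rightarrow> bool" where
  "bott_identification b \<longleftrightarrow> b \<in> iso (pi1 U_inf_top mone) K0 \<and>
     (\<forall>n. \<forall>p \<in> projections n. b (loop_class U_inf_top mone (projection_loop p)) = K0_class (n, p))"

definition is_canonical_pi1 :: "((real \<Rightarrow> 'a::cstar_algebra) set \<Rightarrow> 'a k0) \<Rightarrow> bool" where
  "is_canonical_pi1 k \<longleftrightarrow>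
     (\<exists>b. bott_identification b \<and>
       (\<forall>c \<in> carrier pi1_U. k c = b (pi1_map U_inf_top mone U_embed c)))"


section \<open>Traces\<close>

definition tracial_states :: "('a::cstar_algebra \<Rightarrow> complex) set" where
  "tracial_states = {\<tau>.
     (\<forall>a b. \<tau> (a + b) = \<tau> a + \<tau> b) \<and> (\<forall>c a. \<tau> (scaleC c a) = c * \<tau> a) \<and>
     (\<forall>a. \<tau> (star a * a) \<in> \<real>\<^sub>\<ge>\<^sub>0) \<and> \<tau> 1 = 1 \<and>
     (\<forall>a b. \<tau> (a * b) = \<tau> (b * a))}"

text \<open>
  Functions on \<open>T(A)\<close> are continued by \<open>0\<close>, so that the vector space operations and the order are
  the pointwise ones of the function type. Continuity is with respect to pointwise convergence on
  \<open>A\<close>, i.e. the weak* topology.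
\<close>

definition AffT :: "(('a::cstar_algebra \<Rightarrow> complex) \<Rightarrow> real) set" where
  "AffT = {f. continuous_on tracial_states f \<and>
     (\<forall>\<sigma> \<in> tracial_states. \<forall>\<tau> \<in> tracial_states. \<forall>t \<in> {0..1}.
        f (\<lambda>a. of_real (1 - t) * \<sigma> a + of_real t * \<tau> a) = (1 - t) * f \<sigma> + t * f \<tau>) \<and>
     (\<forall>\<tau>. \<tau> \<notin> tracial_states \<longrightarrow> f \<tau> = 0)}"

definition AffT_unit :: "('a::cstar_algebra \<Rightarrow> complex) \<Rightarrow> real" where
  "AffT_unit = (\<lambda>\<tau>. if \<tau> \<in> tracial_states then 1 else 0)"

definition AffT_hat :: "'a::cstar_algebra \<Rightarrow> ('a \<Rightarrow> complex) \<Rightarrow> real" where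
  "AffT_hat a = (\<lambda>\<tau>. if \<tau> \<in> tracial_states then Re (\<tau> a) else 0)"

definition unital_positive_map ::
  "((('a::cstar_algebra \<Rightarrow> complex) \<Rightarrow> real) \<Rightarrow> (('b::cstar_algebra \<Rightarrow> complex) \<Rightarrow> real)) \<Rightarrow> bool" where
  "unital_positive_map \<gamma> \<longleftrightarrow> \<gamma> \<in> AffT \<rightarrow> AffT \<and>
     (\<forall>f \<in> AffT. \<forall>g \<in> AffT. \<gamma> (\<lambda>\<tau>. f \<tau> + g \<tau>) = (\<lambda>\<tau>. \<gamma> f \<tau> + \<gamma> g \<tau>)) \<and>
     (\<forall>r. \<forall>f \<in> AffT. \<gamma> (\<lambda>\<tau>. r * f \<tau>) = (\<lambda>\<tau>. r * \<gamma> f \<tau>)) \<and>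
     (\<forall>f \<in> AffT. (\<forall>\<tau>. 0 \<le> f \<tau>) \<longrightarrow> (\<forall>\<tau>. 0 \<le> \<gamma> f \<tau>)) \<and>
     \<gamma> AffT_unit = AffT_unit"

definition matrix_trace ::
  "('a::cstar_algebra \<Rightarrow> complex) \<Rightarrow> nat \<times> 'a nmat \<Rightarrow> complex" where
  "matrix_trace \<tau> P = (\<Sum>i<fst P. \<tau> (snd P i i))"

definition rho :: "'a::cstar_algebra k0 \<Rightarrow> ('a \<Rightarrow> complex) \<Rightarrow> real" where
  "rho x = (\<lambda>\<tau>. if \<tau> \<in> tracial_states
     then (THE r. \<forall>(p, q) \<in> x. of_real r = matrix_trace \<tau> p - matrix_trace \<tau> q) else 0)"


section \<open>Morphisms\<close>

definition KTu_morphism ::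
  "('a::cstar_algebra k0 \<Rightarrow> 'b::cstar_algebra k0) \<Rightarrow> ('a nmat set \<Rightarrow> 'b nmat set) \<Rightarrow>
   ((('a \<Rightarrow> complex) \<Rightarrow> real) \<Rightarrow> (('b \<Rightarrow> complex) \<Rightarrow> real)) \<Rightarrow> bool" where
  "KTu_morphism \<alpha>0 \<alpha>1 \<gamma> \<longleftrightarrow>
     \<alpha>0 \<in> hom K0 K0 \<and> \<alpha>0 (K0_class one_proj) = K0_class one_proj \<and>
     \<alpha>1 \<in> hom K1 K1 \<and>
     unital_positive_map \<gamma> \<and>
     (\<forall>x \<in> carrier K0. \<gamma> (rho x) = rho (\<alpha>0 x))"

text \<open>
  What it means for \<open>(\<alpha>0, \<alpha>1, \<gamma>)\<close> to be induced by a homomorphism \<open>\<theta>\<close> of unitary groups. If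
  \<open>\<theta>\<close> preserves the scalar circle, then it acts there as \<open>z \<mapsto> z\<^sup>s\<close> with \<open>s = \<plusminus>1\<close>; in the case
  \<open>s = -1\<close> the maps that \<open>\<theta>\<close> induces on \<open>\<pi>\<^sub>1\<close> and on infinitesimal generators send the unit to
  minus the unit, which is why they are corrected by the sign \<open>s\<close>. The parameters \<open>kA\<close> and \<open>kB\<close>
  are the canonical maps \<open>\<pi>\<^sub>1(U(A)) \<rightarrow> K\<^sub>0(A)\<close> and \<open>\<pi>\<^sub>1(U(B)) \<rightarrow> K\<^sub>0(B)\<close>.
\<close>

definition KTu_induced_by ::
  "('a::cstar_algebra \<Rightarrow> 'b::cstar_algebra) \<Rightarrow>
   ((real \<Rightarrow> 'a) set \<Rightarrow> 'a k0) \<Rightarrow> ((real \<Rightarrow> 'b) set \<Rightarrow> 'b k0) \<Rightarrow>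
   ('a k0 \<Rightarrow> 'b k0) \<Rightarrow> ('a nmat set \<Rightarrow> 'b nmat set) \<Rightarrow>
   ((('a \<Rightarrow> complex) \<Rightarrow> real) \<Rightarrow> (('b \<Rightarrow> complex) \<Rightarrow> real)) \<Rightarrow> bool" where
  "KTu_induced_by \<theta> kA kB \<alpha>0 \<alpha>1 \<gamma> \<longleftrightarrow>
     (\<exists>s::int. s \<in> {1, -1} \<and>
       (\<forall>z. cmod z = 1 \<longrightarrow> \<theta> (scaleC z 1) = scaleC (z powi s) 1) \<and>
       (\<forall>c \<in> carrier pi1_U. \<alpha>0 (kA c) = kB (pi1_map unitary_top 1 \<theta> c) [^]\<^bsub>K0\<^esub> s) \<and>
       (\<forall>c \<in> carrier pi0_U. \<alpha>1 (canonical_pi0 c) =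
          canonical_pi0 (coset_map unitary_group (connected_component_of_set unitary_top 1) \<theta> c)) \<and>
       (\<forall>a \<in> selfadjoint. \<exists>b \<in> selfadjoint.
          (\<forall>t::real. \<theta> (exp (scaleC (\<i> * of_real t) a)) = exp (scaleC (\<i> * of_real t) b)) \<and>
          \<gamma> (AffT_hat a) = (\<lambda>\<tau>. of_int s * AffT_hat b \<tau>)))"

end

theory Submission
  imports Defs "HOL-Library.Multiset"
begin

text \<open>
  For selfadjoint \<open>a\<close>, the homomorphism \<open>\<theta>\<close> maps \<open>exp(ita)\<close> to a norm continuous one-parameter group
  \<open>exp(itS(a))\<close>. Contractivity makes \<open>S\<close> real linear and contractive, and since \<open>\<theta>\<close> is injective and
  preserves the circle of scalars, \<open>S(1) = s = \<plusminus>1\<close>. Hence \<open>\<tau> \<mapsto> s \<tau> S\<close> maps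
  \<open>T(B)\<close> to \<open>T(A)\<close>: it yields traces because
  \<open>S(uau\<^sup>*) = \<theta>(u) S(a) \<theta>(u)\<^sup>*\<close>, and positive functionals because it yields unital contractive ones.
  Composition with this map is \<open>\<gamma>\<close>, while \<open>\<alpha>0\<close> and \<open>\<alpha>1\<close> are transported from \<open>\<pi>\<^sub>1\<close> and \<open>\<pi>\<^sub>0\<close>.

  For \<open>\<gamma> \<rho> = \<rho> \<alpha>0\<close>, the pairing of \<open>\<tau>\<close> with the class of a loop \<open>u\<close> is computed as
  \<open>(2\<pi>i)\<^sup>-\<^sup>1 \<Sum>\<^sub>j \<tau>(log(u(t\<^sub>j)\<^sup>* u(t\<^sub>j\<^sub>+\<^sub>1)))\<close> over a fine partition. This is homotopy invariant, also in matrices,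
  since \<open>\<tau> log\<close> is additive near \<open>1\<close>, and it gives \<open>\<tau>(p)\<close> on the loop of a projection \<open>p\<close>. For a loop in
  \<open>U(A)\<close> the factors are \<open>exp(ih)\<close> with small \<open>h\<close>, and \<open>\<theta>\<close> replaces \<open>h\<close> by \<open>S(h)\<close>.
\<close>

section \<open>Logarithms in Banach algebras\<close>

text \<open>A class in K_0(A) is given by projections in matrices of arbitrary size, whereas
  \<open>\<theta>\<close> acts on U(A) only. Surjectivity of \<open>kA\<close> represents each class
  by a loop in U(A), but evaluating \<open>rho\<close> on it means comparing that loop with
  projection loops in \<open>U_inf\<close>, and there matrices are unavoidable. Three choices keep
  this elementary. Loops are merely continuous, so the determinant is a sum over a partition and not
  the integral of a logarithmic derivative; equalities hold for all sufficiently fine regular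
  partitions, not just in the limit. In matrices only the trace of a logarithm is formed, so an
  incomplete normed algebra suffices and the C*-norm of a matrix algebra is avoided. Spectral theory
  is replaced by exponentials and norm estimates: a tracial state is recognised as a unital tracial
  functional that is real and contractive on selfadjoint elements. The sign s has to be carried
  through, as complex conjugation on A = B = C shows.\<close>

lemma norm_power_diff_le:
  fixes x y :: "'a::real_normed_algebra_1"
  assumes "norm x \<le> r" "norm y \<le> r"
  shows "norm (x ^ n - y ^ n) \<le> n * r ^ (n - 1) * norm (x - y)"
proof (induction n)
  case 0
  then show ?case by simp
next
  case (Suc n)
  have r: "0 \<le> r" using assms(1) norm_ge_zero order_trans by blast
  have "x ^ Suc n - y ^ Suc n = x * (x ^ n - y ^ n) + (x - y) * y ^ n"
    by (simp add: algebra_simps)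
  then have "norm (x ^ Suc n - y ^ Suc n) \<le> norm x * norm (x ^ n - y ^ n) + norm (x - y) * norm (y ^ n)"
    by (metis add_mono norm_mult_ineq norm_triangle_le)
  also have "\<dots> \<le> r * (n * r ^ (n - 1) * norm (x - y)) + norm (x - y) * r ^ n"
    using assms r Suc.IH
    by (intro add_mono mult_mono order_trans[OF norm_power_ineq] power_mono) auto
  also have "\<dots> = Suc n * r ^ (Suc n - 1) * norm (x - y)"
    by (cases n) (auto simp: algebra_simps)
  finally show ?case .
qed

text \<open>Subtracting the identity removes the terms n = 0 and n = 1 of the difference of the
  series; for the others n / n! = 1 / (n - 1)!, and the bounds add up to the series of exp r -
  1.\<close>

lemma exp_minus_id_lipschitz:
  fixes x y :: "'a::{real_normed_algebra_1,banach}"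
  assumes "norm x \<le> r" "norm y \<le> r"
  shows "norm ((exp x - x) - (exp y - y)) \<le> (exp r - 1) * norm (x - y)"
proof -
  define d where "d n = (x ^ n - y ^ n) /\<^sub>R fact n" for n
  have "d sums (exp x - exp y)"
    unfolding d_def scaleR_diff_right by (intro sums_diff exp_converges)
  then have "(\<lambda>n. d (n + 2)) sums (exp x - exp y - (\<Sum>i<2. d i))"
    by (rule sums_split_initial_segment)
  moreover have "(\<Sum>i<2. d i) = x - y"
    by (simp add: d_def numeral_2_eq_2)
  ultimately have s: "(\<lambda>n. d (n + 2)) sums ((exp x - x) - (exp y - y))"
    by (simp add: algebra_simps)
  have r: "0 \<le> r" using assms(1) norm_ge_zero order_trans by blast
  have e: "(\<lambda>n. r ^ Suc n / fact (Suc n)) sums (exp r - 1)"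
    using sums_split_initial_segment[OF exp_converges[of r], of 1] by (simp add: divide_inverse mult.commute)
  then have g: "(\<lambda>n. r ^ Suc n / fact (Suc n) * norm (x - y)) sums ((exp r - 1) * norm (x - y))"
    by (rule sums_mult2)
  have b: "norm (d (n + 2)) \<le> r ^ Suc n / fact (Suc n) * norm (x - y)" for n
  proof -
    have "norm (d (n + 2)) = norm (x ^ (n + 2) - y ^ (n + 2)) / fact (n + 2)"
      by (simp add: d_def divide_inverse mult.commute)
    also have "\<dots> \<le> ((n + 2) * r ^ (n + 2 - 1) * norm (x - y)) / fact (n + 2)"
      by (intro divide_right_mono norm_power_diff_le[OF assms]) auto
    also have "\<dots> = r ^ Suc n / fact (Suc n) * norm (x - y)"
    proof -
      have "(fact (n + 2) :: real) = real (n + 2) * fact (Suc n)"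
        by (simp add: algebra_simps)
      then show ?thesis by (simp del: fact_Suc)
    qed
    finally show ?thesis .
  qed
  show ?thesis
    using norm_suminf_le[OF b sums_summable[OF g]] s g by (simp add: sums_iff)
qed

text \<open>The radius 1/4 that recurs below comes from here: exp (1/4) - 1 is at most 1/2, so on
  this ball exp is the identity plus a contraction. Hence it is injective there, and a fixed point
  argument inverts it near 1.\<close>

lemma exp_minus_id_contraction:
  fixes x y :: "'a::{real_normed_algebra_1,banach}"
  assumes "norm x \<le> 1/4" "norm y \<le> 1/4"
  shows "norm ((exp x - x) - (exp y - y)) \<le> norm (x - y) / 2"
proof -
  have "exp (1/4::real) - 1 \<le> 1/2"
    using exp_bound_lemma[of "1/4::real"] by simp
  then have "(exp (1/4) - 1) * norm (x - y) \<le> 1/2 * norm (x - y)"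
    by (intro mult_right_mono) auto
  then show ?thesis
    using exp_minus_id_lipschitz[OF assms] by linarith
qed

lemma exp_inj_small:
  fixes x y :: "'a::{real_normed_algebra_1,banach}"
  assumes "norm x \<le> 1/4" "norm y \<le> 1/4" "exp x = exp y"
  shows "x = y"
  using exp_minus_id_contraction[OF assms(1,2)] assms(3) by (simp add: norm_minus_commute)

text \<open>A logarithm of w is a fixed point of x -> w - (exp x - x). This contraction maps 0 to w
  - 1 and so preserves the ball of radius 1/4 because 1/8 + 1/8 = 1/4. The factor 2 comes from norm
  x <= norm x / 2 + norm (w - 1).\<close>

lemma exp_surj_near_one:
  fixes w :: "'a::{real_normed_algebra_1,banach}"
  assumes w: "norm (w - 1) \<le> 1/8"
  obtains x where "exp x = w" "norm x \<le> 2 * norm (w - 1)"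
proof -
  define g where "g x = w - (exp x - x)" for x
  have g: "norm (g x - g y) \<le> norm (x - y) / 2" if "norm x \<le> 1/4" "norm y \<le> 1/4" for x y
  proof -
    have "g x - g y = - ((exp x - x) - (exp y - y))" by (simp add: g_def)
    then show ?thesis by (metis exp_minus_id_contraction[OF that] norm_minus_cancel)
  qed
  have b: "norm (g x) \<le> norm x / 2 + norm (w - 1)" if "norm x \<le> 1/4" for x
    using g[OF that, of 0] norm_triangle_ineq2[of "g x" "g 0"] by (simp add: g_def)
  have "\<exists>!x. x \<in> cball 0 (1/4) \<and> g x = x"
  proof (rule Banach_fix)
    show "complete (cball (0::'a) (1/4))" by (simp add: complete_eq_closed)
    show "g ` cball 0 (1/4) \<subseteq> cball 0 (1/4)"
    proof clarsimp
      fix x :: 'a assume "norm x * 4 \<le> 1"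
      then show "norm (g x) * 4 \<le> 1" using b[of x] w by simp
    qed
    show "dist (g x) (g y) \<le> (1/2) * dist x y" if "x \<in> cball 0 (1/4)" "y \<in> cball 0 (1/4)" for x y
      using that g[of x y] by (simp add: dist_norm)
  qed auto
  then obtain x where x: "norm x \<le> 1/4" "g x = x" by auto
  have "exp x = w" using x(2) by (simp add: g_def algebra_simps)
  moreover have "norm x \<le> 2 * norm (w - 1)" using b[OF x(1)] x(2) by simp
  ultimately show ?thesis using that by blast
qed

section \<open>One-parameter groups\<close>

lemma exp_double: "exp (2 *\<^sub>R x) = exp x * exp (x :: 'a::{real_normed_algebra_1,banach})"
  by (simp add: scaleR_2 exp_add_commuting)

lemma exp_scaleR_of_nat: "exp (real n *\<^sub>R x) = exp x ^ n"
  for x :: "'a::{real_normed_algebra_1,banach}"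
proof (induction n)
  case (Suc n)
  have "exp (real (Suc n) *\<^sub>R x) = exp (x + real n *\<^sub>R x)" by (simp add: algebra_simps)
  also have "\<dots> = exp x * exp (real n *\<^sub>R x)" by (rule exp_add_commuting) simp
  finally show ?case using Suc by simp
qed simp

text \<open>Continuity gives no derivative directly. Uniqueness of small logarithms yields L(t) = 2
  L(t/2) near 0, so f agrees with exp(tX) at all dyadic multiples of \<delta>; these are dense in
  the half-line, and negative t follow by inversion.\<close>

lemma one_parameter_group_is_exp:
  fixes f :: "real \<Rightarrow> 'a::{real_normed_algebra_1,banach}"
  assumes add: "\<And>s t. f (s + t) = f s * f t" and one: "f 0 = 1" and cont: "continuous_on UNIV f"
  obtains X where "\<And>t. f t = exp (t *\<^sub>R X)"
proof -
  have "isCont f 0" using cont by (simp add: continuous_on_eq_continuous_at)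
  then obtain e where e: "e > 0" "\<And>t. \<bar>t\<bar> < e \<Longrightarrow> norm (f t - 1) < 1/16"
  proof -
    have "\<exists>d>0. \<forall>t. dist t 0 < d \<longrightarrow> dist (f t) (f 0) < 1/16"
      using \<open>isCont f 0\<close> unfolding continuous_at_eps_delta
      by (meson zero_less_divide_1_iff zero_less_numeral)
    then obtain d where d: "d > 0" "\<And>t. dist t 0 < d \<Longrightarrow> dist (f t) (f 0) < 1/16" by blast
    show ?thesis
    proof (rule that)
      show "d > 0" by fact
      fix t :: real assume "\<bar>t\<bar> < d"
      then show "norm (f t - 1) < 1/16" using d(2)[of t] one by (simp add: dist_norm)
    qed
  qed
  define \<delta> where "\<delta> = e / 2"
  have \<delta>: "\<delta> > 0" "\<And>t. \<bar>t\<bar> \<le> \<delta> \<Longrightarrow> norm (f t - 1) \<le> 1/16"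
    using e by (auto simp: \<delta>_def intro: less_imp_le)
  \<comment> \<open>The bound 1/8, twice 1/16, leaves room for one doubling inside the ball of
    radius 1/4 on which exp is injective.\<close>
  have "\<exists>x. exp x = f t \<and> norm x \<le> 1/8" if "\<bar>t\<bar> \<le> \<delta>" for t
  proof -
    have n: "norm (f t - 1) \<le> 1/16" by (rule \<delta>(2)[OF that])
    then have "norm (f t - 1) \<le> 1/8" by simp
    then obtain x where "exp x = f t" "norm x \<le> 2 * norm (f t - 1)" by (rule exp_surj_near_one)
    then show ?thesis using n by (intro exI[of _ x]) simp
  qed
  then obtain L where L: "\<And>t. \<bar>t\<bar> \<le> \<delta> \<Longrightarrow> exp (L t) = f t \<and> norm (L t) \<le> 1/8"
    by metis
  have half: "L t = 2 *\<^sub>R L (t / 2)" if "\<bar>t\<bar> \<le> \<delta>" for t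
  proof (rule exp_inj_small)
    have t2: "\<bar>t / 2\<bar> \<le> \<delta>" using that by auto
    show "norm (L t) \<le> 1/4" using L[OF that] by simp
    show "norm (2 *\<^sub>R L (t / 2)) \<le> 1/4" using L[OF t2] by simp
    have "f (t/2) * f (t/2) = f t" using add[of "t/2" "t/2"] by simp
    then show "exp (L t) = exp (2 *\<^sub>R L (t / 2))"
      using L[OF that] L[OF t2] exp_double[of "L (t/2)"] by simp
  qed
  have pow: "L (\<delta> / 2 ^ n) = L \<delta> /\<^sub>R 2 ^ n" for n
  proof (induction n)
    case (Suc n)
    have "\<bar>\<delta> / 2 ^ n\<bar> \<le> \<delta>" using \<delta>(1) by (simp add: field_simps)
    then have "2 *\<^sub>R L (\<delta> / 2 ^ n / 2) = L \<delta> /\<^sub>R 2 ^ n" using half[of "\<delta> / 2 ^ n"] Suc by simp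
    then have "(1/2) *\<^sub>R (2 *\<^sub>R L (\<delta> / 2 ^ n / 2)) = (1/2) *\<^sub>R (L \<delta> /\<^sub>R 2 ^ n)" by simp
    then show ?case by (simp add: field_simps)
  qed simp
  have fpow: "f (real k * t) = f t ^ k" for k t
    by (induction k) (auto simp: one add algebra_simps)
  define X where "X = L \<delta> /\<^sub>R \<delta>"
  have dy: "f (real k * (\<delta> / 2 ^ n)) = exp ((real k * (\<delta> / 2 ^ n)) *\<^sub>R X)" for k n
  proof -
    have "\<bar>\<delta> / 2 ^ n\<bar> \<le> \<delta>" using \<delta>(1) by (simp add: field_simps)
    then have "f (\<delta> / 2 ^ n) = exp (L \<delta> /\<^sub>R 2 ^ n)" using L pow by metis
    then have "f (real k * (\<delta> / 2 ^ n)) = exp (real k *\<^sub>R (L \<delta> /\<^sub>R 2 ^ n))"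
      by (simp only: fpow exp_scaleR_of_nat)
    also have "real k *\<^sub>R (L \<delta> /\<^sub>R 2 ^ n) = (real k * (\<delta> / 2 ^ n)) *\<^sub>R X"
      using \<delta>(1) by (simp add: X_def divide_inverse)
    finally show ?thesis .
  qed
  have pos: "f t = exp (t *\<^sub>R X)" if "t \<ge> 0" for t
  proof -
    define k where "k n = nat \<lfloor>t * 2 ^ n / \<delta>\<rfloor>" for n :: nat
    have lim: "(\<lambda>n. real (k n) * (\<delta> / 2 ^ n)) \<longlonglongrightarrow> t"
    proof (rule LIMSEQ_I)
      fix r :: real assume "r > 0"
      obtain N where N: "(1/2)^N < r / \<delta>"
        using \<open>r > 0\<close> \<delta>(1) real_arch_pow_inv[of "r / \<delta>" "1/2"] by auto
      have "norm (real (k n) * (\<delta> / 2 ^ n) - t) < r" if "n \<ge> N" for n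
      proof -
        have "real (k n) = of_int \<lfloor>t * 2 ^ n / \<delta>\<rfloor>"
          using \<open>t \<ge> 0\<close> \<delta>(1) by (simp add: k_def)
        then have "\<bar>real (k n) - t * 2 ^ n / \<delta>\<bar> < 1" by linarith
        then have "\<bar>real (k n) - t * 2 ^ n / \<delta>\<bar> * (\<delta> / 2 ^ n) < 1 * (\<delta> / 2 ^ n)"
            using \<delta>(1) by (intro mult_strict_right_mono) auto
          then have "\<bar>real (k n) - t * 2 ^ n / \<delta>\<bar> * (\<delta> / 2 ^ n) < \<delta> / 2 ^ n" by simp
        also have "\<dots> = \<delta> * (1/2)^n" by (simp add: power_one_over)
        also have "\<dots> \<le> \<delta> * (1/2)^N" using \<delta>(1) that by (intro mult_left_mono power_decreasing) auto
        also have "\<dots> < r" using N \<delta>(1) by (simp add: field_simps)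
        finally have "\<bar>(real (k n) - t * 2 ^ n / \<delta>) * (\<delta> / 2 ^ n)\<bar> < r"
          using \<delta>(1) by (simp add: abs_mult)
        then show ?thesis using \<delta>(1) by (simp add: algebra_simps)
      qed
      then show "\<exists>N. \<forall>n\<ge>N. norm (real (k n) * (\<delta> / 2 ^ n) - t) < r" by blast
    qed
    have "(\<lambda>n. f (real (k n) * (\<delta> / 2 ^ n))) \<longlonglongrightarrow> f t"
      using isCont_tendsto_compose[OF _ lim, of f] cont by (simp add: continuous_on_eq_continuous_at)
    moreover have "(\<lambda>n. exp ((real (k n) * (\<delta> / 2 ^ n)) *\<^sub>R X)) \<longlonglongrightarrow> exp (t *\<^sub>R X)"
      using isCont_tendsto_compose[OF has_vector_derivative_continuous[OF exp_scaleR_has_vector_derivative_right] lim] .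
    ultimately show ?thesis using dy LIMSEQ_unique by auto
  qed
  have "f t = exp (t *\<^sub>R X)" for t
  proof (cases "t \<ge> 0")
    case False
    have a: "f t * f (-t) = 1" using add[of t "-t"] one by simp
    have b: "f (-t) * exp (t *\<^sub>R X) = 1"
      using pos[of "-t"] False exp_minus_inverse[of "-(t *\<^sub>R X)"] by simp
    show ?thesis by (metis a b mult.assoc mult_1_left mult_1_right)
  qed (rule pos)
  then show ?thesis using that by blast
qed

section \<open>The trace of the logarithm\<close>

text \<open>The series of \<open>T (log w)\<close>. Only scalar series occur, so that the algebra need not be complete.\<close>

definition log_trace :: "('m::real_normed_algebra_1 \<Rightarrow> complex) \<Rightarrow> 'm \<Rightarrow> complex" where
  "log_trace T w = - suminf (\<lambda>n. T ((1 - w) ^ Suc n) / of_nat (Suc n))"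

text \<open>The truncation can be differentiated as a finite sum. Analytic facts are proved for it
  with an error of order r^N and then passed to the limit, so that no infinite series is ever
  differentiated.\<close>

definition log_trace_partial :: "('m::real_normed_algebra_1 \<Rightarrow> complex) \<Rightarrow> nat \<Rightarrow> 'm \<Rightarrow> complex" where
  "log_trace_partial T N w = - (\<Sum>n<N. T ((1 - w) ^ Suc n) / of_nat (Suc n))"

text \<open>The truncated Neumann series, an inverse of 1 - y up to the error y^N; in a normed
  algebra that is not complete the full series need not converge.\<close>

definition geometric_sum :: "nat \<Rightarrow> 'm::real_normed_algebra_1 \<Rightarrow> 'm" where
  "geometric_sum N y = (\<Sum>n<N. y ^ n)"

lemma geometric_sum_mult_left: "(1 - y) * geometric_sum N y = 1 - y ^ N"
proof (induction N)
  case (Suc N)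
  have "(1 - y) * geometric_sum (Suc N) y = (1 - y) * geometric_sum N y + (1 - y) * y ^ N"
    by (simp add: geometric_sum_def distrib_left)
  also have "\<dots> = 1 - y ^ Suc N" unfolding Suc by (simp add: left_diff_distrib)
  finally show ?case .
qed (simp add: geometric_sum_def)

lemma geometric_sum_mult_right: "geometric_sum N y * (1 - y) = 1 - y ^ N"
proof (induction N)
  case (Suc N)
  have "geometric_sum (Suc N) y * (1 - y) = geometric_sum N y * (1 - y) + y ^ N * (1 - y)"
    by (simp add: geometric_sum_def distrib_right)
  also have "\<dots> = 1 - y ^ Suc N" unfolding Suc by (simp add: right_diff_distrib power_commutes)
  finally show ?case .
qed (simp add: geometric_sum_def)

lemma norm_geometric_sum_le:
  assumes "norm y \<le> 1/2"
  shows "norm (geometric_sum N y) \<le> 2"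
proof -
  have "norm (geometric_sum N y) \<le> (\<Sum>n<N. norm (y ^ n))"
    unfolding geometric_sum_def by (rule norm_sum)
  also have "\<dots> \<le> (\<Sum>n<N. (1/2) ^ n)"
    by (intro sum_mono order_trans[OF norm_power_ineq] power_mono assms) auto
  also have "\<dots> \<le> 2"
    by (simp add: sum_gp0 sum_gp_strict)
  finally show ?thesis .
qed

lemma norm_increment_le:
  fixes g :: "real \<Rightarrow> 'a::real_normed_vector"
  assumes g: "\<And>t. t \<in> {0..1} \<Longrightarrow> (g has_vector_derivative g' t) (at t)"
    and B: "\<And>t. t \<in> {0..1} \<Longrightarrow> norm (g' t) \<le> B"
  shows "norm (g 1 - g 0) \<le> B"
proof -
  have "norm (g 1 - g 0) \<le> B * 1 - B * 0"
  proof (rule differentiable_bound_general[where f' = g' and \<phi>' = "\<lambda>_. B"])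
    show "continuous_on {0..1} g"
      using g has_vector_derivative_continuous continuous_at_imp_continuous_on by blast
    show "continuous_on {0..1} ((*) B)" by (intro continuous_intros)
    show "((*) B has_vector_derivative B) (at x)" for x
      by (auto intro!: derivative_eq_intros simp: has_real_derivative_iff_has_vector_derivative[symmetric])
  qed (use g B in auto)
  then show ?thesis by simp
qed

lemma LIMSEQ_geometric_bound_imp_zero:
  fixes g :: "nat \<Rightarrow> 'a::real_normed_vector"
  assumes "g \<longlonglongrightarrow> l" and b: "\<And>N. norm (g N) \<le> C * r ^ N" and r: "0 \<le> r" "r < 1"
  shows "l = 0"
proof -
  have "(\<lambda>N. C * r ^ N) \<longlonglongrightarrow> C * 0"
    by (intro tendsto_intros LIMSEQ_realpow_zero r)
  then have "g \<longlonglongrightarrow> 0"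
    using b by (intro Lim_null_comparison[of g "\<lambda>N. C * r ^ N"]) auto
  then show ?thesis using assms(1) LIMSEQ_unique by blast
qed

text \<open>The two instances are a tracial state on the C*-algebra itself and its sum along the
  diagonal of matrices, \<open>umat_trace\<close>.\<close>

locale bounded_trace = bounded_linear T for T :: "'m::real_normed_algebra_1 \<Rightarrow> complex" +
  assumes commute: "T (x * y) = T (y * x)"
begin

lemma log_trace_partial_LIMSEQ:
  assumes w: "norm (1 - w) < 1"
  shows "(\<lambda>N. log_trace_partial T N w) \<longlonglongrightarrow> log_trace T w"
proof -
  obtain K where K: "K > 0" "\<And>x. norm (T x) \<le> norm x * K" using pos_bounded by blast
  have "summable (\<lambda>n. T ((1 - w) ^ Suc n) / of_nat (Suc n))"
  proof (rule summable_comparison_test')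
    show "summable (\<lambda>n. K * norm (1 - w) ^ n)"
      using w by (intro summable_mult summable_geometric) auto
    fix n :: nat
    have "norm (T ((1 - w) ^ Suc n) / of_nat (Suc n)) \<le> norm (T ((1 - w) ^ Suc n))"
      unfolding norm_divide norm_of_nat by (simp add: divide_le_eq mult_le_cancel_left1)
    also have "\<dots> \<le> norm ((1 - w) ^ Suc n) * K" by (rule K)
    also have "\<dots> \<le> norm (1 - w) ^ Suc n * K"
      using K(1) by (intro mult_right_mono norm_power_ineq) auto
    also have "\<dots> \<le> norm (1 - w) ^ n * K"
      using K(1) w by (intro mult_right_mono power_decreasing) auto
    finally show "norm (T ((1 - w) ^ Suc n) / of_nat (Suc n)) \<le> K * norm (1 - w) ^ n"
      by (simp add: mult.commute)
  qed
  then show ?thesis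
    unfolding log_trace_partial_def log_trace_def
    by (intro tendsto_minus summable_LIMSEQ)
qed

text \<open>As y and y' need not commute, the rule n y^(n-1) y' holds only under the trace. The
  multiplier c serves the induction: the case c = 1 for n + 1 calls for the case c = y(t) for
  n.\<close>

lemma power_has_vector_derivative_trace:
  assumes y: "(y has_vector_derivative y') (at t)"
  obtains D where "((\<lambda>t. y t ^ n) has_vector_derivative D) (at t)"
    "\<And>c. c * y t = y t * c \<Longrightarrow> T (c * D) = of_nat n * T (c * y t ^ (n - 1) * y')"
proof -
  have "\<exists>D. ((\<lambda>t. y t ^ n) has_vector_derivative D) (at t) \<and>
    (\<forall>c. c * y t = y t * c \<longrightarrow> T (c * D) = of_nat n * T (c * y t ^ (n - 1) * y'))"
  proof (induction n)
    case 0
    have "((\<lambda>t. y t ^ 0) has_vector_derivative 0) (at t)" by simp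
    then show ?case by (intro exI[of _ 0]) (simp add: zero)
  next
    case (Suc n)
    then obtain D where D: "((\<lambda>t. y t ^ n) has_vector_derivative D) (at t)"
      and c: "\<And>c. c * y t = y t * c \<Longrightarrow> T (c * D) = of_nat n * T (c * y t ^ (n - 1) * y')"
      by blast
    have "((\<lambda>t. y t ^ Suc n) has_vector_derivative (y t * D + y' * y t ^ n)) (at t)"
      using has_vector_derivative_mult[OF y D] by simp
    moreover have "T (c * (y t * D + y' * y t ^ n)) = of_nat (Suc n) * T (c * y t ^ n * y')"
      if cy: "c * y t = y t * c" for c
    proof -
      have cyn: "y t ^ n * c = c * y t ^ n" using cy by (metis power_commuting_commutes)
      have "T (c * (y t * D)) = T ((c * y t) * D)" by (simp add: mult.assoc)
      also have "\<dots> = of_nat n * T (c * y t * y t ^ (n - 1) * y')"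
        by (rule c) (metis cy mult.assoc)
      also have "\<dots> = of_nat n * T (c * y t ^ n * y')"
        by (cases n) (simp_all add: mult.assoc)
      finally have 1: "T (c * (y t * D)) = of_nat n * T (c * y t ^ n * y')" .
      have "T (c * (y' * y t ^ n)) = T ((c * y') * y t ^ n)" by (simp add: mult.assoc)
      also have "\<dots> = T (y t ^ n * (c * y'))" by (rule commute)
      also have "\<dots> = T (c * y t ^ n * y')" by (simp add: mult.assoc[symmetric] cyn)
      finally have 2: "T (c * (y' * y t ^ n)) = T (c * y t ^ n * y')" .
      show ?thesis by (simp add: distrib_left add 1 2 algebra_simps)
    qed
    ultimately show ?case by (intro exI[of _ "y t * D + y' * y t ^ n"]) simp
  qed
  then show ?thesis using that by blast
qed

text \<open>The truncated form of d T(log w) = T(w^-1 w').\<close>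

lemma log_trace_partial_has_vector_derivative:
  assumes w: "(w has_vector_derivative w') (at t)"
  shows "((\<lambda>t. log_trace_partial T N (w t)) has_vector_derivative T (geometric_sum N (1 - w t) * w')) (at t)"
proof -
  have y: "((\<lambda>t. 1 - w t) has_vector_derivative - w') (at t)"
    using w by (auto intro!: derivative_eq_intros)
  have "((\<lambda>t. - (T ((1 - w t) ^ Suc n) / of_nat (Suc n))) has_vector_derivative T ((1 - w t) ^ n * w')) (at t)" for n
  proof -
    obtain D where D: "((\<lambda>t. (1 - w t) ^ Suc n) has_vector_derivative D) (at t)"
      and c: "\<And>c. c * (1 - w t) = (1 - w t) * c \<Longrightarrow>
        T (c * D) = of_nat (Suc n) * T (c * (1 - w t) ^ (Suc n - 1) * - w')"
      using power_has_vector_derivative_trace[OF y, of "Suc n"] by blast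
    have TD: "T D = of_nat (Suc n) * - T ((1 - w t) ^ n * w')" using c[of 1] by (simp add: neg)
    have "((\<lambda>t. T ((1 - w t) ^ Suc n)) has_vector_derivative T D) (at t)"
      by (rule has_vector_derivative[OF D])
    from bounded_linear.has_vector_derivative[OF bounded_linear_mult_left this, of "- (1 / of_nat (Suc n))"]
    show ?thesis unfolding TD by (simp add: field_simps del: of_nat_Suc)
  qed
  then have "((\<lambda>t. \<Sum>n<N. - (T ((1 - w t) ^ Suc n) / of_nat (Suc n))) has_vector_derivative
      (\<Sum>n<N. T ((1 - w t) ^ n * w'))) (at t)"
    by (intro has_vector_derivative_sum) auto
  then show ?thesis
    unfolding log_trace_partial_def geometric_sum_def by (simp add: sum_distrib_right sum sum_negf)
qed

lemma log_trace_partial_one [simp]: "log_trace_partial T N 1 = 0"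
  by (simp add: log_trace_partial_def zero)

lemma log_trace_one [simp]: "log_trace T 1 = 0"
  by (simp add: log_trace_def zero)

text \<open>The curve is exp(tx), but characterising it by its differential equation makes the rule
  usable in the incomplete matrix algebra as well. The truncated derivative is T(x) minus the trace
  of (1 - w)^N x.\<close>

lemma log_trace_curve:
  assumes w: "\<And>t. t \<in> {0..1} \<Longrightarrow> (w has_vector_derivative w t * x) (at t)"
    and one: "w 0 = 1" and r: "r < 1" and b: "\<And>t. t \<in> {0..1} \<Longrightarrow> norm (1 - w t) \<le> r"
  shows "log_trace T (w 1) = T x"
proof -
  obtain K where K: "K > 0" "\<And>x. norm (T x) \<le> norm x * K" using pos_bounded by blast
  have r0: "0 \<le> r" by (rule order_trans[OF norm_ge_zero b[of 0]]) simp
  have bound: "norm (log_trace_partial T N (w 1) - T x) \<le> (norm x * K) * r ^ N" for N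
  proof -
    define g where "g t = log_trace_partial T N (w t) - t *\<^sub>R T x" for t
    have "norm (g 1 - g 0) \<le> (norm x * K) * r ^ N"
    proof (rule norm_increment_le)
      fix t :: real assume t: "t \<in> {0..1}"
      let ?y = "1 - w t"
      have e: "geometric_sum N ?y * (w t * x) = x - ?y ^ N * x"
      proof -
        have "geometric_sum N ?y * w t = 1 - ?y ^ N" using geometric_sum_mult_right[of N ?y] by simp
        then have "geometric_sum N ?y * w t * x = (1 - ?y ^ N) * x" by simp
        then show ?thesis by (simp only: mult.assoc left_diff_distrib mult_1_left)
      qed
      show "(g has_vector_derivative - T (?y ^ N * x)) (at t)"
        unfolding g_def
        by (rule derivative_eq_intros log_trace_partial_has_vector_derivative w t | simp add: e diff)+
      have "norm (T (?y ^ N * x)) \<le> norm (?y ^ N * x) * K" by (rule K)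
      also have "\<dots> \<le> (r ^ N * norm x) * K"
        using K(1) r0 b[OF t]
        by (intro mult_right_mono order_trans[OF norm_mult_ineq] order_trans[OF norm_power_ineq] power_mono) auto
      finally show "norm (- T (?y ^ N * x)) \<le> (norm x * K) * r ^ N" by (simp add: algebra_simps)
    qed
    then show ?thesis by (simp add: g_def one)
  qed
  have "norm (1 - w 1) < 1" using b[of 1] r by simp
  then have "(\<lambda>N. log_trace_partial T N (w 1) - T x) \<longlonglongrightarrow> log_trace T (w 1) - T x"
    by (intro tendsto_intros log_trace_partial_LIMSEQ)
  from LIMSEQ_geometric_bound_imp_zero[OF this bound r0 r] show ?thesis by simp
qed

text \<open>The derivatives of the partial sums of both sides along \<open>t \<mapsto> 1 + t (w - 1)\<close> differ by
  \<open>O(2\<^sup>-\<^sup>N)\<close>; this replaces the inverse of \<open>1 + t (w - 1)\<close>, which need not exist.\<close>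

lemma log_trace_mult:
  assumes v: "norm (v - 1) \<le> 1/8" and w: "norm (w - 1) \<le> 1/8"
  shows "log_trace T (v * w) = log_trace T v + log_trace T w"
proof -
  obtain K where K: "K > 0" "\<And>x. norm (T x) \<le> norm x * K" using pos_bounded by blast
  define d where "d = w - 1"
  define u where "u t = 1 + t *\<^sub>R d" for t :: real
  have nv: "norm v \<le> 9/8" using norm_triangle_ineq[of "v - 1" 1] v by simp
  have y1: "norm (1 - u t) \<le> 1/8" if "t \<in> {0..1}" for t
  proof -
    have "norm (1 - u t) = \<bar>t\<bar> * norm d" by (simp add: u_def)
    also have "\<dots> \<le> 1 * (1/8)" using that w by (intro mult_mono) (auto simp: d_def)
    finally show ?thesis by simp
  qed
  have y2: "norm (1 - v * u t) \<le> 1/2" if "t \<in> {0..1}" for t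
  proof -
    have "1 - v * u t = (1 - v) + v * (1 - u t)" by (simp add: algebra_simps)
    then have "norm (1 - v * u t) = norm ((1 - v) + v * (1 - u t))" by (rule arg_cong)
    also have "\<dots> \<le> norm (1 - v) + norm v * norm (1 - u t)"
      using norm_triangle_ineq[of "1 - v" "v * (1 - u t)"] norm_mult_ineq[of v "1 - u t"] by linarith
    also have "\<dots> \<le> 1/8 + 9/8 * (1/8)"
      using v nv y1[OF that] by (intro add_mono mult_mono) (auto simp: norm_minus_commute)
    finally show ?thesis by simp
  qed
  have bound: "norm ((log_trace_partial T N (v * w) - log_trace_partial T N w) - log_trace_partial T N v)
      \<le> ((2 + 2 * (9/8)) * norm d * K) * (1/2) ^ N" for N
  proof -
    define g where "g t = log_trace_partial T N (v * u t) - log_trace_partial T N (u t)" for t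
    have "norm (g 1 - g 0) \<le> ((2 + 2 * (9/8)) * norm d * K) * (1/2) ^ N"
    proof (rule norm_increment_le)
      fix t :: real assume t: "t \<in> {0..1}"
      define A where "A = geometric_sum N (1 - v * u t)"
      define B where "B = geometric_sum N (1 - u t)"
      have u': "(u has_vector_derivative d) (at t)"
        unfolding u_def by (auto intro!: derivative_eq_intros)
      have vu': "((\<lambda>t. v * u t) has_vector_derivative v * d) (at t)"
        by (rule bounded_linear.has_vector_derivative[OF bounded_linear_mult_right u'])
      have "u t * B = 1 - (1 - u t) ^ N" using geometric_sum_mult_left[of "1 - u t" N] by (simp add: B_def)
      then have uB: "u t * B + (1 - u t) ^ N = 1" by simp
      have Avu: "A * v * u t = 1 - (1 - v * u t) ^ N"
        using geometric_sum_mult_right[of N "1 - v * u t"] by (simp add: A_def mult.assoc)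
      \<comment> \<open>For exact inverses A = (v u)^-1 and B = u^-1 one has A v = B; inserting the
        identity \<open>uB\<close> isolates the two remainders of order N.\<close>
      have "A * v = A * v * (u t * B + (1 - u t) ^ N)" by (simp add: uB)
      also have "\<dots> = (A * v * u t) * B + A * v * (1 - u t) ^ N"
        by (simp only: distrib_left mult.assoc)
      also have "\<dots> = B - (1 - v * u t) ^ N * B + A * v * (1 - u t) ^ N"
        unfolding Avu by (simp add: left_diff_distrib)
      finally have "A * v - B = (B - (1 - v * u t) ^ N * B + A * v * (1 - u t) ^ N) - B"
        by (rule arg_cong)
      then have AvB: "A * v - B = A * v * (1 - u t) ^ N - (1 - v * u t) ^ N * B"
        by (simp only: diff_conv_add_uminus add_ac) simp
      show "(g has_vector_derivative T ((A * v - B) * d)) (at t)"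
        unfolding g_def A_def B_def
        by (rule derivative_eq_intros log_trace_partial_has_vector_derivative u' vu'
            | simp add: diff left_diff_distrib mult.assoc)+
      have p1: "norm ((1 - u t) ^ N) \<le> (1/2) ^ N"
        using y1[OF t] by (intro order_trans[OF norm_power_ineq] power_mono) auto
      have p2: "norm ((1 - v * u t) ^ N) \<le> (1/2) ^ N"
        using y2[OF t] by (intro order_trans[OF norm_power_ineq] power_mono) auto
      have nA: "norm A \<le> 2" unfolding A_def by (rule norm_geometric_sum_le[OF y2[OF t]])
      have nB: "norm B \<le> 2" unfolding B_def using y1[OF t] by (intro norm_geometric_sum_le) auto
      have "norm (A * v * (1 - u t) ^ N) \<le> (2 * (9/8)) * (1/2) ^ N"
        using nA nv p1 by (intro order_trans[OF norm_mult_ineq] mult_mono) auto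
      moreover have "norm ((1 - v * u t) ^ N * B) \<le> (1/2) ^ N * 2"
        using nB p2 by (intro order_trans[OF norm_mult_ineq] mult_mono) auto
      ultimately have n: "norm (A * v - B) \<le> (2 + 2 * (9/8)) * (1/2) ^ N"
        unfolding AvB using norm_triangle_ineq4[of "A * v * (1 - u t) ^ N" "(1 - v * u t) ^ N * B"]
        by (simp add: algebra_simps)
      have "norm (T ((A * v - B) * d)) \<le> norm ((A * v - B) * d) * K" by (rule K)
      also have "\<dots> \<le> ((2 + 2 * (9/8)) * (1/2) ^ N * norm d) * K"
        using K(1) n by (intro mult_right_mono order_trans[OF norm_mult_ineq]) auto
      finally show "norm (T ((A * v - B) * d)) \<le> ((2 + 2 * (9/8)) * norm d * K) * (1/2) ^ N"
        by (simp add: algebra_simps)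
    qed
    moreover have "g 1 - g 0 = (log_trace_partial T N (v * w) - log_trace_partial T N w) - log_trace_partial T N v"
      by (simp add: g_def u_def d_def)
    ultimately show ?thesis by simp
  qed
  have "norm (1 - v) < 1" "norm (1 - w) < 1" "norm (1 - v * w) < 1"
    using v w y2[of 1] by (auto simp: norm_minus_commute u_def d_def)
  then have "(\<lambda>N. (log_trace_partial T N (v * w) - log_trace_partial T N w) - log_trace_partial T N v)
    \<longlonglongrightarrow> (log_trace T (v * w) - log_trace T w) - log_trace T v"
    by (intro tendsto_intros log_trace_partial_LIMSEQ)
  from LIMSEQ_geometric_bound_imp_zero[OF this bound] show ?thesis by (simp add: algebra_simps)
qed

text \<open>On a fine grid, additivity of \<open>log_trace\<close> along the two ways around each square makes the
  difference of consecutive rows a telescoping sum.\<close>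

lemma log_trace_sum_homotopy_invariant:
  fixes h k :: "real \<times> real \<Rightarrow> 'm"
  assumes h: "continuous_on ({0..1} \<times> {0..1}) h" and k: "continuous_on ({0..1} \<times> {0..1}) k"
    and hk: "\<And>z. z \<in> {0..1} \<times> {0..1} \<Longrightarrow> h z * k z = 1"
    and h0: "\<And>s. s \<in> {0..1} \<Longrightarrow> h (s, 0) = 1" and h1: "\<And>s. s \<in> {0..1} \<Longrightarrow> h (s, 1) = 1"
    and kh: "\<And>z. z \<in> {0..1} \<times> {0..1} \<Longrightarrow> k z * h z = 1"
  shows "eventually (\<lambda>N. (\<Sum>j<N. log_trace T (k (0, j / N) * h (0, Suc j / N))) =
    (\<Sum>j<N. log_trace T (k (1, j / N) * h (1, Suc j / N)))) sequentially"
proof -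
  let ?I = "{0..1::real} \<times> {0..1::real}"
  have cpt: "compact ?I" by (intro compact_Times) auto
  have "bounded (k ` ?I)" by (intro compact_imp_bounded compact_continuous_image k cpt)
  then obtain B where B: "B > 0" "\<And>z. z \<in> ?I \<Longrightarrow> norm (k z) \<le> B"
    unfolding bounded_pos by auto
  have "uniformly_continuous_on ?I h" by (rule compact_uniformly_continuous[OF h cpt])
  \<comment> \<open>As \<open>B\<close> bounds k, this tolerance puts each increment k(z) h(z')
    within 1/8 of 1, the range of \<open>log_trace_mult\<close>.\<close>
  then obtain d where d: "d > 0"
    "\<And>z z'. z \<in> ?I \<Longrightarrow> z' \<in> ?I \<Longrightarrow> dist z' z < d \<Longrightarrow> dist (h z') (h z) < 1 / (8 * B)"
    unfolding uniformly_continuous_on_def using B(1)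
    by (metis mult_pos_pos zero_less_divide_1_iff zero_less_numeral)
  have near: "norm (k z * h z' - 1) \<le> 1/8" if z: "z \<in> ?I" "z' \<in> ?I" "dist z' z < d" for z z'
  proof -
    have "norm (k z * h z' - 1) = norm (k z * (h z' - h z))"
      using kh[OF z(1)] by (simp add: right_diff_distrib)
    also have "\<dots> \<le> norm (k z) * norm (h z' - h z)" by (rule norm_mult_ineq)
    also have "\<dots> \<le> B * (1 / (8 * B))"
      using B z d(2)[OF z] by (intro mult_mono) (auto simp: dist_norm)
    finally show ?thesis using B(1) by simp
  qed
  \<comment> \<open>Opposite corners of a grid square are at distance at most 1/N + 1/N, hence the
    2.\<close>
  obtain N0 :: nat where N0: "N0 > 2 / d" using reals_Archimedean2 by blast
  show ?thesis
  proof (rule eventually_sequentiallyI[of N0])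
    fix N assume N: "N \<ge> N0"
    have "2 / d < N" using N0 N by (meson of_nat_le_iff order_less_le_trans)
    moreover have "0 < 2 / d" using d(1) by simp
    ultimately have N0: "0 < real N" by linarith
    then have Nd: "2 / real N < d" "0 < N" using d(1) \<open>2 / d < N\<close> by (simp_all add: field_simps)
    define z where "z i j = (real i / real N, real j / real N)" for i j
    have zI: "z i j \<in> ?I" if "i \<le> N" "j \<le> N" for i j
      using that Nd(2) by (auto simp: z_def)
    have zz: "dist (z i' j') (z i j) < d" if "i' \<in> {i, Suc i}" "j' \<in> {j, Suc j}" for i i' j j'
    proof -
      have a: "dist (real i' / real N) (real i / real N) \<le> 1 / real N"
        using that Nd(2) by (auto simp: dist_real_def field_simps)
      have b: "dist (real j' / real N) (real j / real N) \<le> 1 / real N"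
        using that Nd(2) by (auto simp: dist_real_def field_simps)
      have "dist (z i' j') (z i j) \<le> dist (real i' / real N) (real i / real N) + dist (real j' / real N) (real j / real N)"
        unfolding z_def dist_Pair_Pair by (rule sqrt_sum_squares_le_sum) auto
      then show ?thesis using a b Nd(1) by linarith
    qed
    define P where "P i j = log_trace T (k (z i j) * h (z i (Suc j)))" for i j
    define E where "E i j = log_trace T (k (z i j) * h (z (Suc i) j))" for i j
    have split: "log_trace T (k a * h c) = log_trace T (k a * h b) + log_trace T (k b * h c)"
      if "a \<in> ?I" "b \<in> ?I" "c \<in> ?I" "dist b a < d" "dist c b < d" for a b c
    proof -
      have "k a * h b * (k b * h c) = k a * (h b * k b) * h c" by (simp only: mult.assoc)
      also have "\<dots> = k a * h c" using hk[OF that(2)] by simp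
      finally show ?thesis using log_trace_mult[OF near near] that by metis
    qed
    have square: "P i j - P (Suc i) j = E i j - E i (Suc j)" if "i < N" "j < N" for i j
    proof -
      have "P i j + E i (Suc j) = log_trace T (k (z i j) * h (z (Suc i) (Suc j)))"
        unfolding P_def E_def using that by (intro split[symmetric] zI zz) auto
      moreover have "E i j + P (Suc i) j = log_trace T (k (z i j) * h (z (Suc i) (Suc j)))"
        unfolding P_def E_def using that by (intro split[symmetric] zI zz) auto
      ultimately show ?thesis by (simp add: algebra_simps)
    qed
    \<comment> \<open>Basedness of the homotopy is used here: both ends of the telescoping sum lie
      on the sides where h is 1.\<close>
    have E0: "E i 0 = 0" "E i N = 0" if "i < N" for i
    proof -
      have m: "real i / real N \<in> {0..1}" "real (Suc i) / real N \<in> {0..1}" using that by auto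
      have k1: "k (s, 0) = 1" "k (s, 1) = 1" if "s \<in> {0..1}" for s
        using kh[of "(s, 0)"] kh[of "(s, 1)"] h0[OF that] h1[OF that] that by auto
      show "E i 0 = 0" using m k1(1)[OF m(1)] h0[OF m(2)] by (simp add: E_def z_def)
      show "E i N = 0" using m k1(2)[OF m(1)] h1[OF m(2)] Nd(2) by (simp add: E_def z_def)
    qed
    have step: "(\<Sum>j<N. P i j) = (\<Sum>j<N. P (Suc i) j)" if "i < N" for i
    proof -
      have "(\<Sum>j<N. P i j) - (\<Sum>j<N. P (Suc i) j) = (\<Sum>j<N. E i j - E i (Suc j))"
        unfolding sum_subtractf[symmetric] using square that by (intro sum.cong) auto
      also have "\<dots> = E i 0 - E i N" by (rule sum_lessThan_telescope')
      finally show ?thesis using E0[OF that] by simp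
    qed
    have "(\<Sum>j<N. P 0 j) = (\<Sum>j<N. P i j)" if "i \<le> N" for i
      using that by (induction i) (auto simp: step)
    from this[of N] show "(\<Sum>j<N. log_trace T (k (0, j / N) * h (0, Suc j / N))) =
      (\<Sum>j<N. log_trace T (k (1, j / N) * h (1, Suc j / N)))"
      using Nd(2) by (simp add: P_def z_def)
  qed
qed

end

section \<open>Finite matrices as a normed algebra\<close>

lemma mmult_eq_sum:
  assumes "\<And>k. k \<ge> n \<Longrightarrow> x i k * y k j = 0"
  shows "mmult x y i j = (\<Sum>k<n. x i k * y k j)"
  unfolding mmult_def
  by (rule Sum_any.expand_superset) (use assms in \<open>auto simp: not_less[symmetric]\<close>)

lemma corner_mono: "m \<le> m' \<Longrightarrow> n \<le> n' \<Longrightarrow> corner m n \<subseteq> corner m' n'"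
  by (auto simp: corner_def)

lemma cornerD: "x \<in> corner m n \<Longrightarrow> i \<ge> m \<or> j \<ge> n \<Longrightarrow> x i j = 0"
  by (auto simp: corner_def)

lemma mmult_corner_eq:
  assumes "x \<in> corner m k \<or> y \<in> corner k n"
  shows "mmult x y i j = (\<Sum>l<k. x i l * y l j)"
  using assms by (intro mmult_eq_sum) (auto simp: corner_def)

lemma mmult_corner [intro]:
  assumes "x \<in> corner m k" "y \<in> corner k n"
  shows "mmult x y \<in> corner m n"
  unfolding corner_def mem_Collect_eq
  using assms by (auto simp: mmult_corner_eq[of x m k y n] cornerD intro!: sum.neutral)

lemma mmult_assoc:
  assumes "x \<in> corner m k" "y \<in> corner k l" "z \<in> corner l n"
  shows "mmult (mmult x y) z = mmult x (mmult y z)"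
proof (intro ext)
  fix i j
  have "mmult (mmult x y) z i j = (\<Sum>b<l. (\<Sum>a<k. x i a * y a b) * z b j)"
    using assms by (simp add: mmult_corner_eq[of "mmult x y" m l z n] mmult_corner_eq[of x m k y l])
  also have "\<dots> = (\<Sum>b<l. \<Sum>a<k. x i a * (y a b * z b j))"
    by (simp add: sum_distrib_right mult.assoc)
  also have "\<dots> = (\<Sum>a<k. \<Sum>b<l. x i a * (y a b * z b j))" by (rule sum.swap)
  also have "\<dots> = (\<Sum>a<k. x i a * (\<Sum>b<l. y a b * z b j))"
    by (simp add: sum_distrib_left)
  also have "\<dots> = mmult x (mmult y z) i j"
    using assms by (simp add: mmult_corner_eq[of x m k "mmult y z" n] mmult_corner_eq[of y k l z n])
  finally show "mmult (mmult x y) z i j = mmult x (mmult y z) i j" .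
qed

section \<open>Matrices of finite support and their entrywise norm\<close>

definition finite_support :: "'a::cstar_algebra nmat \<Rightarrow> bool" where
  "finite_support x \<longleftrightarrow> (\<exists>n. x \<in> corner n n)"

lemma finite_support_common:
  assumes "finite_support x" "finite_support y"
  obtains n where "x \<in> corner n n" "y \<in> corner n n"
proof -
  obtain a b where "x \<in> corner a a" "y \<in> corner b b" using assms by (auto simp: finite_support_def)
  then have "x \<in> corner (max a b) (max a b)" "y \<in> corner (max a b) (max a b)"
    by (auto simp: corner_def)
  then show ?thesis using that by blast
qed

lemma finite_support_common3:
  assumes "finite_support x" "finite_support y" "finite_support z"
  obtains n where "x \<in> corner n n" "y \<in> corner n n" "z \<in> corner n n"
proof -
  obtain a where "x \<in> corner a a" "y \<in> corner a a" using finite_support_common assms by blast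
  moreover obtain b where "z \<in> corner b b" using assms by (auto simp: finite_support_def)
  ultimately have "x \<in> corner (max a b) (max a b)" "y \<in> corner (max a b) (max a b)" "z \<in> corner (max a b) (max a b)"
    by (auto simp: corner_def)
  then show ?thesis using that by blast
qed

lemma finite_support_zero: "finite_support (\<lambda>i j. 0)"
  by (simp add: finite_support_def corner_def)

lemma finite_support_add:
  assumes "finite_support x" "finite_support y"
  shows "finite_support (\<lambda>i j. x i j + y i j)"
proof -
  obtain n where "x \<in> corner n n" "y \<in> corner n n" using finite_support_common[OF assms] .
  then have "(\<lambda>i j. x i j + y i j) \<in> corner n n" by (simp add: corner_def)
  then show ?thesis unfolding finite_support_def ..
qed

lemma finite_support_diff:
  assumes "finite_support x" "finite_support y"
  shows "finite_support (\<lambda>i j. x i j - y i j)"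
proof -
  obtain n where "x \<in> corner n n" "y \<in> corner n n" using finite_support_common[OF assms] .
  then have "(\<lambda>i j. x i j - y i j) \<in> corner n n" by (simp add: corner_def)
  then show ?thesis unfolding finite_support_def ..
qed

lemma finite_support_uminus: "finite_support x \<Longrightarrow> finite_support (\<lambda>i j. - x i j)"
  by (auto simp: finite_support_def corner_def)

lemma finite_support_scaleR: "finite_support x \<Longrightarrow> finite_support (\<lambda>i j. r *\<^sub>R x i j)"
  by (auto simp: finite_support_def corner_def)

lemma finite_support_mmult:
  assumes "finite_support x" "finite_support y"
  shows "finite_support (mmult x y)"
  using finite_support_common[OF assms] mmult_corner unfolding finite_support_def by metis

lemma mmult_add_left:
  assumes "finite_support x" "finite_support y"
  shows "mmult (\<lambda>i j. x i j + y i j) z = (\<lambda>i j. mmult x z i j + mmult y z i j)"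
proof -
  obtain n where n: "x \<in> corner n n" "y \<in> corner n n" using finite_support_common[OF assms] .
  then have "(\<lambda>i j. x i j + y i j) \<in> corner n n" by (auto simp: corner_def)
  then show ?thesis
    using n by (intro ext) (simp add: mmult_corner_eq[of _ n n z n] sum.distrib distrib_right)
qed

lemma mmult_add_right:
  assumes "finite_support x" "finite_support y"
  shows "mmult z (\<lambda>i j. x i j + y i j) = (\<lambda>i j. mmult z x i j + mmult z y i j)"
proof -
  obtain n where n: "x \<in> corner n n" "y \<in> corner n n" using finite_support_common[OF assms] .
  then have "(\<lambda>i j. x i j + y i j) \<in> corner n n" by (auto simp: corner_def)
  then show ?thesis
    using n by (intro ext) (simp add: mmult_corner_eq[of z n n _ n] sum.distrib distrib_left)
qed

lemma mmult_scaleR_left: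
  assumes "finite_support x"
  shows "mmult (\<lambda>i j. r *\<^sub>R x i j) z = (\<lambda>i j. r *\<^sub>R mmult x z i j)"
proof -
  obtain n where n: "x \<in> corner n n" using assms by (auto simp: finite_support_def)
  then have "(\<lambda>i j. r *\<^sub>R x i j) \<in> corner n n" by (auto simp: corner_def)
  then show ?thesis
    using n by (intro ext) (simp add: mmult_corner_eq[of _ n n z n] scaleR_sum_right)
qed

lemma mmult_scaleR_right:
  assumes "finite_support x"
  shows "mmult z (\<lambda>i j. r *\<^sub>R x i j) = (\<lambda>i j. r *\<^sub>R mmult z x i j)"
proof -
  obtain n where n: "x \<in> corner n n" using assms by (auto simp: finite_support_def)
  then have "(\<lambda>i j. r *\<^sub>R x i j) \<in> corner n n" by (auto simp: corner_def)
  then show ?thesis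
    using n by (intro ext) (simp add: mmult_corner_eq[of z n n _ n] scaleR_sum_right)
qed

lemma mmult_zero [simp]: "mmult (\<lambda>i j. 0) z = (\<lambda>i j. 0)" "mmult z (\<lambda>i j. 0) = (\<lambda>i j. 0)"
  by (simp_all add: mmult_def)

text \<open>It stands in for the C*-norm of M_n(A), to which it is equivalent for each n; it does
  not depend on the size, and its submultiplicativity is elementary.\<close>

definition entry_norm :: "'a::cstar_algebra nmat \<Rightarrow> real" where
  "entry_norm x = Sum_any (\<lambda>(i, j). norm (x i j))"

lemma entry_norm_eq:
  assumes "x \<in> corner n n"
  shows "entry_norm x = (\<Sum>i<n. \<Sum>j<n. norm (x i j))"
proof -
  have "entry_norm x = (\<Sum>(i, j)\<in>{..<n} \<times> {..<n}. norm (x i j))"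
    unfolding entry_norm_def
    by (rule Sum_any.expand_superset) (auto, (metis assms cornerD not_less)+)
  then show ?thesis by (simp add: sum.cartesian_product)
qed

lemma entry_norm_nonneg: "finite_support x \<Longrightarrow> 0 \<le> entry_norm x"
  by (auto simp: finite_support_def entry_norm_eq intro!: sum_nonneg)

lemma entry_norm_zero_iff:
  assumes "finite_support x"
  shows "entry_norm x = 0 \<longleftrightarrow> x = (\<lambda>i j. 0)"
proof -
  obtain n where n: "x \<in> corner n n" using assms by (auto simp: finite_support_def)
  have "entry_norm x = 0 \<longleftrightarrow> (\<forall>i<n. \<forall>j<n. x i j = 0)"
    by (simp add: entry_norm_eq[OF n] sum_nonneg_eq_0_iff sum_nonneg Ball_def)
  also have "\<dots> \<longleftrightarrow> x = (\<lambda>i j. 0)"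
    using n by (auto simp: corner_def fun_eq_iff not_less[symmetric])
  finally show ?thesis .
qed

lemma entry_norm_add_le:
  assumes "finite_support x" "finite_support y"
  shows "entry_norm (\<lambda>i j. x i j + y i j) \<le> entry_norm x + entry_norm y"
proof -
  obtain n where n: "x \<in> corner n n" "y \<in> corner n n" using finite_support_common[OF assms] .
  then have "(\<lambda>i j. x i j + y i j) \<in> corner n n" by (auto simp: corner_def)
  then show ?thesis
    using n by (simp add: entry_norm_eq sum.distrib[symmetric] sum_mono norm_triangle_ineq)
qed

lemma entry_norm_scaleR:
  assumes "finite_support x"
  shows "entry_norm (\<lambda>i j. r *\<^sub>R x i j) = \<bar>r\<bar> * entry_norm x"
proof -
  obtain n where n: "x \<in> corner n n" using assms by (auto simp: finite_support_def)
  then have "(\<lambda>i j. r *\<^sub>R x i j) \<in> corner n n" by (auto simp: corner_def)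
  then show ?thesis using n by (simp add: entry_norm_eq sum_distrib_left)
qed

lemma entry_norm_mmult_le:
  assumes "finite_support x" "finite_support y"
  shows "entry_norm (mmult x y) \<le> entry_norm x * entry_norm y"
proof -
  obtain n where n: "x \<in> corner n n" "y \<in> corner n n" using finite_support_common[OF assms] .
  have "entry_norm (mmult x y) = (\<Sum>i<n. \<Sum>j<n. norm (\<Sum>k<n. x i k * y k j))"
    using n by (simp add: entry_norm_eq[OF mmult_corner[OF n]] mmult_corner_eq[of x n n y n])
  also have "\<dots> \<le> (\<Sum>i<n. \<Sum>j<n. \<Sum>k<n. norm (x i k) * norm (y k j))"
    by (intro sum_mono order_trans[OF norm_sum] norm_mult_ineq)
  also have "\<dots> = (\<Sum>i<n. \<Sum>k<n. norm (x i k) * (\<Sum>j<n. norm (y k j)))"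
    by (simp add: sum_distrib_left) (intro sum.cong refl sum.swap)
  also have "\<dots> \<le> (\<Sum>i<n. \<Sum>k<n. norm (x i k) * entry_norm y)"
  proof (intro sum_mono mult_left_mono)
    fix k assume "k \<in> {..<n}"
    then show "(\<Sum>j<n. norm (y k j)) \<le> entry_norm y"
      unfolding entry_norm_eq[OF n(2)]
      by (intro member_le_sum) (auto intro!: sum_nonneg)
  qed auto
  also have "\<dots> = entry_norm x * entry_norm y"
    by (simp add: entry_norm_eq[OF n(1)] sum_distrib_right)
  finally show ?thesis .
qed

text \<open>The unitization of the normed algebra of finite matrices of arbitrary size. It is not complete,
  but all finite sizes can be treated at once.\<close>

typedef (overloaded) 'a umat = "{(r :: real, x :: 'a::cstar_algebra nmat). finite_support x}"
  by (rule exI[of _ "(0, \<lambda>i j. 0)"]) (simp add: finite_support_zero)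

setup_lifting type_definition_umat

instantiation umat :: (cstar_algebra) real_normed_algebra_1
begin

lift_definition zero_umat :: "'a umat" is "(0, \<lambda>i j. 0)" by (simp add: finite_support_zero)
lift_definition one_umat :: "'a umat" is "(1, \<lambda>i j. 0)" by (simp add: finite_support_zero)
lift_definition plus_umat :: "'a umat \<Rightarrow> 'a umat \<Rightarrow> 'a umat" is
  "\<lambda>(r, x) (s, y). (r + s, \<lambda>i j. x i j + y i j)" by (auto simp: finite_support_add)
lift_definition minus_umat :: "'a umat \<Rightarrow> 'a umat \<Rightarrow> 'a umat" is
  "\<lambda>(r, x) (s, y). (r - s, \<lambda>i j. x i j - y i j)" by (auto simp: finite_support_diff)
lift_definition uminus_umat :: "'a umat \<Rightarrow> 'a umat" is
  "\<lambda>(r, x). (- r, \<lambda>i j. - x i j)" by (auto simp: finite_support_uminus)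
lift_definition scaleR_umat :: "real \<Rightarrow> 'a umat \<Rightarrow> 'a umat" is
  "\<lambda>c (r, x). (c * r, \<lambda>i j. c *\<^sub>R x i j)" by (auto simp: finite_support_scaleR)
lift_definition times_umat :: "'a umat \<Rightarrow> 'a umat \<Rightarrow> 'a umat" is
  "\<lambda>(r, x) (s, y). (r * s, \<lambda>i j. r *\<^sub>R y i j + s *\<^sub>R x i j + mmult x y i j)"
  by (auto simp: finite_support_add finite_support_scaleR finite_support_mmult)
lift_definition norm_umat :: "'a umat \<Rightarrow> real" is "\<lambda>(r, x). \<bar>r\<bar> + entry_norm x" .

definition dist_umat :: "'a umat \<Rightarrow> 'a umat \<Rightarrow> real" where
  "dist_umat x y = norm (x - y)"
definition sgn_umat :: "'a umat \<Rightarrow> 'a umat" where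
  "sgn_umat x = scaleR (inverse (norm x)) x"
definition uniformity_umat :: "('a umat \<times> 'a umat) filter" where
  "uniformity_umat = (INF e\<in>{0<..}. principal {(x, y). dist x y < e})"
definition open_umat :: "'a umat set \<Rightarrow> bool" where
  "open_umat U \<longleftrightarrow> (\<forall>x\<in>U. eventually (\<lambda>(x', y). x' = x \<longrightarrow> y \<in> U) uniformity)"

instance
proof
  fix a b c :: "'a umat" and r s :: real
  show "a + b + c = a + (b + c)" by transfer (auto simp: algebra_simps)
  show "a + b = b + a" by transfer (auto simp: algebra_simps)
  show "0 + a = a" by transfer auto
  show "- a + a = 0" by transfer auto
  show "a - b = a + - b" by transfer auto
  show "r *\<^sub>R (a + b) = r *\<^sub>R a + r *\<^sub>R b" by transfer (auto simp: algebra_simps)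
  show "(r + s) *\<^sub>R a = r *\<^sub>R a + s *\<^sub>R a" by transfer (auto simp: algebra_simps)
  show "r *\<^sub>R s *\<^sub>R a = (r * s) *\<^sub>R a" by transfer auto
  show "1 *\<^sub>R a = a" by transfer auto
  show "dist a b = norm (a - b)" by (rule dist_umat_def)
  show "sgn a = scaleR (inverse (norm a)) a" by (rule sgn_umat_def)
  show "(uniformity :: ('a umat \<times> 'a umat) filter) = (INF e\<in>{0<..}. principal {(x, y). dist x y < e})"
    by (rule uniformity_umat_def)
  show "open U \<longleftrightarrow> (\<forall>x\<in>U. eventually (\<lambda>(x', y). x' = x \<longrightarrow> y \<in> U) uniformity)" for U :: "'a umat set"
    by (rule open_umat_def)
  show "norm a = 0 \<longleftrightarrow> a = 0"
    by transfer (auto simp: entry_norm_nonneg add_nonneg_eq_0_iff entry_norm_zero_iff)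
  show "norm (a + b) \<le> norm a + norm b"
  proof transfer
    fix a b :: "real \<times> 'a nmat"
    assume "a \<in> {(r, x). finite_support x}" "b \<in> {(r, x). finite_support x}"
    then show "(case (case a of (r, x) \<Rightarrow> \<lambda>(s, y). (r + s, \<lambda>i j. x i j + y i j)) b of (r, x) \<Rightarrow> \<bar>r\<bar> + entry_norm x)
      \<le> (case a of (r, x) \<Rightarrow> \<bar>r\<bar> + entry_norm x) + (case b of (r, x) \<Rightarrow> \<bar>r\<bar> + entry_norm x)"
      using entry_norm_add_le[of "snd a" "snd b"] by (auto split: prod.splits)
  qed
  show "norm (r *\<^sub>R a) = \<bar>r\<bar> * norm a"
    by transfer (auto simp: entry_norm_scaleR abs_mult algebra_simps)
  show "a * b * c = a * (b * c)"
  proof transfer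
    fix a b c :: "real \<times> 'a nmat"
    assume "a \<in> {(r, x). finite_support x}" "b \<in> {(r, x). finite_support x}" "c \<in> {(r, x). finite_support x}"
    then obtain r x s y t z where eq: "a = (r, x)" "b = (s, y)" "c = (t, z)"
      and fs: "finite_support x" "finite_support y" "finite_support z" by auto
    obtain n where "x \<in> corner n n" "y \<in> corner n n" "z \<in> corner n n"
      using finite_support_common3[OF fs] .
    then have assoc: "mmult (mmult x y) z = mmult x (mmult y z)" by (rule mmult_assoc)
    note fs' = fs finite_support_add finite_support_scaleR finite_support_mmult
    show "(\<lambda>(r, x) (s, y). (r * s, \<lambda>i j. r *\<^sub>R y i j + s *\<^sub>R x i j + mmult x y i j))
        ((\<lambda>(r, x) (s, y). (r * s, \<lambda>i j. r *\<^sub>R y i j + s *\<^sub>R x i j + mmult x y i j)) a b) c =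
      (\<lambda>(r, x) (s, y). (r * s, \<lambda>i j. r *\<^sub>R y i j + s *\<^sub>R x i j + mmult x y i j)) a
        ((\<lambda>(r, x) (s, y). (r * s, \<lambda>i j. r *\<^sub>R y i j + s *\<^sub>R x i j + mmult x y i j)) b c)"
      by (simp add: eq mmult_add_left mmult_add_right mmult_scaleR_left mmult_scaleR_right fs' assoc)
         (simp add: algebra_simps)
  qed
  show "(a + b) * c = a * c + b * c"
    by transfer (auto simp: mmult_add_left algebra_simps)
  show "a * (b + c) = a * b + a * c"
    by transfer (auto simp: mmult_add_right algebra_simps)
  show "r *\<^sub>R a * b = r *\<^sub>R (a * b)"
    by transfer (auto simp: mmult_scaleR_left algebra_simps)
  show "a * r *\<^sub>R b = r *\<^sub>R (a * b)"
    by transfer (auto simp: mmult_scaleR_right algebra_simps)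
  show "1 * a = a" by transfer auto
  show "a * 1 = a" by transfer auto
  show "(0 :: 'a umat) \<noteq> 1" by transfer auto
  show "norm (1 :: 'a umat) = 1" by transfer (simp add: entry_norm_def)
  show "norm (a * b) \<le> norm a * norm b"
  proof transfer
    fix a b :: "real \<times> 'a nmat"
    assume "a \<in> {(r, x). finite_support x}" "b \<in> {(r, x). finite_support x}"
    then obtain r x s y where eq: "a = (r, x)" "b = (s, y)"
      and fs: "finite_support x" "finite_support y" by auto
    note fs' = fs finite_support_add finite_support_scaleR finite_support_mmult
    have "entry_norm (\<lambda>i j. r *\<^sub>R y i j + s *\<^sub>R x i j + mmult x y i j)
        \<le> \<bar>r\<bar> * entry_norm y + \<bar>s\<bar> * entry_norm x + entry_norm x * entry_norm y"
      using entry_norm_add_le[of "\<lambda>i j. r *\<^sub>R y i j + s *\<^sub>R x i j" "mmult x y"]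
        entry_norm_add_le[of "\<lambda>i j. r *\<^sub>R y i j" "\<lambda>i j. s *\<^sub>R x i j"] entry_norm_mmult_le[OF fs]
      by (simp add: fs' entry_norm_scaleR)
    then show "(case (\<lambda>(r, x) (s, y). (r * s, \<lambda>i j. r *\<^sub>R y i j + s *\<^sub>R x i j + mmult x y i j)) a b of
        (r, x) \<Rightarrow> \<bar>r\<bar> + entry_norm x)
      \<le> (case a of (r, x) \<Rightarrow> \<bar>r\<bar> + entry_norm x) * (case b of (r, x) \<Rightarrow> \<bar>r\<bar> + entry_norm x)"
      by (simp add: eq abs_mult algebra_simps)
  qed
qed

end


text \<open>The default 0 for matrices without finite support makes the constructor total.\<close>

lift_definition umat :: "real \<Rightarrow> 'a::cstar_algebra nmat \<Rightarrow> 'a umat" is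
  "\<lambda>r x. (r, if finite_support x then x else (\<lambda>i j. 0))"
  by (simp add: finite_support_zero)

lemma umat_simps:
  assumes "finite_support x" "finite_support y"
  shows "umat r x + umat s y = umat (r + s) (\<lambda>i j. x i j + y i j)"
    "umat r x - umat s y = umat (r - s) (\<lambda>i j. x i j - y i j)"
    "umat r x * umat s y = umat (r * s) (\<lambda>i j. r *\<^sub>R y i j + s *\<^sub>R x i j + mmult x y i j)"
  using assms
  by (transfer, simp add: finite_support_add finite_support_diff finite_support_scaleR finite_support_mmult)+

lemma scaleR_umat:
  assumes "finite_support x"
  shows "c *\<^sub>R umat r x = umat (c * r) (\<lambda>i j. c *\<^sub>R x i j)"
  using assms by transfer (simp add: finite_support_scaleR)

lemma norm_umat:
  assumes "finite_support x"
  shows "norm (umat r x) = \<bar>r\<bar> + entry_norm x"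
  using assms by transfer simp

lemma umat_one: "umat 1 (\<lambda>i j. 0) = 1"
  by transfer simp

text \<open>The unit gets trace 0, since its diagonal sum would diverge. The functional stays
  tracial, and \<open>log_trace\<close> evaluates it only at powers of 1 - w, which have scalar part
  0 for the elements w of interest.\<close>

lift_definition umat_trace :: "('a::cstar_algebra \<Rightarrow> complex) \<Rightarrow> 'a umat \<Rightarrow> complex" is
  "\<lambda>\<tau> (r, x). Sum_any (\<lambda>i. \<tau> (x i i))" .

lemma umat_trace_umat:
  assumes "bounded_trace \<tau>" "x \<in> corner n n"
  shows "umat_trace \<tau> (umat r x) = (\<Sum>i<n. \<tau> (x i i))"
proof -
  interpret \<tau>: bounded_trace \<tau> by fact
  have "finite_support x" using assms(2) by (auto simp: finite_support_def)
  then have "umat_trace \<tau> (umat r x) = Sum_any (\<lambda>i. \<tau> (x i i))" by transfer simp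
  also have "\<dots> = (\<Sum>i<n. \<tau> (x i i))"
    by (rule Sum_any.expand_superset) (auto, rule ccontr, simp add: cornerD[OF assms(2)] \<tau>.zero)
  finally show ?thesis .
qed

lemma umat_cases:
  obtains r x n where "a = umat r x" "x \<in> corner n n"
proof -
  obtain r x where R: "Rep_umat a = (r, x)" by (cases "Rep_umat a")
  then have fs: "finite_support x" using Rep_umat[of a] by simp
  then have "a = umat r x" using R by (simp add: Rep_umat_inject[symmetric] umat.rep_eq)
  then show ?thesis using that fs by (auto simp: finite_support_def)
qed

lemma umat_cases2:
  obtains r x s y n where "a = umat r x" "x \<in> corner n n" "b = umat s y" "y \<in> corner n n"
proof -
  obtain r x n where a: "a = umat r x" "x \<in> corner n n" by (rule umat_cases)
  obtain s y m where b: "b = umat s y" "y \<in> corner m m" by (rule umat_cases)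
  have "x \<in> corner (max n m) (max n m)" "y \<in> corner (max n m) (max n m)"
    using a b by (auto intro: corner_mono[THEN subsetD, rotated 2])
  then show ?thesis using that a b by blast
qed

lemma bounded_trace_umat_trace:
  assumes "bounded_trace \<tau>"
  shows "bounded_trace (umat_trace \<tau>)"
proof -
  interpret bounded_trace \<tau> by fact
  obtain K where K: "K > 0" "\<And>x. norm (\<tau> x) \<le> norm x * K" using pos_bounded by blast
  show ?thesis
  proof
    fix a b :: "'a umat" and c :: real
    obtain r x s y n where eq: "a = umat r x" "b = umat s y" and n: "x \<in> corner n n" "y \<in> corner n n"
      by (metis umat_cases2)
    have fs: "finite_support x" "finite_support y" using n by (auto simp: finite_support_def)
    have c: "(\<lambda>i j. x i j + y i j) \<in> corner n n" "(\<lambda>i j. c *\<^sub>R x i j) \<in> corner n n"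
      using n by (auto simp: corner_def)
    show "umat_trace \<tau> (a + b) = umat_trace \<tau> a + umat_trace \<tau> b"
      by (simp add: eq umat_simps fs umat_trace_umat[OF assms c(1)] umat_trace_umat[OF assms n(1)]
          umat_trace_umat[OF assms n(2)] add sum.distrib)
    show "umat_trace \<tau> (c *\<^sub>R a) = c *\<^sub>R umat_trace \<tau> a"
      unfolding eq scaleR_umat[OF fs(1)] umat_trace_umat[OF assms c(2)] umat_trace_umat[OF assms n(1)]
      by (simp add: scaleR scaleR_sum_right)
    have p: "umat_trace \<tau> (umat q (\<lambda>i j. r *\<^sub>R y i j + s *\<^sub>R x i j + mmult x y i j)) =
        (\<Sum>i<n. r *\<^sub>R \<tau> (y i i) + s *\<^sub>R \<tau> (x i i)) + (\<Sum>i<n. \<Sum>k<n. \<tau> (x i k * y k i))"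
      if "x \<in> corner n n" "y \<in> corner n n" for x y r s q
    proof -
      have "(\<lambda>i j. r *\<^sub>R y i j + s *\<^sub>R x i j + mmult x y i j) \<in> corner n n"
        using that mmult_corner[OF that] by (auto simp: corner_def)
      from umat_trace_umat[OF assms this] show ?thesis
        using that by (simp add: mmult_corner_eq[of x n n y n] add sum scaleR sum.distrib)
    qed
    have "(\<Sum>i<n. \<Sum>k<n. \<tau> (x i k * y k i)) = (\<Sum>k<n. \<Sum>i<n. \<tau> (y k i * x i k))"
      by (subst sum.swap) (simp add: commute)
    then show "umat_trace \<tau> (a * b) = umat_trace \<tau> (b * a)"
      unfolding eq umat_simps(3)[OF fs] umat_simps(3)[OF fs(2,1)] p[OF n] p[OF n(2,1)]
      by (simp add: add.commute)
  next
    show "\<exists>K. \<forall>a :: 'a umat. norm (umat_trace \<tau> a) \<le> norm a * K"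
    proof (intro exI allI)
      fix a :: "'a umat"
      obtain r x n where eq: "a = umat r x" and n: "x \<in> corner n n" by (metis umat_cases)
      have fs: "finite_support x" using n by (auto simp: finite_support_def)
      have "norm (umat_trace \<tau> a) \<le> (\<Sum>i<n. norm (x i i) * K)"
        unfolding eq umat_trace_umat[OF assms n] by (intro order_trans[OF norm_sum] sum_mono K)
      also have "\<dots> \<le> (\<Sum>i<n. (\<Sum>j<n. norm (x i j)) * K)"
        using K(1) by (intro sum_mono mult_right_mono member_le_sum) auto
      also have "\<dots> = entry_norm x * K" by (simp add: entry_norm_eq[OF n] sum_distrib_right)
      also have "\<dots> \<le> norm a * K" using K(1) by (simp add: eq norm_umat fs)
      finally show "norm (umat_trace \<tau> a) \<le> norm a * K" .
    qed
  qed
qed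


section \<open>Matrices equal to the identity outside a corner\<close>

definition stable :: "nat \<Rightarrow> 'a::cstar_algebra nmat set" where
  "stable n = {u. \<forall>i j. i \<ge> n \<or> j \<ge> n \<longrightarrow> u i j = mone i j}"

definition to_umat :: "'a::cstar_algebra nmat \<Rightarrow> 'a umat" where
  "to_umat u = umat 1 (\<lambda>i j. u i j - mone i j)"

lemma stable_corner: "u \<in> stable n \<Longrightarrow> (\<lambda>i j. u i j - mone i j) \<in> corner n n"
  by (simp add: stable_def corner_def)

lemma stable_finite_support: "u \<in> stable n \<Longrightarrow> finite_support (\<lambda>i j. u i j - mone i j)"
  using stable_corner finite_support_def by blast

lemma to_umat_mone [simp]: "to_umat mone = 1"
  by (simp add: to_umat_def umat_one)

lemma mmult_stable:
  assumes "u \<in> stable n" "v \<in> stable n"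
  shows "mmult u v = (\<lambda>i j. mone i j + (u i j - mone i j) + (v i j - mone i j)
    + mmult (\<lambda>i j. u i j - mone i j) (\<lambda>i j. v i j - mone i j) i j)"
proof (intro ext)
  fix i j
  define x where "x = (\<lambda>i j. u i j - mone i j)"
  define y where "y = (\<lambda>i j. v i j - mone i j)"
  \<comment> \<open>The bound has to exceed i and j too, because the diagonal of \<open>mone\<close>
    continues outside the corner.\<close>
  define m where "m = max n (max (Suc i) (Suc j))"
  have c: "x \<in> corner n n" "y \<in> corner n n" using assms stable_corner unfolding x_def y_def by auto
  have c': "x \<in> corner m m" using corner_mono[of n m n m] c by (auto simp: m_def)
  have u: "u a b = mone a b + x a b" and v: "v a b = mone a b + y a b" for a b
    by (simp_all add: x_def y_def)
  have "mmult u v i j = (\<Sum>k<m. u i k * v k j)"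
  proof (rule mmult_eq_sum)
    fix k assume "k \<ge> m"
    then have "u i k = 0" using assms(1) by (auto simp: m_def stable_def mone_def)
    then show "u i k * v k j = 0" by simp
  qed
  also have "\<dots> = (\<Sum>k<m. mone i k * mone k j) + (\<Sum>k<m. mone i k * y k j) + (\<Sum>k<m. x i k * mone k j)
      + (\<Sum>k<m. x i k * y k j)"
    unfolding u v by (simp add: distrib_left distrib_right sum.distrib algebra_simps)
  also have "(\<Sum>k<m. mone i k * mone k j) = (\<Sum>k<m. if i = k then mone i j else 0)"
    by (intro sum.cong) (auto simp: mone_def)
  also have "\<dots> = mone i j" by (auto simp: m_def not_less)
  also have "(\<Sum>k<m. mone i k * y k j) = (\<Sum>k<m. if i = k then y i j else 0)"
    by (intro sum.cong) (auto simp: mone_def)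
  also have "\<dots> = y i j" by (auto simp: m_def not_less)
  also have "(\<Sum>k<m. x i k * mone k j) = (\<Sum>k<m. if k = j then x i j else 0)"
    by (intro sum.cong) (auto simp: mone_def)
  also have "\<dots> = x i j" by (auto simp: m_def not_less)
  also have "(\<Sum>k<m. x i k * y k j) = mmult x y i j"
    using c' by (simp add: mmult_corner_eq[of x m m y m])
  finally show "mmult u v i j = mone i j + (u i j - mone i j) + (v i j - mone i j) + mmult x y i j"
    by (simp add: x_def y_def)
qed

lemma to_umat_mmult:
  assumes "u \<in> stable n" "v \<in> stable n"
  shows "to_umat (mmult u v) = to_umat u * to_umat v"
  using stable_finite_support[OF assms(1)] stable_finite_support[OF assms(2)]
  by (simp add: to_umat_def umat_simps mmult_stable[OF assms] algebra_simps)

lemma dist_to_umat: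
  assumes "u \<in> stable n" "v \<in> stable n"
  shows "dist (to_umat u) (to_umat v) = (\<Sum>i<n. \<Sum>j<n. norm (u i j - v i j))"
proof -
  have "(\<lambda>i j. u i j - v i j) \<in> corner n n"
    using assms by (auto simp: stable_def corner_def)
  moreover from this have "finite_support (\<lambda>i j. u i j - v i j)" unfolding finite_support_def ..
  ultimately show ?thesis
    using stable_finite_support[OF assms(1)] stable_finite_support[OF assms(2)]
    by (simp add: dist_norm to_umat_def umat_simps norm_umat entry_norm_eq)
qed

text \<open>For fixed n the distance is a finite sum of entry distances. Matrices of growing size
  can converge entrywise without converging in norm, which is why homotopies are confined to one
  \<open>U_mat n\<close> before this is applied.\<close>

lemma continuous_on_to_umat: "continuous_on (stable n) to_umat"
  unfolding continuous_on_def
proof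
  fix u :: "'a nmat" assume u: "u \<in> stable n"
  have "((\<lambda>v. \<Sum>i<n. \<Sum>j<n. norm (v i j - u i j)) \<longlongrightarrow> (\<Sum>i<n. \<Sum>j<n. norm (u i j - u i j))) (at u within stable n)"
  proof (intro tendsto_intros)
    fix i j
    have "continuous_on UNIV (\<lambda>v :: 'a nmat. v i j)"
      by (rule continuous_on_product_then_coordinatewise[OF continuous_on_product_coordinates])
    then show "((\<lambda>v. v i j) \<longlongrightarrow> u i j) (at u within stable n)"
      using continuous_on_subset[of UNIV _ "stable n"] u unfolding continuous_on_def by blast
  qed
  moreover have "eventually (\<lambda>v. (\<Sum>i<n. \<Sum>j<n. norm (v i j - u i j)) = dist (to_umat v) (to_umat u)) (at u within stable n)"
    by (simp add: eventually_at_filter dist_to_umat[OF _ u])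
  ultimately have "((\<lambda>v. dist (to_umat v) (to_umat u)) \<longlongrightarrow> (\<Sum>i<n. \<Sum>j<n. norm (u i j - u i j))) (at u within stable n)"
    by (rule Lim_transform_eventually)
  then show "(to_umat \<longlongrightarrow> to_umat u) (at u within stable n)"
    by (subst tendsto_dist_iff) simp
qed

section \<open>Tracial states\<close>

lemma norm_star [simp]: "norm (star x) = norm (x :: 'a::cstar_algebra)"
proof -
  have le: "norm x \<le> norm (star x)" for x :: 'a
  proof (cases "x = 0")
    case False
    have "norm x * norm x \<le> norm (star x) * norm x"
      by (metis cstar_identity norm_mult_ineq)
    then show ?thesis using False by simp
  qed simp
  show ?thesis using le[of x] le[of "star x"] by (simp add: star_star)
qed

lemma scaleC_one [simp]: "scaleC 1 x = (x :: 'a::cstar_algebra)"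
  using scaleC_of_real[of 1 x] by simp

lemma scaleC_zero_left [simp]: "scaleC 0 x = (0 :: 'a::cstar_algebra)"
  using scaleC_of_real[of 0 x] by simp

lemma scaleC_minus_left: "scaleC (- c) x = - scaleC c (x :: 'a::cstar_algebra)"
  using scaleC_add_left[of c "- c" x] by (simp add: eq_neg_iff_add_eq_0 add.commute)

lemma scaleC_scaleR_commute: "scaleC c (r *\<^sub>R x) = r *\<^sub>R scaleC c (x :: 'a::cstar_algebra)"
  by (metis scaleC_of_real scaleC_scaleC mult.commute)

lemma scaleC_of_real_mult: "scaleC (c * of_real r) x = r *\<^sub>R scaleC c (x :: 'a::cstar_algebra)"
  by (metis scaleC_of_real scaleC_scaleC scaleC_scaleR_commute)

lemma bounded_linear_scaleC: "bounded_linear (scaleC c :: 'a::cstar_algebra \<Rightarrow> 'a)"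
  by (rule bounded_linear_intro[of _ "cmod c"])
    (simp_all add: scaleC_add_right scaleC_scaleR_commute norm_scaleC mult.commute)

lemma star_scaleR: "star (r *\<^sub>R x) = r *\<^sub>R star (x :: 'a::cstar_algebra)"
  by (metis scaleC_of_real star_scaleC complex_cnj_complex_of_real)

lemma bounded_linear_star: "bounded_linear (star :: 'a::cstar_algebra \<Rightarrow> 'a)"
  by (rule bounded_linear_intro[of _ 1]) (simp_all add: star_add star_scaleR)

lemmas star_diff = linear_diff[OF bounded_linear.linear[OF bounded_linear_star]]
lemmas star_neg = linear_neg[OF bounded_linear.linear[OF bounded_linear_star]]
lemmas scaleC_diff = linear_diff[OF bounded_linear.linear[OF bounded_linear_scaleC]]
lemmas scaleC_neg = linear_neg[OF bounded_linear.linear[OF bounded_linear_scaleC]]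

lemma scaleC_zero_right [simp]: "scaleC c 0 = (0 :: 'a::cstar_algebra)"
  by (rule linear_0[OF bounded_linear.linear[OF bounded_linear_scaleC]])

lemma star_one [simp]: "star 1 = (1 :: 'a::cstar_algebra)"
  by (metis mult.right_neutral mult_1 star_mult star_star)

lemma star_power: "star (x ^ n) = star (x :: 'a::cstar_algebra) ^ n"
  by (induction n) (auto simp: star_mult power_commutes)

lemma star_exp: "star (exp x) = exp (star (x :: 'a::cstar_algebra))"
proof -
  have "(\<lambda>n. star (x ^ n /\<^sub>R fact n)) sums star (exp x)"
    by (rule bounded_linear.sums[OF bounded_linear_star exp_converges])
  then show ?thesis
    using sums_unique2[OF _ exp_converges[of "star x"]] by (simp add: star_scaleR star_power)
qed

lemma selfadjointD: "a \<in> selfadjoint \<Longrightarrow> star a = a"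
  by (simp add: selfadjoint_def)

lemma selfadjoint_add: "a \<in> selfadjoint \<Longrightarrow> b \<in> selfadjoint \<Longrightarrow> a + b \<in> selfadjoint"
  by (simp add: selfadjoint_def star_add)

lemma selfadjoint_scaleR: "a \<in> selfadjoint \<Longrightarrow> r *\<^sub>R a \<in> selfadjoint"
  by (simp add: selfadjoint_def star_scaleR)

lemma selfadjoint_minus: "a \<in> selfadjoint \<Longrightarrow> - a \<in> selfadjoint"
  by (simp add: selfadjoint_def star_neg)

definition re_part :: "'a::cstar_algebra \<Rightarrow> 'a" where
  "re_part x = (1/2) *\<^sub>R (x + star x)"

definition im_part :: "'a::cstar_algebra \<Rightarrow> 'a" where
  "im_part x = (1/2) *\<^sub>R scaleC (- \<i>) (x - star x)"

lemma re_part_selfadjoint: "re_part x \<in> selfadjoint"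
  by (simp add: re_part_def selfadjoint_def star_scaleR star_add star_star add.commute)

lemma im_part_selfadjoint: "im_part x \<in> selfadjoint"
  by (simp add: im_part_def selfadjoint_def star_scaleR star_scaleC star_diff star_star scaleC_minus_left scaleC_diff)

lemma re_im_parts: "x = re_part x + scaleC \<i> (im_part x)"
  by (simp add: re_part_def im_part_def scaleC_scaleR_commute scaleC_scaleC scaleR_right_diff_distrib scaleR_right_distrib
      flip: scaleR_left_distrib)

lemma norm_re_part_le: "norm (re_part x) \<le> norm x"
  using norm_triangle_ineq[of x "star x"] by (simp add: re_part_def)

lemma norm_im_part_le: "norm (im_part x) \<le> norm x"
  using norm_triangle_ineq4[of x "star x"] by (simp add: im_part_def norm_scaleC)

lemma norm_unitary: "u \<in> unitaries \<Longrightarrow> norm u = 1"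
  using cstar_identity[of u] norm_ge_zero[of u] square_eq_1_iff[of "norm u"] by (auto simp: unitaries_def)

lemma unitaries_mult:
  assumes "u \<in> unitaries" "v \<in> unitaries"
  shows "u * v \<in> unitaries"
proof -
  have "star (u * v) * (u * v) = star v * (star u * u) * v" "u * v * star (u * v) = u * (v * star v) * star u"
    by (simp_all only: star_mult mult.assoc)
  then show ?thesis using assms by (simp add: unitaries_def)
qed

lemma unitaries_star: "u \<in> unitaries \<Longrightarrow> star u \<in> unitaries"
  by (simp add: unitaries_def star_star)

lemma unitaries_one: "1 \<in> unitaries"
  by (simp add: unitaries_def)

lemma exp_skew_unitary:
  assumes "star x = - x"
  shows "exp x \<in> unitaries"
  using exp_minus_inverse[of x] exp_minus_inverse[of "- x"] by (simp add: unitaries_def star_exp assms)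

lemma skew_of_selfadjoint: "a \<in> selfadjoint \<Longrightarrow> star (t *\<^sub>R scaleC \<i> a) = - (t *\<^sub>R scaleC \<i> a)"
  by (simp add: selfadjoint_def star_scaleR star_scaleC scaleC_minus_left)

lemma exp_selfadjoint_unitary: "a \<in> selfadjoint \<Longrightarrow> exp (t *\<^sub>R scaleC \<i> a) \<in> unitaries"
  by (intro exp_skew_unitary skew_of_selfadjoint)

text \<open>For a small logarithm x of u, both \<open>star x\<close> and \<open>- x\<close> are
  small logarithms of \<open>star u\<close>; injectivity of exp near 0 makes x skew, so -i x is
  selfadjoint.\<close>

lemma unitary_near_one_log:
  assumes u: "u \<in> unitaries" and n: "norm (u - 1) \<le> 1/8"
  obtains a where "a \<in> selfadjoint" "exp (scaleC \<i> a) = u" "norm a \<le> 2 * norm (u - 1)"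
proof -
  obtain x where x: "exp x = u" "norm x \<le> 2 * norm (u - 1)" using exp_surj_near_one[OF n] .
  have nx: "norm x \<le> 1/4" using x(2) n by simp
  have "u * exp (- x) = 1" using exp_minus_inverse[of x] x(1) by simp
  then have "star u = star u * (u * exp (- x))" by simp
  also have "\<dots> = (star u * u) * exp (- x)" by (simp only: mult.assoc)
  also have "\<dots> = exp (- x)" using u by (simp add: unitaries_def)
  finally have "star u = exp (- x)" .
  then have "exp (star x) = exp (- x)" by (simp add: x(1) flip: star_exp)
  then have sx: "star x = - x" by (rule exp_inj_small[rotated 2]) (use nx in \<open>simp_all only: norm_star norm_minus_cancel\<close>)
  let ?a = "scaleC (- \<i>) x"
  have "?a \<in> selfadjoint" by (simp add: selfadjoint_def star_scaleC star_neg sx scaleC_minus_left scaleC_neg)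
  moreover have "scaleC \<i> ?a = x" by (simp add: scaleC_scaleC)
  ultimately show ?thesis using that[of ?a] x by (simp add: norm_scaleC)
qed

section \<open>Generators and derivatives at 0\<close>

lemma exp_generator_unique:
  fixes X Y :: "'a::{real_normed_algebra_1,banach}"
  assumes "\<And>t. exp (t *\<^sub>R X) = exp (t *\<^sub>R Y)"
  shows "X = Y"
proof -
  define t where "t = 1 / (4 * (1 + norm X + norm Y))"
  have pos: "1 + norm X + norm Y > 0" by (simp add: add_pos_nonneg)
  have t: "t > 0" using pos by (simp add: t_def)
  have "norm (t *\<^sub>R X) \<le> 1/4" "norm (t *\<^sub>R Y) \<le> 1/4"
    using pos by (simp_all add: t_def divide_simps)
  then have "t *\<^sub>R X = t *\<^sub>R Y" by (rule exp_inj_small) (rule assms)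
  then show ?thesis using t by simp
qed

text \<open>Derivatives at 0 enter through this sequence, since norm inequalities, membership in a
  closed set and nonnegativity pass to its limit.\<close>

lemma has_vector_derivative_quotient_LIMSEQ:
  fixes f :: "real \<Rightarrow> 'a::real_normed_vector"
  assumes f: "(f has_vector_derivative D) (at 0)" and f0: "f 0 = 0"
  shows "(\<lambda>n. real (Suc n) *\<^sub>R f (1 / real (Suc n))) \<longlonglongrightarrow> D"
proof -
  have "((\<lambda>h. norm (f (0 + h) - f 0 - h *\<^sub>R D) / norm h) \<longlongrightarrow> 0) (at 0)"
    using f unfolding has_vector_derivative_def has_derivative_at by blast
  moreover have "filterlim (\<lambda>n. 1 / real (Suc n)) (at 0) sequentially"
    unfolding filterlim_at using LIMSEQ_inverse_real_of_nat by (auto simp: inverse_eq_divide)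
  ultimately have "(\<lambda>n. norm (f (1 / real (Suc n)) - (1 / real (Suc n)) *\<^sub>R D) / norm (1 / real (Suc n))) \<longlonglongrightarrow> 0"
    by (auto simp: f0 dest: filterlim_compose simp del: of_nat_Suc)
  moreover have "norm (f (1 / real (Suc n)) - (1 / real (Suc n)) *\<^sub>R D) / norm (1 / real (Suc n))
      = norm (real (Suc n) *\<^sub>R f (1 / real (Suc n)) - D)" for n
  proof -
    have "real (Suc n) *\<^sub>R f (1 / real (Suc n)) - D = real (Suc n) *\<^sub>R (f (1 / real (Suc n)) - (1 / real (Suc n)) *\<^sub>R D)"
      by (simp add: scaleR_right_diff_distrib del: of_nat_Suc)
    then show ?thesis by (simp del: of_nat_Suc)
  qed
  ultimately have "(\<lambda>n. norm (real (Suc n) *\<^sub>R f (1 / real (Suc n)) - D)) \<longlonglongrightarrow> 0" by simp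
  then show ?thesis by (simp add: LIM_zero_iff tendsto_norm_zero_iff)
qed

text \<open>The form in which contractivity of \<open>\<theta>\<close> descends from group elements
  to generators.\<close>

lemma norm_derivative_mono:
  fixes f :: "real \<Rightarrow> 'a::real_normed_vector" and g :: "real \<Rightarrow> 'b::real_normed_vector"
  assumes f: "(f has_vector_derivative X) (at 0)" and g: "(g has_vector_derivative Y) (at 0)"
    and "f 0 = 0" "g 0 = 0" and le: "\<And>t. norm (f t) \<le> norm (g t)"
  shows "norm X \<le> norm Y"
proof (rule LIMSEQ_le)
  show "(\<lambda>n. norm (real (Suc n) *\<^sub>R f (1 / real (Suc n)))) \<longlonglongrightarrow> norm X"
    by (intro tendsto_norm has_vector_derivative_quotient_LIMSEQ assms)
  show "(\<lambda>n. norm (real (Suc n) *\<^sub>R g (1 / real (Suc n)))) \<longlonglongrightarrow> norm Y"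
    by (intro tendsto_norm has_vector_derivative_quotient_LIMSEQ assms)
  show "\<exists>N. \<forall>n\<ge>N. norm (real (Suc n) *\<^sub>R f (1 / real (Suc n))) \<le> norm (real (Suc n) *\<^sub>R g (1 / real (Suc n)))"
    using le by (auto simp: mult_left_mono simp del: of_nat_Suc)
qed

lemma exp_conjugate:
  fixes x :: "'a::{real_normed_algebra_1,banach}"
  assumes vu: "v * u = 1" and uv: "u * v = 1"
  shows "exp (u * x * v) = u * exp x * v"
proof -
  have pow: "(u * x * v) ^ n = u * x ^ n * v" for n
  proof (induction n)
    case (Suc n)
    have "(u * x * v) ^ Suc n = u * x * (v * u) * x ^ n * v"
      unfolding power_Suc Suc by (simp only: mult.assoc)
    then show ?case by (simp add: vu mult.assoc)
  qed (simp add: uv)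
  have b: "bounded_linear (\<lambda>y. u * y * v)"
    by (intro bounded_linear_compose[OF bounded_linear_mult_left bounded_linear_mult_right])
  have "(\<lambda>n. u * (x ^ n /\<^sub>R fact n) * v) sums (u * exp x * v)"
    by (rule bounded_linear.sums[OF b exp_converges])
  then have "(\<lambda>n. (u * x * v) ^ n /\<^sub>R fact n) sums (u * exp x * v)" by (simp add: pow)
  then show ?thesis using exp_converges sums_unique2 by blast
qed


section \<open>Reality and norm bounds for a tracial state\<close>

context
  fixes \<tau> :: "'a::cstar_algebra \<Rightarrow> complex"
  assumes \<tau>: "\<tau> \<in> tracial_states"
begin

lemma tracial_state_add: "\<tau> (a + b) = \<tau> a + \<tau> b"
  and tracial_state_scaleC: "\<tau> (scaleC c a) = c * \<tau> a"
  and tracial_state_pos: "\<tau> (star a * a) \<in> \<real>\<^sub>\<ge>\<^sub>0"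
  and tracial_state_one: "\<tau> 1 = 1"
  and tracial_state_commute: "\<tau> (a * b) = \<tau> (b * a)"
  using \<tau> unfolding tracial_states_def by blast+

lemma tracial_state_scaleR: "\<tau> (r *\<^sub>R a) = of_real r * \<tau> a"
  by (metis scaleC_of_real tracial_state_scaleC)

lemma tracial_state_minus: "\<tau> (- a) = - \<tau> a"
  using tracial_state_scaleR[of "-1" a] by simp

lemma tracial_state_diff: "\<tau> (a - b) = \<tau> a - \<tau> b"
  using tracial_state_add[of a "- b"] by (simp add: tracial_state_minus)

lemma tracial_state_pos_real: "Im (\<tau> (star a * a)) = 0" "0 \<le> Re (\<tau> (star a * a))"
  using tracial_state_pos[of a] by (auto simp: complex_nonneg_Reals_iff)

text \<open>Polarization: the traces of the positive elements built from a + 1 and a + i are real,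
  and these two conditions fix the imaginary and the real part of the trace of
  \<open>star a\<close>.\<close>

lemma tracial_state_star: "\<tau> (star a) = cnj (\<tau> a)"
proof -
  have "star (a + 1) * (a + 1) = star a * a + (star a + (a + 1))"
    by (simp add: star_add algebra_simps)
  then have 1: "Im (\<tau> (star a) + \<tau> a) = 0"
    using tracial_state_pos_real(1)[of "a + 1"] tracial_state_pos_real(1)[of a]
    by (simp add: tracial_state_add tracial_state_one)
  have "star (a + scaleC \<i> 1) * (a + scaleC \<i> 1) = star a * a + (scaleC \<i> (star a) + (scaleC (- \<i>) a + 1))"
    by (simp add: star_add star_scaleC distrib_left distrib_right scaleC_mult_left scaleC_mult_right scaleC_scaleC scaleC_add_right add.assoc)
  then have "Im (\<i> * \<tau> (star a) - \<i> * \<tau> a) = 0"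
    using tracial_state_pos_real(1)[of "a + scaleC \<i> 1"] tracial_state_pos_real(1)[of a]
    by (simp add: tracial_state_add tracial_state_one tracial_state_scaleC)
  with 1 show ?thesis by (simp add: complex_eq_iff)
qed

lemma tracial_state_selfadjoint_real: "a \<in> selfadjoint \<Longrightarrow> of_real (Re (\<tau> a)) = \<tau> a"
  using tracial_state_star[of a] by (simp add: selfadjoint_def complex_eq_iff)

text \<open>A square root without functional calculus: 1 - a has a small logarithm x, selfadjoint by
  uniqueness, and 1 - a is the square of the selfadjoint element exp(x/2). Scaling to the radius 1/8
  produces the factor 8 in the next bound.\<close>

lemma tracial_state_le_small:
  assumes a: "a \<in> selfadjoint" and n: "norm a \<le> 1/8"
  shows "Re (\<tau> a) \<le> 1"
proof -
  obtain x where x: "exp x = 1 - a" "norm x \<le> 2 * norm (1 - a - 1)"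
    using exp_surj_near_one[of "1 - a"] n by auto
  have nx: "norm x \<le> 1/4" using x(2) n by simp
  have "exp (star x) = star (1 - a)" by (simp add: x(1) flip: star_exp)
  also have "\<dots> = exp x" using selfadjointD[OF a] x(1) by (simp add: star_diff)
  finally have sx: "star x = x" by (rule exp_inj_small[rotated 2]) (use nx in \<open>simp_all only: norm_star\<close>)
  let ?y = "exp ((1/2) *\<^sub>R x)"
  have "star ?y * ?y = ?y * ?y" by (simp add: star_exp star_scaleR sx)
  also have "\<dots> = 1 - a" using exp_double[of "(1/2) *\<^sub>R x"] x(1) by simp
  finally have "0 \<le> Re (\<tau> (1 - a))" using tracial_state_pos_real(2)[of ?y] by simp
  then show ?thesis by (simp add: tracial_state_diff tracial_state_one)
qed

lemma tracial_state_abs_le_8: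
  assumes a: "a \<in> selfadjoint"
  shows "\<bar>Re (\<tau> a)\<bar> \<le> 8 * norm a"
proof (cases "a = 0")
  case True
  then show ?thesis using tracial_state_scaleR[of 0 a] by simp
next
  case False
  let ?b = "(1 / (8 * norm a)) *\<^sub>R a"
  have b: "?b \<in> selfadjoint" "- ?b \<in> selfadjoint" using a by (auto intro: selfadjoint_scaleR selfadjoint_minus)
  have "norm ?b \<le> 1/8" "norm (- ?b) \<le> 1/8" using False by auto
  from tracial_state_le_small[OF b(1) this(1)] tracial_state_le_small[OF b(2) this(2)]
  have "\<bar>Re (\<tau> ?b)\<bar> \<le> 1" by (simp only: tracial_state_minus) simp
  then have "\<bar>Re (\<tau> a)\<bar> / (8 * norm a) \<le> 1"
    unfolding tracial_state_scaleR by (simp add: abs_mult del: of_real_divide)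
  then show ?thesis using False by (simp add: divide_simps)
qed

text \<open>Nonnegativity of the variance, i.e. of the trace of the square of a - \<tau>(a).\<close>

lemma tracial_state_square_le:
  assumes a: "a \<in> selfadjoint"
  shows "(Re (\<tau> a))\<^sup>2 \<le> Re (\<tau> (a * a))"
proof -
  let ?r = "Re (\<tau> a)"
  let ?x = "a - ?r *\<^sub>R 1"
  have "star ?x * ?x = ?x * ?x" using a by (simp add: star_diff star_scaleR selfadjoint_def)
  also have "\<dots> = a * a - (?r *\<^sub>R a + ?r *\<^sub>R a) + (?r * ?r) *\<^sub>R 1"
    by (simp add: algebra_simps)
  finally have "0 \<le> Re (\<tau> (a * a - (?r *\<^sub>R a + ?r *\<^sub>R a) + (?r * ?r) *\<^sub>R 1))"
    using tracial_state_pos_real(2)[of ?x] by simp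
  then show ?thesis
    by (simp add: tracial_state_add tracial_state_diff tracial_state_scaleR tracial_state_one power2_eq_square)
qed

text \<open>The factor 8 of the crude bound is removed by passing to high powers.\<close>

lemma tracial_state_abs_le:
  assumes a: "a \<in> selfadjoint"
  shows "\<bar>Re (\<tau> a)\<bar> \<le> norm a"
proof (rule ccontr)
  assume "\<not> \<bar>Re (\<tau> a)\<bar> \<le> norm a"
  then have lt: "norm a < \<bar>Re (\<tau> a)\<bar>" by simp
  then have a0: "norm a > 0" using tracial_state_abs_le_8[OF a] by (cases "a = 0") auto
  have sa: "a ^ m \<in> selfadjoint" for m using a by (simp add: selfadjoint_def star_power)
  have pow: "\<bar>Re (\<tau> a)\<bar> ^ (2 ^ n) \<le> \<bar>Re (\<tau> (a ^ (2 ^ n)))\<bar>" for n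
  proof (induction n)
    case (Suc n)
    have "\<bar>Re (\<tau> a)\<bar> ^ (2 ^ Suc n) = (\<bar>Re (\<tau> a)\<bar> ^ (2 ^ n))\<^sup>2" by (simp only: power_Suc2 power_mult)
    also have "\<dots> \<le> \<bar>Re (\<tau> (a ^ (2 ^ n)))\<bar>\<^sup>2" by (intro power_mono Suc) auto
    also have "\<dots> \<le> Re (\<tau> (a ^ (2 ^ n) * a ^ (2 ^ n)))" using tracial_state_square_le[OF sa] by simp
    also have "\<dots> = Re (\<tau> (a ^ (2 ^ Suc n)))" by (simp add: mult_2 flip: power_add)
    finally show ?case by simp
  qed simp
  let ?q = "\<bar>Re (\<tau> a)\<bar> / norm a"
  have q: "?q > 1" using lt a0 by simp
  obtain N where N: "?q ^ N > 8" using real_arch_pow[OF q] by blast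
  have "?q ^ N \<le> ?q ^ (2 ^ N)" using q by (intro power_increasing) (auto intro: less_imp_le less_exp)
  moreover have "?q ^ (2 ^ N) \<le> 8"
  proof -
    have "\<bar>Re (\<tau> a)\<bar> ^ (2 ^ N) \<le> 8 * norm (a ^ (2 ^ N))"
      using pow[of N] tracial_state_abs_le_8[OF sa, of "2 ^ N"] by linarith
    also have "\<dots> \<le> 8 * norm a ^ (2 ^ N)" by (simp add: norm_power_ineq)
    finally show ?thesis using a0 by (simp add: power_divide divide_simps)
  qed
  ultimately show False using N by linarith
qed

lemma tracial_state_norm_le: "norm (\<tau> x) \<le> 2 * norm x"
proof -
  have "\<tau> x = \<tau> (re_part x) + \<i> * \<tau> (im_part x)"
    by (metis re_im_parts tracial_state_add tracial_state_scaleC)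
  then have "norm (\<tau> x) \<le> norm (\<tau> (re_part x)) + norm (\<tau> (im_part x))"
    by (metis norm_triangle_ineq norm_mult norm_ii mult_1)
  also have "norm (\<tau> (re_part x)) = \<bar>Re (\<tau> (re_part x))\<bar>"
    by (metis re_part_selfadjoint tracial_state_selfadjoint_real norm_of_real)
  also have "norm (\<tau> (im_part x)) = \<bar>Re (\<tau> (im_part x))\<bar>"
    by (metis im_part_selfadjoint tracial_state_selfadjoint_real norm_of_real)
  finally show ?thesis
    using tracial_state_abs_le[OF re_part_selfadjoint, of x] tracial_state_abs_le[OF im_part_selfadjoint, of x]
      norm_re_part_le[of x] norm_im_part_le[of x] by linarith
qed

lemma bounded_trace_tracial_state: "bounded_trace \<tau>"
proof
  show "\<exists>K. \<forall>x. norm (\<tau> x) \<le> norm x * K" using tracial_state_norm_le by (metis mult.commute)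
qed (simp_all add: tracial_state_add tracial_state_scaleR scaleR_conv_of_real[where 'a = complex] tracial_state_commute)

end

text \<open>Traciality reduces positivity to squares of selfadjoint elements \<open>h\<close>. These are limits of
  \<open>sin\<^sup>2(th)/t\<^sup>2\<close>, and \<open>1 - sin\<^sup>2(th) = cos\<^sup>2(th)\<close> is a contraction.\<close>

lemma tracial_stateI:
  fixes \<phi> :: "'a::cstar_algebra \<Rightarrow> complex"
  assumes add: "\<And>a b. \<phi> (a + b) = \<phi> a + \<phi> b" and scale: "\<And>c a. \<phi> (scaleC c a) = c * \<phi> a"
    and one: "\<phi> 1 = 1" and commute: "\<And>a b. \<phi> (a * b) = \<phi> (b * a)"
    and real: "\<And>a. a \<in> selfadjoint \<Longrightarrow> \<phi> a \<in> \<real>"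
    and contractive: "\<And>a. a \<in> selfadjoint \<Longrightarrow> norm (\<phi> a) \<le> norm a"
  shows "\<phi> \<in> tracial_states"
proof -
  have minus: "\<phi> (- a) = - \<phi> a" for a using scale[of "-1" a] by (simp add: scaleC_minus_left)
  have diff: "\<phi> (a - b) = \<phi> a - \<phi> b" for a b using add[of a "- b"] by (simp add: minus)
  have scaleR: "\<phi> (r *\<^sub>R a) = of_real r * \<phi> a" for r a using scale[of "of_real r" a] by (simp add: scaleC_of_real)
  have sa_square: "h * h \<in> selfadjoint" if "h \<in> selfadjoint" for h :: 'a
    using that by (simp add: selfadjoint_def star_mult)
  have square: "\<phi> (h * h) \<in> \<real>\<^sub>\<ge>\<^sub>0" if h: "h \<in> selfadjoint" for h
  proof -
    define e where "e t = exp (t *\<^sub>R scaleC \<i> h)" for t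
    define s where "s t = (1/2) *\<^sub>R scaleC (- \<i>) (e t - e (- t))" for t
    define c where "c t = (1/2) *\<^sub>R (e t + e (- t))" for t
    have eu: "e t \<in> unitaries" for t unfolding e_def by (rule exp_selfadjoint_unitary[OF h])
    have star_e: "star (e t) = e (- t)" for t
      by (simp add: e_def star_exp skew_of_selfadjoint[OF h])
    have ee: "e t * e (- t) = 1" "e (- t) * e t = 1" for t
      using eu[of t] star_e[of t] by (auto simp: unitaries_def)
    have s: "s t \<in> selfadjoint" for t
      by (simp add: s_def selfadjoint_def star_scaleR star_scaleC star_diff star_e scaleC_minus_left scaleC_diff)
    have c: "c t \<in> selfadjoint" for t
      by (simp add: c_def selfadjoint_def star_scaleR star_add star_e add.commute)
    have norm_c: "norm (c t) \<le> 1" for t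
      using norm_triangle_ineq[of "e t" "e (- t)"] norm_unitary[OF eu] by (simp add: c_def)
    have sc: "s t * s t = 1 - c t * c t" for t
    proof -
      have "4 *\<^sub>R (s t * s t) = - ((e t - e (- t)) * (e t - e (- t)))"
        by (simp add: s_def scaleC_mult_left scaleC_mult_right scaleC_scaleC scaleC_minus_left scaleC_neg scaleC_scaleR_commute)
      moreover have "4 *\<^sub>R (c t * c t) = (e t + e (- t)) * (e t + e (- t))" by (simp add: c_def)
      ultimately have "4 *\<^sub>R (s t * s t + c t * c t) = 4 *\<^sub>R 1"
        by (simp add: scaleR_right_distrib algebra_simps ee) (simp add: scaleR_conv_of_real)
      then have "s t * s t + c t * c t = 1" by simp
      then show ?thesis by (simp add: eq_diff_eq)
    qed
    have pos: "0 \<le> Re (\<phi> (s t * s t))" for t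
    proof -
      have "norm (\<phi> (c t * c t)) \<le> norm (c t * c t)" by (rule contractive[OF sa_square[OF c]])
      also have "\<dots> \<le> norm (c t) * norm (c t)" by (rule norm_mult_ineq)
      also have "\<dots> \<le> 1" using norm_c[of t] by (simp add: mult_le_one)
      finally show ?thesis using complex_Re_le_cmod[of "\<phi> (c t * c t)"] by (simp add: sc diff one)
    qed
    have "(s has_vector_derivative (1/2) *\<^sub>R scaleC (- \<i>) (scaleC \<i> h - - scaleC \<i> h)) (at 0)"
    proof -
      have "(e has_vector_derivative scaleC \<i> h) (at 0)"
        unfolding e_def using exp_scaleR_has_vector_derivative_right[of "scaleC \<i> h" 0] by simp
      moreover have "((\<lambda>t. e (- t)) has_vector_derivative - scaleC \<i> h) (at 0)"
        unfolding e_def using exp_scaleR_has_vector_derivative_right[of "- scaleC \<i> h" 0] by simp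
      ultimately have d: "((\<lambda>t. e t - e (- t)) has_vector_derivative (scaleC \<i> h - - scaleC \<i> h)) (at 0)"
        by (rule has_vector_derivative_diff)
      show ?thesis
        unfolding s_def
        by (intro bounded_linear.has_vector_derivative[OF bounded_linear_scaleR_right]
            bounded_linear.has_vector_derivative[OF bounded_linear_scaleC] d)
    qed
    also have "(1/2) *\<^sub>R scaleC (- \<i>) (scaleC \<i> h - - scaleC \<i> h) = h"
      by (simp add: scaleC_add_right scaleC_scaleC scaleC_scaleR_commute flip: scaleR_2)
    finally have "(s has_vector_derivative h) (at 0)" .
    then have "(\<lambda>n. real (Suc n) *\<^sub>R s (1 / real (Suc n))) \<longlonglongrightarrow> h"
      by (rule has_vector_derivative_quotient_LIMSEQ) (simp add: s_def)
    then have l: "(\<lambda>n. (real (Suc n) *\<^sub>R s (1 / real (Suc n))) * (real (Suc n) *\<^sub>R s (1 / real (Suc n)))) \<longlonglongrightarrow> h * h"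
      by (intro tendsto_mult)
    let ?x = "\<lambda>n. (real (Suc n) *\<^sub>R s (1 / real (Suc n))) * (real (Suc n) *\<^sub>R s (1 / real (Suc n)))"
    \<comment> \<open>Contractivity is given on selfadjoint elements only; this is enough because
      the sequence and its limit are selfadjoint.\<close>
    have "(\<lambda>n. \<phi> (?x n)) \<longlonglongrightarrow> \<phi> (h * h)"
    proof (rule metric_LIMSEQ_I)
      fix r :: real assume "r > 0"
      then obtain N where N: "\<And>n. n \<ge> N \<Longrightarrow> dist (?x n) (h * h) < r" using metric_LIMSEQ_D[OF l] by blast
      have "dist (\<phi> (?x n)) (\<phi> (h * h)) \<le> dist (?x n) (h * h)" for n
      proof -
        have "?x n \<in> selfadjoint" by (intro sa_square selfadjoint_scaleR s)
        then have "?x n - h * h \<in> selfadjoint"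
          using sa_square[OF h] by (simp only: selfadjoint_def mem_Collect_eq star_diff)
        from contractive[OF this] show ?thesis by (simp only: dist_norm diff)
      qed
      then show "\<exists>N. \<forall>n\<ge>N. dist (\<phi> (?x n)) (\<phi> (h * h)) < r" using N order_le_less_trans by blast
    qed
    then have "(\<lambda>n. Re (\<phi> (?x n))) \<longlonglongrightarrow> Re (\<phi> (h * h))" by (rule tendsto_Re)
    moreover have "0 \<le> Re (\<phi> (?x n))" for n
    proof -
      have "?x n = (real (Suc n) * real (Suc n)) *\<^sub>R (s (1 / real (Suc n)) * s (1 / real (Suc n)))"
        by (simp del: of_nat_Suc)
      then have "Re (\<phi> (?x n)) = (real (Suc n) * real (Suc n)) * Re (\<phi> (s (1 / real (Suc n)) * s (1 / real (Suc n))))"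
        by (simp only: scaleR) (simp del: of_nat_Suc)
      then show ?thesis using pos by (simp del: of_nat_Suc)
    qed
    ultimately have "0 \<le> Re (\<phi> (h * h))" by (intro LIMSEQ_le_const) auto
    then show ?thesis using real[OF sa_square[OF h]] by (auto simp: complex_nonneg_Reals_iff complex_is_Real_iff)
  qed
  have "\<phi> (star x * x) \<in> \<real>\<^sub>\<ge>\<^sub>0" for x
  proof -
    define h where "h = re_part x"
    define k where "k = im_part x"
    have hk: "h \<in> selfadjoint" "k \<in> selfadjoint" by (auto simp: h_def k_def re_part_selfadjoint im_part_selfadjoint)
    have x: "x = h + scaleC \<i> k" unfolding h_def k_def by (rule re_im_parts)
    have "star x = h + scaleC (- \<i>) k" using hk by (simp add: x star_add star_scaleC selfadjoint_def)
    then have "star x * x = h * h + scaleC \<i> (h * k) + (scaleC (- \<i>) (k * h) + k * k)"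
      by (simp add: x distrib_left distrib_right scaleC_mult_left scaleC_mult_right scaleC_scaleC scaleC_add_right add.assoc)
    \<comment> \<open>The cross term i(hk - kh) vanishes by traciality.\<close>
    then have "\<phi> (star x * x) = \<phi> (h * h) + \<phi> (k * k)" by (simp add: add scale commute[of k h])
    then show ?thesis using square[OF hk(1)] square[OF hk(2)] by (simp add: nonneg_Reals_add_I)
  qed
  then show ?thesis unfolding tracial_states_def using add scale one commute by blast
qed

section \<open>The group K0 and its pairing with traces\<close>

lemma star_zero [simp]: "star 0 = (0 :: 'a::cstar_algebra)"
  using star_add[of "0::'a" 0] by simp

lemma star_sum: "star (sum f A) = (\<Sum>i\<in>A. star (f i :: 'a::cstar_algebra))"
  by (induction A rule: infinite_finite_induct) (auto simp: star_add)

lemma mstar_corner [intro]: "x \<in> corner m n \<Longrightarrow> mstar x \<in> corner n m"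
  by (auto simp: corner_def mstar_def)

lemma mstar_mstar [simp]: "mstar (mstar x) = x"
  by (simp add: mstar_def star_star)

lemma mstar_mmult:
  assumes "x \<in> corner m k" "y \<in> corner k n"
  shows "mstar (mmult x y) = mmult (mstar y) (mstar x)"
proof (intro ext)
  fix i j
  have "mmult (mstar y) (mstar x) i j = (\<Sum>l<k. mstar y i l * mstar x l j)"
    using assms by (intro mmult_corner_eq[of _ n _ _ m]) auto
  moreover have "mmult x y j i = (\<Sum>l<k. x j l * y l i)"
    using assms by (intro mmult_corner_eq[of _ m _ _ n]) auto
  ultimately show "mstar (mmult x y) i j = mmult (mstar y) (mstar x) i j"
    by (simp add: mstar_def star_sum star_mult)
qed

lemma P_inf_iff: "P \<in> P_inf \<longleftrightarrow> snd P \<in> corner (fst P) (fst P) \<and> mstar (snd P) = snd P \<and> mmult (snd P) (snd P) = snd P"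
  by (cases P) (auto simp: P_inf_def projections_def)

text \<open>Rectangular blocks are allowed because the partial isometries between projections of
  different sizes are rectangular.\<close>

definition block :: "nat \<Rightarrow> nat \<Rightarrow> 'a::cstar_algebra nmat \<Rightarrow> 'a nmat \<Rightarrow> 'a nmat" where
  "block m n x y = (\<lambda>i j. if i < m \<and> j < n then x i j
            else if m \<le> i \<and> n \<le> j then y (i - m) (j - n) else 0)"

lemma dsum_block: "dsum P Q = (fst P + fst Q, block (fst P) (fst P) (snd P) (snd Q))"
  by (simp add: dsum_def block_def)

lemma block_corner:
  assumes "x \<in> corner m n" "y \<in> corner m' n'"
  shows "block m n x y \<in> corner (m + m') (n + n')"
  using assms by (auto simp: block_def corner_def)

lemma sum_lessThan_add: "(\<Sum>k<m + n. f k) = (\<Sum>k<m. f k) + (\<Sum>k<n. f (m + k))" for f :: "nat \<Rightarrow> 'b::comm_monoid_add"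
  by (induction n) (auto simp: add.assoc)

lemma mmult_block:
  assumes "x \<in> corner m k" "y \<in> corner m' k'" "x' \<in> corner k n" "y' \<in> corner k' n'"
  shows "mmult (block m k x y) (block k n x' y') = block m n (mmult x x') (mmult y y')"
proof (intro ext)
  fix i j
  have "mmult (block m k x y) (block k n x' y') i j = (\<Sum>l<k + k'. block m k x y i l * block k n x' y' l j)"
    using block_corner assms by (intro mmult_corner_eq[of _ "m + m'" _ _ "n + n'"]) blast
  also have "\<dots> = block m n (mmult x x') (mmult y y') i j"
  proof -
    have e: "mmult x x' a b = (\<Sum>l<k. x a l * x' l b)" "mmult y y' a b = (\<Sum>l<k'. y a l * y' l b)" for a b
      using assms mmult_corner_eq by blast+
    show ?thesis
      by (auto simp: block_def not_less sum_lessThan_add e intro!: sum.neutral)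
  qed
  finally show "mmult (block m k x y) (block k n x' y') i j = block m n (mmult x x') (mmult y y') i j" .
qed

lemma mstar_block: "mstar (block m n x y) = block n m (mstar x) (mstar y)"
  by (auto simp: block_def mstar_def fun_eq_iff)

lemma dsum_P_inf [intro]: "P \<in> P_inf \<Longrightarrow> Q \<in> P_inf \<Longrightarrow> dsum P Q \<in> P_inf"
  by (auto simp: P_inf_iff dsum_block mstar_block block_corner
      mmult_block[of _ "fst P" "fst P" _ "fst Q" "fst Q" _ "fst P" _ "fst Q"])

lemma dsum_assoc: "dsum (dsum P Q) R = dsum P (dsum Q R)"
  by (auto simp: dsum_def fun_eq_iff)

lemma zero_proj_P_inf [intro, simp]: "zero_proj \<in> P_inf"
  by (simp add: P_inf_iff zero_proj_def corner_def mstar_def)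

lemma dsum_zero_right: "P \<in> P_inf \<Longrightarrow> dsum P zero_proj = P"
  by (cases P) (auto simp: dsum_def zero_proj_def P_inf_iff corner_def fun_eq_iff)

lemma dsum_zero_left: "P \<in> P_inf \<Longrightarrow> dsum zero_proj P = P"
  by (cases P) (auto simp: dsum_def zero_proj_def P_inf_iff corner_def fun_eq_iff)

lemma mvn_equiv_refl: "P \<in> P_inf \<Longrightarrow> mvn_equiv P P"
  by (auto simp: mvn_equiv_def P_inf_iff intro!: bexI[of _ "snd P"])

lemma mvn_equiv_sym: "mvn_equiv P Q \<Longrightarrow> mvn_equiv Q P"
  unfolding mvn_equiv_def by (metis mstar_corner mstar_mstar)

text \<open>The partial isometries v and w compose. As \<open>mstar w\<close> times w is
  \<open>snd Q\<close>, which is also v times \<open>mstar v\<close>, the products collapse to the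
  squares of \<open>snd P\<close> and \<open>snd R\<close>; idempotence of these two finishes the
  argument.\<close>

lemma mvn_equiv_trans:
  assumes P: "P \<in> P_inf" and R: "R \<in> P_inf" and "mvn_equiv P Q" "mvn_equiv Q R"
  shows "mvn_equiv P R"
proof -
  obtain v where v: "v \<in> corner (fst Q) (fst P)" "mmult (mstar v) v = snd P" "mmult v (mstar v) = snd Q"
    using assms unfolding mvn_equiv_def by blast
  obtain w where w: "w \<in> corner (fst R) (fst Q)" "mmult (mstar w) w = snd Q" "mmult w (mstar w) = snd R"
    using assms unfolding mvn_equiv_def by blast
  note sv = mstar_corner[OF v(1)] and sw = mstar_corner[OF w(1)]
  have wv: "mmult w v \<in> corner (fst R) (fst P)" using w v by auto
  have swv: "mstar (mmult w v) = mmult (mstar v) (mstar w)" by (rule mstar_mmult[OF w(1) v(1)])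
  have "mmult (mstar (mmult w v)) (mmult w v) = mmult (mstar v) (mmult (mmult (mstar w) w) v)"
    unfolding swv by (simp add: mmult_assoc[OF sv sw wv] mmult_assoc[OF sw w(1) v(1)])
  also have "\<dots> = mmult (mmult (mstar v) v) (mmult (mstar v) v)"
    unfolding w(2) v(3)[symmetric]
    by (simp add: mmult_assoc[OF v(1) sv v(1)] mmult_assoc[OF sv v(1) mmult_corner[OF sv v(1)]])
  also have "\<dots> = snd P" using P v(2) by (simp add: P_inf_iff)
  finally have 1: "mmult (mstar (mmult w v)) (mmult w v) = snd P" .
  have "mmult (mmult w v) (mstar (mmult w v)) = mmult w (mmult (mmult v (mstar v)) (mstar w))"
    unfolding swv by (simp add: mmult_assoc[OF w(1) v(1) mmult_corner[OF sv sw]] mmult_assoc[OF v(1) sv sw])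
  also have "\<dots> = mmult (mmult w (mstar w)) (mmult w (mstar w))"
    unfolding v(3) w(2)[symmetric]
    by (simp add: mmult_assoc[OF sw w(1) sw] mmult_assoc[OF w(1) sw mmult_corner[OF w(1) sw]])
  also have "\<dots> = snd R" using R w(3) by (simp add: P_inf_iff)
  finally show ?thesis using 1 wv unfolding mvn_equiv_def by blast
qed

lemma mvn_equiv_dsum:
  assumes "mvn_equiv P P'" "mvn_equiv Q Q'"
  shows "mvn_equiv (dsum P Q) (dsum P' Q')"
proof -
  obtain v where v: "v \<in> corner (fst P') (fst P)" "mmult (mstar v) v = snd P" "mmult v (mstar v) = snd P'"
    using assms unfolding mvn_equiv_def by blast
  obtain w where w: "w \<in> corner (fst Q') (fst Q)" "mmult (mstar w) w = snd Q" "mmult w (mstar w) = snd Q'"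
    using assms unfolding mvn_equiv_def by blast
  have "block (fst P') (fst P) v w \<in> corner (fst P' + fst Q') (fst P + fst Q)"
    by (rule block_corner[OF v(1) w(1)])
  moreover have "mmult (mstar (block (fst P') (fst P) v w)) (block (fst P') (fst P) v w) = snd (dsum P Q)"
    using mmult_block[OF mstar_corner[OF v(1)] mstar_corner[OF w(1)] v(1) w(1)]
    by (simp add: mstar_block dsum_block v w)
  moreover have "mmult (block (fst P') (fst P) v w) (mstar (block (fst P') (fst P) v w)) = snd (dsum P' Q')"
    using mmult_block[OF v(1) w(1) mstar_corner[OF v(1)] mstar_corner[OF w(1)]]
    by (simp add: mstar_block dsum_block v w)
  ultimately show ?thesis unfolding mvn_equiv_def by (auto simp: dsum_block)
qed

lemma mvn_equiv_dsum_commute: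
  assumes P: "P \<in> P_inf" and Q: "Q \<in> P_inf"
  shows "mvn_equiv (dsum P Q) (dsum Q P)"
proof -
  define m where "m = fst P"
  define n where "n = fst Q"
  define p where "p = snd P"
  define q where "q = snd Q"
  have p: "p \<in> corner m m" "mstar p = p" "mmult p p = p" and q: "q \<in> corner n n" "mstar q = q" "mmult q q = q"
    using P Q by (auto simp: P_inf_iff m_def n_def p_def q_def)
  have p': "(\<Sum>k<m. p i k * p k j) = p i j" for i j
    using mmult_corner_eq[of p m m p m i j] p by simp
  have q': "(\<Sum>k<n. q i k * q k j) = q i j" for i j
    using mmult_corner_eq[of q n n q n i j] q by simp
  have ps: "star (p i j) = p j i" and qs: "star (q i j) = q j i" for i j
    using p(2) q(2) by (metis mstar_def)+
  \<comment> \<open>The flip of the two summands cut down to the projections: the block matrix with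
    rows (0, q) and (p, 0).\<close>
  define v where "v i j = (if i < n \<and> m \<le> j then q i (j - m) else if n \<le> i \<and> j < m then p (i - n) j else 0)" for i j
  have v: "v \<in> corner (n + m) (m + n)"
    using p(1) q(1) by (auto simp: corner_def v_def)
  have vs: "mstar v i j = (if j < n \<and> m \<le> i then q (i - m) j else if n \<le> j \<and> i < m then p i (j - n) else 0)" for i j
    by (simp add: mstar_def v_def ps qs)
  have 1: "mmult (mstar v) v = block m m p q"
  proof (intro ext)
    fix i j
    have "mmult (mstar v) v i j = (\<Sum>k<n + m. mstar v i k * v k j)"
      using v by (intro mmult_corner_eq[of _ "m + n" _ _ "m + n"]) auto
    also have "\<dots> = block m m p q i j"
      unfolding sum_lessThan_add vs v_def
      using p' q' by (auto simp: block_def not_less)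
    finally show "mmult (mstar v) v i j = block m m p q i j" .
  qed
  have 2: "mmult v (mstar v) = block n n q p"
  proof (intro ext)
    fix i j
    have "mmult v (mstar v) i j = (\<Sum>k<m + n. v i k * mstar v k j)"
      using v by (intro mmult_corner_eq[of _ "n + m" _ _ "n + m"]) auto
    also have "\<dots> = block n n q p i j"
      unfolding sum_lessThan_add vs v_def
      using p' q' by (auto simp: block_def not_less)
    finally show "mmult v (mstar v) i j = block n n q p i j" .
  qed
  show ?thesis
    unfolding mvn_equiv_def using 1 2 v by (auto simp: dsum_block m_def n_def p_def q_def)
qed

text \<open>Iterated sums reduce associativity and commutativity up to equivalence to a comparison
  of multisets of summands.\<close>

definition dsums :: "(nat \<times> 'a::cstar_algebra nmat) list \<Rightarrow> nat \<times> 'a nmat" where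
  "dsums Ps = foldr dsum Ps zero_proj"

lemma dsums_simps [simp]: "dsums [] = zero_proj" "dsums (P # Ps) = dsum P (dsums Ps)"
  by (simp_all add: dsums_def)

lemma dsums_P_inf [intro]: "set Ps \<subseteq> P_inf \<Longrightarrow> dsums Ps \<in> P_inf"
  by (induction Ps) auto

lemma dsums_append: "set Ps \<subseteq> P_inf \<Longrightarrow> set Qs \<subseteq> P_inf \<Longrightarrow> dsums (Ps @ Qs) = dsum (dsums Ps) (dsums Qs)"
  by (induction Ps) (auto simp: dsum_zero_left dsums_P_inf dsum_assoc)

lemma mvn_equiv_dsums_remove:
  assumes "set Ps \<subseteq> P_inf" "P \<in> set Ps"
  shows "mvn_equiv (dsums Ps) (dsum P (dsums (remove1 P Ps)))"
  using assms
proof (induction Ps)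
  case (Cons Q Ps)
  show ?case
  proof (cases "P = Q")
    case False
    let ?R = "dsums (remove1 P Ps)"
    have in_P: "P \<in> P_inf" "Q \<in> P_inf" "?R \<in> P_inf" "dsums Ps \<in> P_inf"
      using Cons.prems False set_remove1_subset[of P Ps] by (auto intro!: dsums_P_inf)
    have "mvn_equiv (dsum Q (dsums Ps)) (dsum Q (dsum P ?R))"
      using Cons False in_P by (intro mvn_equiv_dsum mvn_equiv_refl) auto
    moreover have "mvn_equiv (dsum (dsum Q P) ?R) (dsum (dsum P Q) ?R)"
      using in_P by (intro mvn_equiv_dsum mvn_equiv_refl mvn_equiv_dsum_commute)
    ultimately have "mvn_equiv (dsum Q (dsums Ps)) (dsum (dsum P Q) ?R)"
      using in_P by (intro mvn_equiv_trans[of "dsum Q (dsums Ps)" "dsum (dsum P Q) ?R" "dsum Q (dsum P ?R)"])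
        (auto simp: dsum_assoc)
    then show ?thesis using False by (simp add: dsum_assoc)
  qed (use Cons.prems in \<open>auto intro!: mvn_equiv_refl\<close>)
qed simp

lemma mvn_equiv_dsums_mset:
  assumes "set Ps \<subseteq> P_inf" "mset Ps = mset Qs"
  shows "mvn_equiv (dsums Ps) (dsums Qs)"
  using assms
proof (induction Ps arbitrary: Qs)
  case Nil
  then show ?case by (auto intro!: mvn_equiv_refl)
next
  case (Cons P Ps)
  have PQ: "P \<in> set Qs" "set Qs \<subseteq> P_inf" and ms: "mset Ps = mset (remove1 P Qs)"
    using Cons.prems 
  proof -
    have "set Qs = set (P # Ps)" using Cons.prems(2) by (metis set_mset_mset)
    then show "P \<in> set Qs" "set Qs \<subseteq> P_inf" using Cons.prems(1) by auto
    show "mset Ps = mset (remove1 P Qs)" using Cons.prems(2)[symmetric] by simp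
  qed
  have in_P: "P \<in> P_inf" "dsums Ps \<in> P_inf" "dsums Qs \<in> P_inf"
    using Cons.prems PQ by auto
  have "mvn_equiv (dsum P (dsums Ps)) (dsum P (dsums (remove1 P Qs)))"
    using Cons.IH[OF _ ms] Cons.prems by (intro mvn_equiv_dsum mvn_equiv_refl) auto
  moreover have "mvn_equiv (dsum P (dsums (remove1 P Qs))) (dsums Qs)"
    by (rule mvn_equiv_sym[OF mvn_equiv_dsums_remove[OF PQ(2,1)]])
  ultimately show ?case using in_P by (auto intro: mvn_equiv_trans[rotated 2])
qed


section \<open>The Grothendieck group of matrix projections\<close>

text \<open>A list in place of the stabilizing summand can be collected from several equivalences;
  the empty list covers the case without stabilization.\<close>

lemma K0_rel_iff: "((p, q), (p', q')) \<in> K0_rel \<longleftrightarrow> p \<in> P_inf \<and> q \<in> P_inf \<and> p' \<in> P_inf \<and> q' \<in> P_inf \<and>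
    (\<exists>Rs. set Rs \<subseteq> P_inf \<and> mvn_equiv (dsums (p # q' # Rs)) (dsums (p' # q # Rs)))"
proof
  assume "((p, q), (p', q')) \<in> K0_rel"
  then obtain r where r: "p \<in> P_inf" "q \<in> P_inf" "p' \<in> P_inf" "q' \<in> P_inf" "r \<in> P_inf"
    "mvn_equiv (dsum (dsum p q') r) (dsum (dsum p' q) r)"
    by (auto simp: K0_rel_def)
  then have "mvn_equiv (dsums (p # q' # [r])) (dsums (p' # q # [r]))"
    by (simp add: dsum_zero_right dsum_assoc)
  with r show "p \<in> P_inf \<and> q \<in> P_inf \<and> p' \<in> P_inf \<and> q' \<in> P_inf \<and>
    (\<exists>Rs. set Rs \<subseteq> P_inf \<and> mvn_equiv (dsums (p # q' # Rs)) (dsums (p' # q # Rs)))"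
    by (intro conjI exI[of _ "[r]"]) auto
next
  assume *: "p \<in> P_inf \<and> q \<in> P_inf \<and> p' \<in> P_inf \<and> q' \<in> P_inf \<and>
    (\<exists>Rs. set Rs \<subseteq> P_inf \<and> mvn_equiv (dsums (p # q' # Rs)) (dsums (p' # q # Rs)))"
  then obtain Rs where "set Rs \<subseteq> P_inf" "mvn_equiv (dsums (p # q' # Rs)) (dsums (p' # q # Rs))" by blast
  with * show "((p, q), (p', q')) \<in> K0_rel"
    unfolding K0_rel_def using dsums_P_inf[of Rs] by (auto simp: dsum_assoc intro!: bexI[of _ "dsums Rs"])
qed

lemma K0_relE:
  assumes "((p, q), (p', q')) \<in> K0_rel"
  obtains Rs where "p \<in> P_inf" "q \<in> P_inf" "p' \<in> P_inf" "q' \<in> P_inf" "set Rs \<subseteq> P_inf"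
    "mvn_equiv (dsums (p # q' # Rs)) (dsums (p' # q # Rs))"
  using assms unfolding K0_rel_iff by blast

text \<open>Adding two equivalences and rearranging the summands is the one step behind both
  transitivity of \<open>K0_rel\<close> and the well-definedness of addition.\<close>

lemma mvn_equiv_dsums_append:
  assumes "mvn_equiv (dsums Ps) (dsums Ps')" "mvn_equiv (dsums Qs) (dsums Qs')"
    and "set Ps \<subseteq> P_inf" "set Ps' \<subseteq> P_inf" "set Qs \<subseteq> P_inf" "set Qs' \<subseteq> P_inf"
    and "mset Rs = mset (Ps @ Qs)" "mset Rs' = mset (Ps' @ Qs')"
  shows "mvn_equiv (dsums Rs) (dsums Rs')"
proof -
  have sets: "set Rs \<subseteq> P_inf" "set Rs' \<subseteq> P_inf" "set (Ps @ Qs) \<subseteq> P_inf" "set (Ps' @ Qs') \<subseteq> P_inf"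
    using assms(3-8) by (metis set_append Un_least set_mset_mset)+
  have "mvn_equiv (dsums (Ps @ Qs)) (dsums (Ps' @ Qs'))"
    using assms by (simp add: dsums_append mvn_equiv_dsum)
  moreover have "mvn_equiv (dsums Rs) (dsums (Ps @ Qs))" "mvn_equiv (dsums (Ps' @ Qs')) (dsums Rs')"
    using sets assms(7,8) by (auto intro!: mvn_equiv_dsums_mset)
  ultimately show ?thesis
    using sets by (meson mvn_equiv_trans dsums_P_inf)
qed

lemma equiv_K0_rel: "equiv (P_inf \<times> P_inf) K0_rel"
proof (rule equivI)
  show "K0_rel \<subseteq> (P_inf \<times> P_inf) \<times> P_inf \<times> P_inf" by (auto simp: K0_rel_iff)
  show "refl_on (P_inf \<times> P_inf) K0_rel"
    by (auto simp: refl_on_def K0_rel_iff intro!: exI[of _ "[]"] mvn_equiv_refl dsum_P_inf)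
  show "sym K0_rel"
    unfolding sym_def by (auto simp: K0_rel_iff dest: mvn_equiv_sym)
  show "trans K0_rel"
  proof (rule transI)
    fix x y z
    assume xyz: "(x, y) \<in> K0_rel" "(y, z) \<in> K0_rel"
    obtain p q p' q' p'' q'' where eq: "x = (p, q)" "y = (p', q')" "z = (p'', q'')"
      by (cases x, cases y, cases z)
    note rel = xyz[unfolded eq]
    obtain Rs where 1: "p \<in> P_inf" "q \<in> P_inf" "p' \<in> P_inf" "q' \<in> P_inf" "set Rs \<subseteq> P_inf"
      "mvn_equiv (dsums (p # q' # Rs)) (dsums (p' # q # Rs))"
      by (rule K0_relE[OF rel(1)])
    obtain Rs' where 2: "p' \<in> P_inf" "q' \<in> P_inf" "p'' \<in> P_inf" "q'' \<in> P_inf" "set Rs' \<subseteq> P_inf"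
      "mvn_equiv (dsums (p' # q'' # Rs')) (dsums (p'' # q' # Rs'))"
      by (rule K0_relE[OF rel(2)])
    note * = 1(1-5) 2(1-5)
    \<comment> \<open>The summands p' and q', which occur on both sides after the two equivalences
      are added, join the stabilizing part.\<close>
    have "mvn_equiv (dsums (p # q'' # (q' # p' # Rs @ Rs'))) (dsums (p'' # q # (q' # p' # Rs @ Rs')))"
      by (rule mvn_equiv_dsums_append[OF 1(6) 2(6)]) (simp_all add: *)
    with * show "(x, z) \<in> K0_rel"
      unfolding eq K0_rel_iff by (intro conjI exI[of _ "q' # p' # Rs @ Rs'"]) auto
  qed
qed

lemma K0_diff_eq_iff:
  assumes "p \<in> P_inf" "q \<in> P_inf" "p' \<in> P_inf" "q' \<in> P_inf"
  shows "K0_diff p q = K0_diff p' q' \<longleftrightarrow> ((p, q), (p', q')) \<in> K0_rel"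
  unfolding K0_diff_def using assms by (intro eq_equiv_class_iff[OF equiv_K0_rel]) auto

lemma K0_carrier_iff: "x \<in> carrier K0 \<longleftrightarrow> (\<exists>p\<in>P_inf. \<exists>q\<in>P_inf. x = K0_diff p q)"
  by (auto simp: K0_def quotient_def K0_diff_def)

lemma K0_carrierE:
  assumes "x \<in> carrier K0"
  obtains p q where "p \<in> P_inf" "q \<in> P_inf" "x = K0_diff p q"
  using assms by (auto simp: K0_carrier_iff)

lemma K0_mult:
  assumes in_P: "p \<in> P_inf" "q \<in> P_inf" "p' \<in> P_inf" "q' \<in> P_inf"
  shows "K0_diff p q \<otimes>\<^bsub>K0\<^esub> K0_diff p' q' = K0_diff (dsum p p') (dsum q q')"
proof -
  have eq: "K0_diff (dsum a a') (dsum b b') = K0_diff (dsum p p') (dsum q q')"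
    if "((p, q), (a, b)) \<in> K0_rel" "((p', q'), (a', b')) \<in> K0_rel" for a b a' b'
  proof -
    note rel = that
    obtain Rs where 1: "p \<in> P_inf" "q \<in> P_inf" "a \<in> P_inf" "b \<in> P_inf" "set Rs \<subseteq> P_inf"
      "mvn_equiv (dsums (p # b # Rs)) (dsums (a # q # Rs))"
      by (rule K0_relE[OF rel(1)])
    obtain Rs' where 2: "p' \<in> P_inf" "q' \<in> P_inf" "a' \<in> P_inf" "b' \<in> P_inf" "set Rs' \<subseteq> P_inf"
      "mvn_equiv (dsums (p' # b' # Rs')) (dsums (a' # q' # Rs'))"
      by (rule K0_relE[OF rel(2)])
    note * = 1(1-5) 2(1-5)
    have "mvn_equiv (dsums (p # p' # b # b' # Rs @ Rs')) (dsums (a # a' # q # q' # Rs @ Rs'))"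
      by (rule mvn_equiv_dsums_append[OF 1(6) 2(6)]) (simp_all add: * in_P)
    then have "mvn_equiv (dsums (dsum p p' # dsum b b' # Rs @ Rs')) (dsums (dsum a a' # dsum q q' # Rs @ Rs'))"
      by (simp add: dsum_assoc)
    then have "((dsum p p', dsum q q'), (dsum a a', dsum b b')) \<in> K0_rel"
      unfolding K0_rel_iff using * in_P by (intro conjI exI[of _ "Rs @ Rs'"]) auto
    then show ?thesis using * in_P by (metis K0_diff_eq_iff dsum_P_inf)
  qed
  have "(p, q) \<in> K0_diff p q" "(p', q') \<in> K0_diff p' q'"
    unfolding K0_diff_def
    using in_P by (auto simp: K0_rel_iff intro!: exI[of _ "[]"] mvn_equiv_refl dsum_P_inf)
  note self = this
  have "(\<Union>(a, b)\<in>K0_diff p q. \<Union>(a', b')\<in>K0_diff p' q'. K0_diff (dsum a a') (dsum b b')) = K0_diff (dsum p p') (dsum q q')"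
    (is "?L = ?R")
  proof (intro equalityI subsetI)
    fix z assume "z \<in> ?L"
    then obtain a b a' b' where ab: "(a, b) \<in> K0_diff p q" "(a', b') \<in> K0_diff p' q'"
      and z: "z \<in> K0_diff (dsum a a') (dsum b b')" by blast
    have "K0_diff (dsum a a') (dsum b b') = ?R"
      using ab by (intro eq) (simp_all add: K0_diff_def)
    then show "z \<in> ?R" using z by simp
  next
    fix z assume "z \<in> ?R"
    then show "z \<in> ?L" using self by blast
  qed
  then show ?thesis by (simp add: K0_def)
qed

lemma K0_one: "\<one>\<^bsub>K0\<^esub> = K0_diff zero_proj zero_proj"
  by (simp add: K0_def K0_class_def)

lemma comm_group_K0: "comm_group K0"
proof (rule comm_groupI)
  fix x y z :: "'a k0"
  assume carr: "x \<in> carrier K0" "y \<in> carrier K0" "z \<in> carrier K0"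
  obtain p q where pq: "p \<in> P_inf" "q \<in> P_inf" "x = K0_diff p q" by (rule K0_carrierE[OF carr(1)])
  obtain p' q' where pq': "p' \<in> P_inf" "q' \<in> P_inf" "y = K0_diff p' q'" by (rule K0_carrierE[OF carr(2)])
  obtain p'' q'' where pq'': "p'' \<in> P_inf" "q'' \<in> P_inf" "z = K0_diff p'' q''" by (rule K0_carrierE[OF carr(3)])
  note in_P = pq(1,2) pq'(1,2) pq''(1,2)
  note simps = pq pq' pq'' K0_mult dsum_P_inf dsum_assoc
  show "x \<otimes>\<^bsub>K0\<^esub> y \<in> carrier K0"
    unfolding pq pq' K0_mult[OF pq(1,2) pq'(1,2)] using in_P by (auto simp: K0_carrier_iff)
  show "x \<otimes>\<^bsub>K0\<^esub> y \<otimes>\<^bsub>K0\<^esub> z = x \<otimes>\<^bsub>K0\<^esub> (y \<otimes>\<^bsub>K0\<^esub> z)" by (simp add: simps)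
  have "mvn_equiv (dsums [p, p', q', q]) (dsums [p', p, q, q'])"
    using in_P by (intro mvn_equiv_dsums_mset) auto
  then have "((dsum p p', dsum q q'), (dsum p' p, dsum q' q)) \<in> K0_rel"
    unfolding K0_rel_iff using in_P by (intro conjI exI[of _ "[]"]) (auto simp: dsum_assoc)
  then show "x \<otimes>\<^bsub>K0\<^esub> y = y \<otimes>\<^bsub>K0\<^esub> x" by (simp add: simps K0_diff_eq_iff)
next
  show "\<one>\<^bsub>K0\<^esub> \<in> carrier K0" unfolding K0_carrier_iff K0_one by blast
  fix x :: "'a k0" assume x: "x \<in> carrier K0"
  obtain p q where in_P: "p \<in> P_inf" "q \<in> P_inf" and eq: "x = K0_diff p q" by (rule K0_carrierE[OF x])
  show "\<one>\<^bsub>K0\<^esub> \<otimes>\<^bsub>K0\<^esub> x = x" using in_P by (simp add: eq K0_one K0_mult dsum_zero_left)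
  have "((dsum q p, dsum p q), (zero_proj, zero_proj)) \<in> K0_rel"
    unfolding K0_rel_iff using in_P
    by (intro conjI exI[of _ "[]"]) (auto simp: dsum_zero_left dsum_zero_right dsum_P_inf intro!: mvn_equiv_dsum_commute)
  then have "K0_diff q p \<otimes>\<^bsub>K0\<^esub> x = \<one>\<^bsub>K0\<^esub>" using in_P by (simp add: eq K0_mult K0_one K0_diff_eq_iff dsum_P_inf)
  then show "\<exists>y\<in>carrier K0. y \<otimes>\<^bsub>K0\<^esub> x = \<one>\<^bsub>K0\<^esub>" 
    using in_P by (intro bexI[of _ "K0_diff q p"]) (auto simp: K0_carrier_iff)
qed

section \<open>The pairing with traces\<close>

lemma matrix_trace_mvn_equiv:
  assumes "bounded_trace \<tau>" and "mvn_equiv P Q"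
  shows "matrix_trace \<tau> P = matrix_trace \<tau> Q"
proof -
  interpret bounded_trace \<tau> by fact
  obtain v where v: "v \<in> corner (fst Q) (fst P)" "mmult (mstar v) v = snd P" "mmult v (mstar v) = snd Q"
    using assms unfolding mvn_equiv_def by blast
  have "matrix_trace \<tau> P = (\<Sum>i<fst P. \<Sum>k<fst Q. \<tau> (star (v k i) * v k i))"
    unfolding matrix_trace_def v(2)[symmetric] using v(1)
    by (subst mmult_corner_eq[of _ "fst P" "fst Q" _ "fst P"]) (auto simp: mstar_def sum)
  also have "\<dots> = (\<Sum>k<fst Q. \<Sum>i<fst P. \<tau> (v k i * star (v k i)))"
    by (subst sum.swap) (simp add: commute)
  also have "\<dots> = matrix_trace \<tau> Q"
    unfolding matrix_trace_def v(3)[symmetric] using v(1)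
    by (subst mmult_corner_eq[of _ "fst Q" "fst P" _ "fst Q"]) (auto simp: mstar_def sum)
  finally show ?thesis .
qed

lemma matrix_trace_dsum: "matrix_trace \<tau> (dsum P Q) = matrix_trace \<tau> P + matrix_trace \<tau> Q"
  by (simp add: matrix_trace_def dsum_def sum_lessThan_add)

lemma matrix_trace_K0_rel:
  assumes "bounded_trace \<tau>" "((p, q), (p', q')) \<in> K0_rel"
  shows "matrix_trace \<tau> p - matrix_trace \<tau> q = matrix_trace \<tau> p' - matrix_trace \<tau> q'"
proof -
  obtain r where "mvn_equiv (dsum (dsum p q') r) (dsum (dsum p' q) r)"
    using assms(2) by (auto simp: K0_rel_def)
  from matrix_trace_mvn_equiv[OF assms(1) this] show ?thesis
    by (simp add: matrix_trace_dsum algebra_simps)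
qed


lemma matrix_trace_real:
  assumes "\<tau> \<in> tracial_states" "P \<in> P_inf"
  shows "of_real (Re (matrix_trace \<tau> P)) = matrix_trace \<tau> P"
proof -
  have "star (snd P i i) = snd P i i" for i
    using assms(2) unfolding P_inf_iff by (metis mstar_def)
  then have "snd P i i \<in> selfadjoint" for i by (simp add: selfadjoint_def)
  then show ?thesis
    by (simp add: matrix_trace_def tracial_state_selfadjoint_real[OF assms(1)])
qed

text \<open>This justifies the definite description in \<open>rho\<close>: traces of projections are
  real because the diagonal entries are selfadjoint, and on a class the difference is constant
  because the stabilizing summand cancels.\<close>

lemma rho_K0_diff:
  assumes \<tau>: "\<tau> \<in> tracial_states" and pq: "p \<in> P_inf" "q \<in> P_inf"
  shows "of_real (rho (K0_diff p q) \<tau>) = matrix_trace \<tau> p - matrix_trace \<tau> q"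
proof -
  let ?r = "Re (matrix_trace \<tau> p) - Re (matrix_trace \<tau> q)"
  have r: "of_real ?r = matrix_trace \<tau> p - matrix_trace \<tau> q"
    using matrix_trace_real[OF \<tau>] pq by simp
  have self: "(p, q) \<in> K0_diff p q"
    unfolding K0_diff_def
    using pq by (auto simp: K0_rel_iff intro!: exI[of _ "[]"] mvn_equiv_refl dsum_P_inf)
  have "(THE r. \<forall>(p', q') \<in> K0_diff p q. of_real r = matrix_trace \<tau> p' - matrix_trace \<tau> q') = ?r"
  proof (rule the_equality)
    show "\<forall>(p', q') \<in> K0_diff p q. of_real ?r = matrix_trace \<tau> p' - matrix_trace \<tau> q'"
      unfolding r K0_diff_def
      using matrix_trace_K0_rel[OF bounded_trace_tracial_state[OF \<tau>]] by auto
  next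
    fix r' :: real
    assume "\<forall>(p', q') \<in> K0_diff p q. of_real r' = matrix_trace \<tau> p' - matrix_trace \<tau> q'"
    then have "complex_of_real r' = of_real ?r" unfolding r using self by auto
    then show "r' = ?r" by (simp only: of_real_eq_iff)
  qed
  then show ?thesis using \<tau> r by (simp add: rho_def)
qed

lemma rho_outside: "\<tau> \<notin> tracial_states \<Longrightarrow> rho x \<tau> = 0"
  by (simp add: rho_def)

lemma rho_mult:
  assumes x: "x \<in> carrier K0" and y: "y \<in> carrier K0"
  shows "rho (x \<otimes>\<^bsub>K0\<^esub> y) \<tau> = rho x \<tau> + rho y \<tau>"
proof (cases "\<tau> \<in> tracial_states")
  case True
  obtain p q where pq: "p \<in> P_inf" "q \<in> P_inf" "x = K0_diff p q" by (rule K0_carrierE[OF x])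
  obtain p' q' where pq': "p' \<in> P_inf" "q' \<in> P_inf" "y = K0_diff p' q'" by (rule K0_carrierE[OF y])
  have "complex_of_real (rho (x \<otimes>\<^bsub>K0\<^esub> y) \<tau>) = of_real (rho x \<tau> + rho y \<tau>)"
    unfolding pq(3) pq'(3) K0_mult[OF pq(1,2) pq'(1,2)] of_real_add
    using pq pq' by (simp add: rho_K0_diff[OF True] dsum_P_inf matrix_trace_dsum)
  then show ?thesis by (simp only: of_real_eq_iff)
qed (simp add: rho_outside)

lemma rho_one: "rho \<one>\<^bsub>K0\<^esub> \<tau> = 0"
proof -
  interpret K0: comm_group K0 by (rule comm_group_K0)
  show ?thesis using rho_mult[OF K0.one_closed K0.one_closed, of \<tau>] by simp
qed

lemma rho_inv:
  assumes x: "x \<in> carrier K0"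
  shows "rho (inv\<^bsub>K0\<^esub> x) \<tau> = - rho x \<tau>"
proof -
  interpret K0: comm_group K0 by (rule comm_group_K0)
  show ?thesis using rho_mult[OF x K0.inv_closed[OF x], of \<tau>] x by (simp add: rho_one)
qed

section \<open>Loops and the topology of the inductive limit\<close>

lemma loop_homotopy_refl: "g \<in> loops X x \<Longrightarrow> (g, g) \<in> loop_homotopy X x"
  by (auto simp: loop_homotopy_def loops_def pathin_def)

lemma loop_homotopy_sym: "(g, h) \<in> loop_homotopy X x \<Longrightarrow> (h, g) \<in> loop_homotopy X x"
  by (auto simp: loop_homotopy_def homotopic_with_sym)

lemma loop_homotopy_trans: "(g, h) \<in> loop_homotopy X x \<Longrightarrow> (h, k) \<in> loop_homotopy X x \<Longrightarrow> (g, k) \<in> loop_homotopy X x"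
  by (auto simp: loop_homotopy_def intro: homotopic_with_trans)

lemma equiv_loop_homotopy: "equiv (loops X x) (loop_homotopy X x)"
proof (rule equivI)
  show "loop_homotopy X x \<subseteq> loops X x \<times> loops X x" by (auto simp: loop_homotopy_def)
  show "refl_on (loops X x) (loop_homotopy X x)" by (simp add: refl_on_def loop_homotopy_refl)
  show "sym (loop_homotopy X x)" using loop_homotopy_sym by (rule symI)
  show "trans (loop_homotopy X x)" using loop_homotopy_trans by (rule transI)
qed

lemma loop_class_eq_iff:
  "g \<in> loops X x \<Longrightarrow> h \<in> loops X x \<Longrightarrow> loop_class X x g = loop_class X x h \<longleftrightarrow> (g, h) \<in> loop_homotopy X x"
  unfolding loop_class_def by (rule eq_equiv_class_iff[OF equiv_loop_homotopy])

lemma loop_class_self: "g \<in> loops X x \<Longrightarrow> g \<in> loop_class X x g"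
  by (simp add: loop_class_def loop_homotopy_refl)

lemma loop_class_memD: "h \<in> loop_class X x g \<Longrightarrow> (g, h) \<in> loop_homotopy X x"
  by (simp add: loop_class_def)

lemma pi1_carrierE:
  assumes "c \<in> carrier (pi1 X x)"
  obtains g where "g \<in> loops X x" "c = loop_class X x g"
  using assms by (auto simp: pi1_def loop_class_def elim: quotientE)

lemma loop_class_carrier: "g \<in> loops X x \<Longrightarrow> loop_class X x g \<in> carrier (pi1 X x)"
  by (simp add: pi1_def loop_class_def quotientI)

lemma loops_compose:
  assumes "continuous_map X Y f" "g \<in> loops X x"
  shows "f \<circ> g \<in> loops Y (f x)"
  using assms by (auto simp: loops_def pathin_def intro: continuous_map_compose)

lemma loop_homotopy_compose:
  assumes f: "continuous_map X Y f" and gh: "(g, h) \<in> loop_homotopy X x"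
  shows "(f \<circ> g, f \<circ> h) \<in> loop_homotopy Y (f x)"
proof -
  have "homotopic_with (\<lambda>k. k 0 = x \<and> k 1 = x) (top_of_set {0..1}) X g h"
    using gh by (simp add: loop_homotopy_def)
  then have "homotopic_with (\<lambda>k. k 0 = f x \<and> k 1 = f x) (top_of_set {0..1}) Y (f \<circ> g) (f \<circ> h)"
    by (rule homotopic_with_compose_continuous_map_left[OF _ f]) simp
  then show ?thesis using gh loops_compose[OF f] by (auto simp: loop_homotopy_def)
qed

lemma pi1_map_loop_class:
  assumes f: "continuous_map X Y f" and g: "g \<in> loops X x" and y: "f x = y"
  shows "pi1_map Y y f (loop_class X x g) = loop_class Y y (f \<circ> g)"
proof -
  have "loop_class Y y (f \<circ> h) = loop_class Y y (f \<circ> g)" if h: "h \<in> loop_class X x g" for h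
  proof -
    have "(g, h) \<in> loop_homotopy X x" using h by (rule loop_class_memD)
    then have "(f \<circ> g, f \<circ> h) \<in> loop_homotopy Y y" using loop_homotopy_compose[OF f] y by blast
    moreover from this have "f \<circ> g \<in> loops Y y" "f \<circ> h \<in> loops Y y" by (auto simp: loop_homotopy_def)
    ultimately show ?thesis using loop_class_eq_iff by metis
  qed
  then show ?thesis unfolding pi1_map_def using loop_class_self[OF g] by blast
qed

lemma loops_join:
  assumes g: "g \<in> loops X x" and h: "h \<in> loops X x"
  shows "g +++ h \<in> loops X x"
proof -
  let ?I = "{0..1::real}"
  have g': "continuous_map (top_of_set ?I) X g" "g 1 = x" and h': "continuous_map (top_of_set ?I) X h" "h 0 = x"
    using g h by (auto simp: loops_def pathin_def)
  have "continuous_map (top_of_set ?I) X (\<lambda>t. if t \<le> 1/2 then g (2 * t) else h (2 * t - 1))"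
  proof (rule continuous_map_cases_le)
    show "continuous_map (top_of_set ?I) euclideanreal (\<lambda>t. t)" "continuous_map (top_of_set ?I) euclideanreal (\<lambda>t. 1/2)"
      by auto
    show "continuous_map (subtopology (top_of_set ?I) {t \<in> topspace (top_of_set ?I). t \<le> 1/2}) X (\<lambda>t. g (2 * t))"
      by (rule continuous_map_compose[OF _ g'(1), unfolded o_def])
        (auto simp: continuous_map_in_subtopology subtopology_subtopology intro!: continuous_intros)
    show "continuous_map (subtopology (top_of_set ?I) {t \<in> topspace (top_of_set ?I). 1/2 \<le> t}) X (\<lambda>t. h (2 * t - 1))"
      by (rule continuous_map_compose[OF _ h'(1), unfolded o_def])
        (auto simp: continuous_map_in_subtopology subtopology_subtopology intro!: continuous_intros)
    show "g (2 * t) = h (2 * t - 1)" if "t = 1/2" for t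
    proof -
      have "2 * t = 1" using that by simp
      then show ?thesis using g' h' by simp
    qed
  qed
  then show ?thesis using g h by (simp add: loops_def pathin_def joinpaths_def)
qed

lemma loop_homotopy_join:
  assumes g: "(g, g') \<in> loop_homotopy X x" and h: "(h, h') \<in> loop_homotopy X x"
  shows "(g +++ h, g' +++ h') \<in> loop_homotopy X x"
proof -
  let ?I = "{0..1::real}"
  let ?II = "prod_topology (top_of_set ?I) (top_of_set ?I)"
  obtain k where k: "continuous_map ?II X k" "\<And>t. k (0, t) = g t" "\<And>t. k (1, t) = g' t"
    "\<And>s. s \<in> ?I \<Longrightarrow> k (s, 0) = x \<and> k (s, 1) = x"
    using g unfolding loop_homotopy_def homotopic_with_def by auto
  obtain l where l: "continuous_map ?II X l" "\<And>t. l (0, t) = h t" "\<And>t. l (1, t) = h' t"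
    "\<And>s. s \<in> ?I \<Longrightarrow> l (s, 0) = x \<and> l (s, 1) = x"
    using h unfolding loop_homotopy_def homotopic_with_def by auto
  define m where "m = (\<lambda>z. if snd z \<le> 1/2 then k (fst z, 2 * snd z) else l (fst z, 2 * snd z - 1 :: real))"
  have II: "?II = top_of_set (?I \<times> ?I)" by (simp add: subtopology_Times)
  have "continuous_map ?II X m"
    unfolding m_def
  proof (rule continuous_map_cases_le)
    show "continuous_map ?II euclideanreal snd" "continuous_map ?II euclideanreal (\<lambda>z. 1/2)"
      by (auto simp: II intro!: continuous_intros)
    show "continuous_map (subtopology ?II {z \<in> topspace ?II. snd z \<le> 1/2}) X (\<lambda>z. k (fst z, 2 * snd z))"
      unfolding II
      by (rule continuous_map_compose[OF _ k(1)[unfolded II], unfolded o_def])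
        (auto simp: continuous_map_in_subtopology subtopology_subtopology intro!: continuous_intros)
    show "continuous_map (subtopology ?II {z \<in> topspace ?II. 1/2 \<le> snd z}) X (\<lambda>z. l (fst z, 2 * snd z - 1))"
      unfolding II
      by (rule continuous_map_compose[OF _ l(1)[unfolded II], unfolded o_def])
        (auto simp: continuous_map_in_subtopology subtopology_subtopology intro!: continuous_intros)
    show "k (fst z, 2 * snd z) = l (fst z, 2 * snd z - 1)" if "z \<in> topspace ?II" "snd z = 1/2" for z
    proof -
      have "2 * snd z = 1" "fst z \<in> ?I" using that by (auto simp: II)
      then show ?thesis using k(4) l(4) by simp
    qed
  qed
  moreover have "m (0, t) = (g +++ h) t" "m (1, t) = (g' +++ h') t" for t
    by (simp_all add: m_def joinpaths_def k l)
  moreover have "m (s, 0) = x \<and> m (s, 1) = x" if "s \<in> ?I" for s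
    using k(4)[OF that] l(4)[OF that] by (simp add: m_def)
  ultimately have "homotopic_with (\<lambda>k. k 0 = x \<and> k 1 = x) (top_of_set ?I) X (g +++ h) (g' +++ h')"
    unfolding homotopic_with_def by auto
  then show ?thesis using g h by (auto simp: loop_homotopy_def loops_join)
qed

text \<open>Concatenation respects homotopy, so the union over all representatives is a single
  class.\<close>

lemma pi1_mult:
  assumes g: "g \<in> loops X x" and h: "h \<in> loops X x"
  shows "loop_class X x g \<otimes>\<^bsub>pi1 X x\<^esub> loop_class X x h = loop_class X x (g +++ h)"
proof -
  have "loop_class X x (g' +++ h') = loop_class X x (g +++ h)"
    if "g' \<in> loop_class X x g" "h' \<in> loop_class X x h" for g' h'
  proof -
    have *: "(g, g') \<in> loop_homotopy X x" "(h, h') \<in> loop_homotopy X x" using that by (auto dest: loop_class_memD)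
    then have "g' \<in> loops X x" "h' \<in> loops X x" by (auto simp: loop_homotopy_def)
    then show ?thesis
      using loop_homotopy_join[OF *] loops_join loop_class_eq_iff g h by metis
  qed
  then show ?thesis
    unfolding pi1_def monoid.simps using loop_class_self[OF g] loop_class_self[OF h] by blast
qed

lemma pi1_mult_closed:
  assumes "c \<in> carrier (pi1 X x)" "d \<in> carrier (pi1 X x)"
  shows "c \<otimes>\<^bsub>pi1 X x\<^esub> d \<in> carrier (pi1 X x)"
proof -
  obtain g where g: "g \<in> loops X x" "c = loop_class X x g" by (rule pi1_carrierE[OF assms(1)])
  obtain h where h: "h \<in> loops X x" "d = loop_class X x h" by (rule pi1_carrierE[OF assms(2)])
  show ?thesis by (simp add: g h pi1_mult loop_class_carrier loops_join)
qed

lemma pi1_map_hom: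
  assumes f: "continuous_map X Y f" and y: "f x = y"
  shows "pi1_map Y y f \<in> hom (pi1 X x) (pi1 Y y)"
proof (rule homI)
  fix c assume "c \<in> carrier (pi1 X x)"
  then obtain g where g: "g \<in> loops X x" "c = loop_class X x g" by (rule pi1_carrierE)
  show "pi1_map Y y f c \<in> carrier (pi1 Y y)"
    using loops_compose[OF f g(1)] y by (simp add: g(2) pi1_map_loop_class[OF f g(1)] loop_class_carrier)
  fix d assume "d \<in> carrier (pi1 X x)"
  then obtain h where h: "h \<in> loops X x" "d = loop_class X x h" by (rule pi1_carrierE)
  have "f \<circ> (g +++ h) = (f \<circ> g) +++ (f \<circ> h)" by (rule path_compose_join)
  then show "pi1_map Y y f (c \<otimes>\<^bsub>pi1 X x\<^esub> d) = pi1_map Y y f c \<otimes>\<^bsub>pi1 Y y\<^esub> pi1_map Y y f d"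
    using loops_compose[OF f g(1)] loops_compose[OF f h(1)] y g h
    by (simp add: pi1_mult pi1_map_loop_class[OF f _ y] loops_join)
qed

section \<open>The stages of the inductive limit\<close>

lemma U_mat_stable: "U_mat n \<subseteq> stable n"
  by (auto simp: U_mat_def stable_def)

lemma U_mat_mono: "m \<le> n \<Longrightarrow> U_mat m \<subseteq> U_mat n"
  by (auto simp: U_mat_def)

lemma U_mat_Int_stable: "m \<le> n \<Longrightarrow> U_mat m = U_mat n \<inter> stable m"
  by (auto simp: U_mat_def stable_def)

lemma continuous_on_entry: "continuous_on S (\<lambda>u :: 'a::topological_space nmat. u i j)"
  by (rule continuous_on_product_then_coordinatewise
      [OF continuous_on_subset[OF continuous_on_product_coordinates subset_UNIV]])

lemma closed_stable: "closed (stable n :: 'a::cstar_algebra nmat set)"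
proof -
  have "stable n = (\<Inter>(i, j) \<in> {(i, j). i \<ge> n \<or> j \<ge> n}. {u :: 'a nmat. u i j = mone i j})"
    by (auto simp: stable_def)
  moreover have "closed {u :: 'a nmat. u i j = mone i j}" for i j
    by (rule closed_Collect_eq[OF continuous_on_entry continuous_on_const])
  ultimately show ?thesis by (simp only:) (auto intro!: closed_INT)
qed

lemma topspace_U_inf_top [simp]: "topspace U_inf_top = U_inf"
proof -
  have "openin U_inf_top (U_inf :: 'a::cstar_algebra nmat set)"
  proof -
    have "U_inf \<inter> U_mat n = (U_mat n :: 'a nmat set)" for n by (auto simp: U_inf_def)
    then show ?thesis by (simp add: openin_U_inf_top)
  qed
  then show ?thesis
    unfolding topspace_def by (auto simp: openin_U_inf_top)
qed

text \<open>Each stage is cut out of every larger one by equations between entries and is therefore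
  closed in it, so a set closed in one stage is closed in all larger ones.\<close>

lemma closedin_U_mat_imp_U_inf:
  assumes C: "closedin (top_of_set (U_mat n)) (C :: 'a::cstar_algebra nmat set)"
  shows "closedin U_inf_top C"
proof -
  have sub: "C \<subseteq> U_mat n" using closedin_subset[OF C] by simp
  have "openin (top_of_set (U_mat m)) ((U_inf - C) \<inter> U_mat m)" for m
  proof -
    define N where "N = max m n"
    have mn: "U_mat m \<subseteq> (U_mat N :: 'a nmat set)" "U_mat n = (U_mat N \<inter> stable n :: 'a nmat set)"
      unfolding N_def by (rule U_mat_mono U_mat_Int_stable; simp)+
    have "closedin (top_of_set (U_mat N)) (U_mat n :: 'a nmat set)"
      unfolding mn(2) by (rule closedin_closed_Int[OF closed_stable])
    then have "closedin (top_of_set (U_mat N)) C" using C closedin_trans by blast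
    then obtain D where D: "closed D" "C = U_mat N \<inter> D" by (auto simp: closedin_closed)
    have "(U_inf - C) \<inter> U_mat m = U_mat m \<inter> - D" using mn(1) by (auto simp: U_inf_def D(2))
    then show ?thesis using D(1) by (simp add: openin_open_Int open_Compl)
  qed
  then have "openin U_inf_top (U_inf - C)" unfolding openin_U_inf_top by blast
  then show ?thesis unfolding closedin_def using sub by (auto simp: U_inf_def)
qed

lemma continuous_map_U_mat_imp_U_inf:
  fixes f :: "'b \<Rightarrow> 'a::cstar_algebra nmat"
  assumes f: "continuous_map X (top_of_set (U_mat n)) f"
  shows "continuous_map X U_inf_top f"
  unfolding continuous_map_def
proof (intro conjI allI impI)
  have fU: "f x \<in> U_mat n" if "x \<in> topspace X" for x
    using f that by (auto simp: continuous_map_def)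
  then show "f \<in> topspace X \<rightarrow> topspace U_inf_top" by (auto simp: U_inf_def)
  fix W :: "'a nmat set" assume "openin U_inf_top W"
  then have "openin (top_of_set (U_mat n)) (W \<inter> U_mat n)" by (simp add: openin_U_inf_top)
  then have "openin X {x \<in> topspace X. f x \<in> W \<inter> U_mat n}" using f by (auto simp: continuous_map_def)
  moreover have "{x \<in> topspace X. f x \<in> W \<inter> U_mat n} = {x \<in> topspace X. f x \<in> W}" using fU by auto
  ultimately show "openin X {x \<in> topspace X. f x \<in> W}" by simp
qed

text \<open>If the image lay in no stage, it would contain points y(n) outside
  \<open>U_mat n\<close>. Each stage contains only finitely many of them, so every tail is closed,
  and the complements of the tails are an open cover of which finitely many members always miss some
  y(m). Once the image lies in one stage, closed subsets of that stage are closed in the limit,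
  which gives continuity into the stage.\<close>

lemma compact_continuous_map_U_inf:
  fixes f :: "'b \<Rightarrow> 'a::cstar_algebra nmat"
  assumes X: "compact_space X" and f: "continuous_map X U_inf_top f"
  obtains n where "continuous_map X (top_of_set (U_mat n)) f"
proof -
  have fU: "f x \<in> U_inf" if "x \<in> topspace X" for x
    using f that by (auto simp: continuous_map_def)
  have cpt: "compactin U_inf_top (f ` topspace X)"
    using X f by (simp add: compact_space_def image_compactin)
  have "\<exists>n. f ` topspace X \<subseteq> U_mat n"
  proof (rule ccontr)
    assume "\<not> ?thesis"
    then have "\<exists>y. y \<in> f ` topspace X \<and> y \<notin> U_mat n" for n by blast
    then obtain y where y: "\<And>n. y n \<in> f ` topspace X" "\<And>n. y n \<notin> U_mat n" by metis
    define W where "W m = U_inf - y ` {m..}" for m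
    have op: "openin U_inf_top (W m)" for m
      unfolding openin_U_inf_top
    proof (intro conjI allI)
      show "W m \<subseteq> U_inf" by (auto simp: W_def)
      fix k
      have fin: "finite (y ` {m..} \<inter> U_mat k)"
      proof (rule finite_subset)
        show "y ` {m..} \<inter> U_mat k \<subseteq> y ` {..k}"
        proof
          fix z assume "z \<in> y ` {m..} \<inter> U_mat k"
          then obtain i where i: "z = y i" "y i \<in> U_mat k" by auto
          then have "i \<le> k" using y(2)[of i] U_mat_mono[of k i] by (meson nat_le_linear subsetD)
          then show "z \<in> y ` {..k}" using i by auto
        qed
      qed simp
      have "W m \<inter> U_mat k = U_mat k \<inter> - (y ` {m..} \<inter> U_mat k)" by (auto simp: W_def U_inf_def)
      then show "openin (top_of_set (U_mat k)) (W m \<inter> U_mat k)"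
        using finite_imp_closed[OF fin] by (simp only:) (intro openin_open_Int open_Compl)
    qed
    have cov: "f ` topspace X \<subseteq> \<Union> (range W)"
    proof
      fix z assume "z \<in> f ` topspace X"
      then have "z \<in> U_inf" using fU by auto
      then obtain k where k: "z \<in> U_mat k" by (auto simp: U_inf_def)
      have "z \<notin> y ` {k..}" 
      proof
        assume "z \<in> y ` {k..}"
        then obtain i where "z = y i" "k \<le> i" by auto
        then show False using y(2)[of i] k U_mat_mono[of k i] by blast
      qed
      then show "z \<in> \<Union> (range W)" using \<open>z \<in> U_inf\<close> by (auto simp: W_def)
    qed
    have "\<exists>F. finite F \<and> F \<subseteq> range W \<and> f ` topspace X \<subseteq> \<Union> F"
      by (rule compactinD[OF cpt _ cov]) (use op in blast)
    then obtain F where F: "finite F" "F \<subseteq> range W" "f ` topspace X \<subseteq> \<Union> F" by blast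
    obtain M where M: "finite M" "F = W ` M" using finite_subset_image[OF F(1,2)] by blast
    obtain m where m: "\<And>i. i \<in> M \<Longrightarrow> i \<le> m" using finite_nat_set_iff_bounded_le M(1) by auto
    have "y m \<in> \<Union> F" using F(3) y(1)[of m] by (rule subsetD)
    then obtain i where "i \<in> M" "y m \<in> W i" unfolding M(2) by auto
    moreover have "y m \<in> y ` {i..}" using m[OF \<open>i \<in> M\<close>] by (intro imageI) simp
    ultimately show False by (simp add: W_def)
  qed
  then obtain n where n: "f ` topspace X \<subseteq> U_mat n" by blast
  have "continuous_map X (top_of_set (U_mat n)) f"
    unfolding continuous_map_closedin
  proof (intro conjI allI impI ballI)
    show "f \<in> topspace X \<rightarrow> topspace (top_of_set (U_mat n))" using n by auto
    fix C :: "'a nmat set" assume "closedin (top_of_set (U_mat n)) C"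
    then have "closedin U_inf_top C" by (rule closedin_U_mat_imp_U_inf)
    then show "closedin X {x \<in> topspace X. f x \<in> C}" using f by (auto simp: continuous_map_closedin)
  qed
  then show ?thesis using that by blast
qed

section \<open>The determinant of a loop\<close>

lemma scaleC_diff_left: "scaleC (c - d) x = scaleC c x - scaleC d (x :: 'a::cstar_algebra)"
  using scaleC_add_left[of "c - d" d x] by (simp add: algebra_simps)

lemma to_umat_inj_on: "inj_on to_umat (stable n)"
proof (rule inj_onI)
  fix u v :: "'a nmat" assume uv: "u \<in> stable n" "v \<in> stable n" "to_umat u = to_umat v"
  have "(\<Sum>i<n. \<Sum>j<n. norm (u i j - v i j)) = 0"
    using dist_to_umat[OF uv(1,2)] uv(3) by simp
  then have "u i j = v i j" if "i < n" "j < n" for i j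
    using that by (simp add: sum_nonneg_eq_0_iff sum_nonneg)
  moreover have "u i j = v i j" if "\<not> (i < n \<and> j < n)" for i j
    using uv(1,2) that by (auto simp: stable_def not_less)
  ultimately show "u = v" by blast
qed

lemma mstar_stable: "u \<in> stable n \<Longrightarrow> mstar u \<in> stable n"
  by (auto simp: stable_def mstar_def mone_def)

lemma mone_stable: "mone \<in> stable n"
  by (simp add: stable_def)

lemma U_mat_iff: "u \<in> U_mat n \<longleftrightarrow> u \<in> stable n \<and> to_umat (mstar u) * to_umat u = 1 \<and> to_umat u * to_umat (mstar u) = 1"
proof -
  have "mmult v w = mone \<longleftrightarrow> to_umat v * to_umat w = 1" if vw: "v \<in> stable n" "w \<in> stable n" for v w :: "'a nmat"
  proof -
    have "mmult v w \<in> stable n"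
    proof -
      have "mmult (\<lambda>i j. v i j - mone i j) (\<lambda>i j. w i j - mone i j) \<in> corner n n"
        by (rule mmult_corner[OF stable_corner[OF vw(1)] stable_corner[OF vw(2)]])
      then show ?thesis using vw unfolding mmult_stable[OF vw] by (auto simp: stable_def corner_def)
    qed
    then show ?thesis
      using inj_on_eq_iff[OF to_umat_inj_on _ mone_stable, of "mmult v w" n] to_umat_mmult[OF vw] by simp
  qed
  then show ?thesis
    unfolding U_mat_def mem_Collect_eq stable_def[symmetric]
    using mstar_stable[of u n] by (auto simp: stable_def)
qed

lemma continuous_on_mstar: "continuous_on S (mstar :: 'a::cstar_algebra nmat \<Rightarrow> 'a nmat)"
  unfolding mstar_def
  by (intro continuous_on_coordinatewise_then_product
      bounded_linear.continuous_on[OF bounded_linear_star] continuous_on_entry)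

lemma U_embed_U_mat: "u \<in> unitaries \<Longrightarrow> U_embed u \<in> U_mat 1"
proof -
  assume u: "u \<in> unitaries"
  have "mmult (U_embed v) (U_embed w) = U_embed (v * w)" for v w :: 'a
  proof (intro ext)
    fix i j
    have "mmult (U_embed v) (U_embed w) i j = (\<Sum>k<Suc i. U_embed v i k * U_embed w k j)"
      by (rule mmult_eq_sum) (auto simp: U_embed_def mone_def)
    also have "\<dots> = (\<Sum>k<Suc i. if k = i then U_embed (v * w) i j else 0)"
      by (rule sum.cong) (auto simp: U_embed_def mone_def)
    finally show "mmult (U_embed v) (U_embed w) i j = U_embed (v * w) i j" by simp
  qed
  moreover have "mstar (U_embed u) = U_embed (star u)" by (auto simp: U_embed_def mstar_def mone_def fun_eq_iff)
  moreover have "U_embed 1 = mone" by (auto simp: U_embed_def mone_def fun_eq_iff)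
  ultimately show ?thesis using u by (auto simp: U_mat_def unitaries_def) (auto simp: U_embed_def)
qed

lemma mstar_U_embed: "mstar (U_embed u) = U_embed (star u)"
  by (auto simp: U_embed_def mstar_def mone_def fun_eq_iff)

lemma U_embed_one: "U_embed 1 = mone"
  by (auto simp: U_embed_def mone_def fun_eq_iff)

lemma U_embed_stable: "U_embed u \<in> stable 1"
  by (auto simp: U_embed_def stable_def)

lemma continuous_map_U_embed: "continuous_map unitary_top U_inf_top (U_embed :: 'a::cstar_algebra \<Rightarrow> 'a nmat)"
proof (rule continuous_map_U_mat_imp_U_inf)
  have "continuous_on unitaries (U_embed :: 'a \<Rightarrow> 'a nmat)"
    unfolding U_embed_def
  proof (intro continuous_on_coordinatewise_then_product)
    fix i j
    show "continuous_on unitaries (\<lambda>x :: 'a. if i = 0 \<and> j = 0 then x else mone i j)"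
      by (cases "i = 0 \<and> j = 0") (auto simp: continuous_on_const continuous_on_id)
  qed
  then show "continuous_map unitary_top (top_of_set (U_mat 1)) (U_embed :: 'a \<Rightarrow> 'a nmat)"
    using U_embed_U_mat by (auto simp: continuous_map_in_subtopology)
qed

text \<open>The upper left corner is a non-unital copy of the algebra with scalar part 0, and the
  embedding of x differs from 1 by the corner element of 1 - x. The series contains positive powers
  only, so both sides agree term by term.\<close>

lemma log_trace_U_embed:
  fixes \<tau> :: "'a::cstar_algebra \<Rightarrow> complex"
  assumes \<tau>: "bounded_trace \<tau>"
  shows "log_trace (umat_trace \<tau>) (to_umat (U_embed v) * to_umat (U_embed w)) = log_trace \<tau> (v * w)"
proof -
  define e :: "'a \<Rightarrow> 'a nmat" where "e x = (\<lambda>i j. if i = 0 \<and> j = 0 then x else 0)" for x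
  have ec: "e x \<in> corner 1 1" for x by (auto simp: e_def corner_def)
  then have fs: "finite_support (e x :: 'a nmat)" for x unfolding finite_support_def by blast
  have ee: "mmult (e x) (e y) = (e (x * y) :: 'a nmat)" for x y
    using mmult_corner_eq[of "e x" 1 1 "e y" 1] ec[of x] by (intro ext) (auto simp: e_def)
  have mult: "umat 0 (e x) * umat 0 (e y) = umat 0 (e (x * y))" for x y
    by (simp add: umat_simps fs ee)
  have pow: "umat 0 (e x) ^ Suc n = umat 0 (e (x ^ Suc n))" for x n
    by (induction n) (simp_all add: mult)
  have one: "1 - to_umat (U_embed x) = umat 0 (e (1 - x))" for x
  proof -
    have "(\<lambda>i j. - (U_embed x i j - mone i j)) = e (1 - x)"
      by (auto simp: U_embed_def mone_def e_def fun_eq_iff)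
    moreover have "finite_support (\<lambda>i j. U_embed x i j - mone i j)"
      by (rule stable_finite_support[OF U_embed_stable])
    ultimately show ?thesis
      by (simp add: to_umat_def umat_simps finite_support_zero flip: umat_one)
  qed
  have emb: "to_umat (U_embed x) = 1 - umat 0 (e (1 - x))" for x by (simp flip: one)
  have "to_umat (U_embed v) * to_umat (U_embed w) = 1 - umat 0 (e (1 - v)) - umat 0 (e (1 - w)) + umat 0 (e (1 - v)) * umat 0 (e (1 - w))"
    unfolding emb by (simp add: left_diff_distrib right_diff_distrib)
  also have "\<dots> = 1 - (umat 0 (e (1 - v)) + umat 0 (e (1 - w)) - umat 0 (e ((1 - v) * (1 - w))))"
    by (simp add: mult)
  also have "umat 0 (e (1 - v)) + umat 0 (e (1 - w)) - umat 0 (e ((1 - v) * (1 - w))) = umat 0 (e (1 - v * w))"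
  proof -
    have "umat 0 (e x) + umat 0 (e y) - umat 0 (e z) = umat 0 (e (x + y - z))" for x y z
      by (simp add: umat_simps finite_support_add fs) (rule arg_cong[of _ _ "umat 0"], auto simp: e_def fun_eq_iff)
    moreover have "1 - v + (1 - w) - (1 - v) * (1 - w) = 1 - v * w" by (simp add: algebra_simps)
    ultimately show ?thesis by metis
  qed
  finally have vw: "1 - to_umat (U_embed v) * to_umat (U_embed w) = umat 0 (e (1 - v * w))" by simp
  have tr: "umat_trace \<tau> (umat 0 (e x)) = \<tau> x" for x
    using umat_trace_umat[OF \<tau> ec[of x]] by (simp add: e_def)
  show ?thesis unfolding log_trace_def vw pow tr ..
qed

section \<open>The loop of a projection\<close>

text \<open>For a projection p this is a (non-unital) homomorphism from the complex numbers, which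
  reduces calculations with the loop of p to complex ones.\<close>

definition proj_line :: "'a::cstar_algebra nmat \<Rightarrow> complex \<Rightarrow> 'a umat" where
  "proj_line p c = umat 0 (\<lambda>i j. scaleC c (p i j))"

context
  fixes n and p :: "'a::cstar_algebra nmat"
  assumes p: "p \<in> projections n"
begin

lemma proj_line_corner: "(\<lambda>i j. scaleC c (p i j)) \<in> corner n n"
  using p by (auto simp: projections_def corner_def)

lemma proj_line_fs: "finite_support (\<lambda>i j. scaleC c (p i j))"
  using proj_line_corner finite_support_def by blast

lemma proj_line_mult: "proj_line p c * proj_line p d = proj_line p (c * d)"
proof -
  have pc: "p \<in> corner n n" "mmult p p = p" using p by (auto simp: projections_def)
  have "mmult (\<lambda>i j. scaleC c (p i j)) (\<lambda>i j. scaleC d (p i j)) = (\<lambda>i j. scaleC (c * d) (p i j))"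
  proof (intro ext)
    fix i j
    have "mmult (\<lambda>i j. scaleC c (p i j)) (\<lambda>i j. scaleC d (p i j)) i j = (\<Sum>k<n. scaleC c (p i k) * scaleC d (p k j))"
      using proj_line_corner by (intro mmult_corner_eq[of _ n _ _ n]) blast
    also have "\<dots> = scaleC (c * d) (\<Sum>k<n. p i k * p k j)"
      by (simp add: scaleC_mult_left scaleC_mult_right scaleC_scaleC mult.commute[of d c]
          linear_sum[OF bounded_linear.linear[OF bounded_linear_scaleC]])
    also have "(\<Sum>k<n. p i k * p k j) = p i j"
      using mmult_corner_eq[of p n n p n i j] pc by simp
    finally show "mmult (\<lambda>i j. scaleC c (p i j)) (\<lambda>i j. scaleC d (p i j)) i j = scaleC (c * d) (p i j)" .
  qed
  then show ?thesis by (simp add: proj_line_def umat_simps proj_line_fs)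
qed

lemma bounded_linear_proj_line: "bounded_linear (proj_line p)"
proof (rule bounded_linear_intro)
  show "proj_line p (c + d) = proj_line p c + proj_line p d" for c d
    by (simp add: proj_line_def umat_simps proj_line_fs scaleC_add_left)
  show "proj_line p (r *\<^sub>R c) = r *\<^sub>R proj_line p c" for r c
    by (simp add: proj_line_def scaleR_umat proj_line_fs scaleR_conv_of_real[where 'a = complex] mult.commute[of _ c] scaleC_of_real_mult)
  show "norm (proj_line p c) \<le> norm c * (\<Sum>i<n. \<Sum>j<n. norm (p i j))" for c
    by (simp add: proj_line_def norm_umat proj_line_fs entry_norm_eq[OF proj_line_corner] norm_scaleC sum_distrib_left)
qed

lemma projection_loop_stable: "projection_loop p t \<in> stable n"
  using p by (auto simp: projection_loop_def stable_def projections_def corner_def)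

lemma to_umat_projection_loop: "to_umat (projection_loop p t) = 1 + proj_line p (cis (2 * pi * t) - 1)"
proof -
  have "(\<lambda>i j. projection_loop p t i j - mone i j) = (\<lambda>i j. scaleC (cis (2 * pi * t) - 1) (p i j))"
    by (auto simp: projection_loop_def fun_eq_iff scaleC_diff_left)
  then show ?thesis
    by (simp add: to_umat_def proj_line_def umat_simps finite_support_zero proj_line_fs flip: umat_one)
qed

text \<open>Since the loop is a one-parameter group, all increments over a regular partition are
  equal and the determinant is N times a single term.\<close>

lemma to_umat_projection_loop_mult:
  "to_umat (projection_loop p s) * to_umat (projection_loop p t) = to_umat (projection_loop p (s + t))"
proof -
  note add = linear_add[OF bounded_linear.linear[OF bounded_linear_proj_line], symmetric]
  have "to_umat (projection_loop p s) * to_umat (projection_loop p t) =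
      1 + (proj_line p (cis (2 * pi * s) - 1) + (proj_line p (cis (2 * pi * t) - 1)
        + proj_line p ((cis (2 * pi * s) - 1) * (cis (2 * pi * t) - 1))))"
    unfolding to_umat_projection_loop by (simp add: distrib_left distrib_right proj_line_mult add.assoc add.left_commute)
  also have "\<dots> = 1 + proj_line p (cis (2 * pi * s) * cis (2 * pi * t) - 1)"
    unfolding add by (simp add: algebra_simps)
  finally show ?thesis
    unfolding to_umat_projection_loop by (simp add: cis_mult distrib_left)
qed

lemma mstar_projection_loop: "mstar (projection_loop p t) = projection_loop p (- t)"
proof (intro ext)
  fix i j
  have "star (p j i) = p i j" using p unfolding projections_def mem_Collect_eq by (metis mstar_def)
  then show "mstar (projection_loop p t) i j = projection_loop p (- t) i j"
    by (auto simp: mstar_def projection_loop_def star_add star_diff star_scaleC mone_def cis_cnj)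
qed

lemma projection_loop_zero: "projection_loop p 0 = mone"
  by (auto simp: projection_loop_def fun_eq_iff)

lemma projection_loop_one: "projection_loop p 1 = mone"
  by (auto simp: projection_loop_def fun_eq_iff)

lemma projection_loop_U_mat: "projection_loop p t \<in> U_mat n"
  unfolding U_mat_iff mstar_projection_loop to_umat_projection_loop_mult
  by (simp add: projection_loop_stable projection_loop_zero)

lemma projection_loop_loops: "projection_loop p \<in> loops U_inf_top mone"
proof -
  have "continuous_on {0..1} (projection_loop p)"
    unfolding projection_loop_def
  proof (intro continuous_on_coordinatewise_then_product continuous_intros)
    fix i j
    have "bounded_linear (\<lambda>c. scaleC c (p i j))"
      by (rule bounded_linear_intro[of _ "norm (p i j)"])
        (simp_all add: scaleC_add_left norm_scaleC scaleR_conv_of_real[where 'a = complex] mult.commute[of "of_real _"] scaleC_of_real_mult)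
    then show "continuous_on {0..1} (\<lambda>t. scaleC (cis (2 * pi * t)) (p i j))"
      by (rule bounded_linear.continuous_on) (intro continuous_intros)
  qed
  then have "continuous_map (top_of_set {0..1}) (top_of_set (U_mat n)) (projection_loop p)"
    using projection_loop_U_mat by (auto simp: continuous_map_in_subtopology)
  then have "continuous_map (top_of_set {0..1}) U_inf_top (projection_loop p)"
    by (rule continuous_map_U_mat_imp_U_inf)
  then show ?thesis by (simp add: loops_def pathin_def projection_loop_zero projection_loop_one)
qed

text \<open>The differential equation that \<open>log_trace_curve\<close> asks for, with x = i
  \<alpha> p; \<alpha> will be the angle 2 pi / N of one increment.\<close>

lemma proj_line_derivative:
  "((\<lambda>t. 1 + proj_line p (cis (\<alpha> * t) - 1)) has_vector_derivative
     (1 + proj_line p (cis (\<alpha> * t) - 1)) * proj_line p (\<i> * of_real \<alpha>)) (at t)"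
proof -
  note pl = bounded_linear_proj_line
  have "((\<lambda>t. cis (\<alpha> * t) - 1) has_vector_derivative (\<i> * of_real \<alpha> * cis (\<alpha> * t))) (at t)"
    unfolding cis_conv_exp
    by (auto intro!: derivative_eq_intros has_vector_derivative_real_field simp: algebra_simps)
  then have "((\<lambda>t. 1 + proj_line p (cis (\<alpha> * t) - 1)) has_vector_derivative (0 + proj_line p (\<i> * of_real \<alpha> * cis (\<alpha> * t)))) (at t)"
    by (intro has_vector_derivative_add bounded_linear.has_vector_derivative[OF pl]) (auto intro: derivative_eq_intros)
  moreover have "(1 + proj_line p (cis (\<alpha> * t) - 1)) * proj_line p (\<i> * of_real \<alpha>) = proj_line p (\<i> * of_real \<alpha> * cis (\<alpha> * t))"
    by (simp add: distrib_right proj_line_mult left_diff_distrib linear_diff[OF bounded_linear.linear[OF pl]] mult.commute)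
  ultimately show ?thesis by simp
qed

text \<open>For N large, depending on the norm of p, the whole arc from 1 to the increment stays
  within 1/2 of 1, so the logarithm can be followed along it.\<close>

lemma log_trace_projection_loop:
  assumes \<tau>: "\<tau> \<in> tracial_states"
  shows "eventually (\<lambda>N. log_trace (umat_trace \<tau>) (to_umat (projection_loop p (1 / real N)))
     = 2 * pi * \<i> / of_nat N * matrix_trace \<tau> (n, p)) sequentially"
proof -
  interpret T: bounded_trace "umat_trace \<tau>"
    by (rule bounded_trace_umat_trace[OF bounded_trace_tracial_state[OF \<tau>]])
  have "isCont (\<lambda>s. cis (2 * pi * s)) 0"
    unfolding cis_conv_exp by (intro continuous_intros)
  then have "isCont (\<lambda>s. norm (proj_line p (cis (2 * pi * s) - 1))) 0"
    by (intro continuous_intros bounded_linear.isCont[OF bounded_linear_proj_line])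
  then have "((\<lambda>s. norm (proj_line p (cis (2 * pi * s) - 1))) \<longlongrightarrow> 0) (at 0)"
    by (simp add: isCont_def linear_0[OF bounded_linear.linear[OF bounded_linear_proj_line]])
  then have "eventually (\<lambda>s. norm (proj_line p (cis (2 * pi * s) - 1)) < 1/2) (at 0)"
    by (rule order_tendstoD) simp
  then obtain d where d: "d > 0" "\<And>s. s \<noteq> 0 \<Longrightarrow> dist s 0 < d \<Longrightarrow> norm (proj_line p (cis (2 * pi * s) - 1)) < 1/2"
    unfolding eventually_at by blast
  obtain N0 :: nat where N0: "N0 > 1 / d" using reals_Archimedean2 by blast
  show ?thesis
  proof (rule eventually_sequentiallyI[of "Suc N0"])
    fix N assume N: "N \<ge> Suc N0"
    then have "1 / d < N" using N0 by linarith
    then have Nd: "1 / N < d" "N > 0" using d(1) N by (auto simp: field_simps)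
    let ?x = "proj_line p (\<i> * of_real (2 * pi / N))"
    have "log_trace (umat_trace \<tau>) (1 + proj_line p (cis (2 * pi / N * 1) - 1)) = umat_trace \<tau> ?x"
    proof (rule T.log_trace_curve)
      fix t :: real assume t: "t \<in> {0..1}"
      show "((\<lambda>t. 1 + proj_line p (cis (2 * pi / N * t) - 1)) has_vector_derivative
          (1 + proj_line p (cis (2 * pi / N * t) - 1)) * ?x) (at t)"
        by (rule proj_line_derivative)
      show "norm (1 - (1 + proj_line p (cis (2 * pi / N * t) - 1))) \<le> 1/2"
      proof (cases "t = 0")
        case False
        have "dist (t / N) 0 \<le> 1 / N" using t by (simp add: divide_right_mono)
        then have "norm (proj_line p (cis (2 * pi * (t / N)) - 1)) < 1/2"
          using Nd False by (intro d(2)) auto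
        then show ?thesis by simp
      qed (simp add: linear_0[OF bounded_linear.linear[OF bounded_linear_proj_line]])
    qed (simp_all add: linear_0[OF bounded_linear.linear[OF bounded_linear_proj_line]])
    also have "umat_trace \<tau> ?x = (\<Sum>i<n. \<tau> (scaleC (\<i> * of_real (2 * pi / N)) (p i i)))"
      unfolding proj_line_def by (rule umat_trace_umat[OF bounded_trace_tracial_state[OF \<tau>] proj_line_corner])
    also have "\<dots> = \<i> * of_real (2 * pi / N) * matrix_trace \<tau> (n, p)"
      by (simp add: matrix_trace_def tracial_state_scaleC[OF \<tau>] sum_distrib_left)
    finally show "log_trace (umat_trace \<tau>) (to_umat (projection_loop p (1 / real N)))
        = 2 * pi * \<i> / of_nat N * matrix_trace \<tau> (n, p)"
      unfolding to_umat_projection_loop by (simp add: mult.commute)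
  qed
qed

lemma log_trace_sum_projection_loop:
  assumes \<tau>: "\<tau> \<in> tracial_states"
  shows "eventually (\<lambda>N. (\<Sum>j<N. log_trace (umat_trace \<tau>)
      (to_umat (mstar (projection_loop p (j / N))) * to_umat (projection_loop p (Suc j / N))))
     = 2 * pi * \<i> * matrix_trace \<tau> (n, p)) sequentially"
  using log_trace_projection_loop[OF \<tau>] eventually_gt_at_top[of 0]
proof eventually_elim
  case (elim N)
  have "- (real j / real N) + real (Suc j) / real N = 1 / real N" for j
    using elim by (simp add: field_simps)
  then show ?case
    using elim by (simp add: mstar_projection_loop to_umat_projection_loop_mult)
qed

end

section \<open>Homotopy invariance and comparison with the pairing\<close>

lemma prod_topology_unit_square: "prod_topology (top_of_set {0..1::real}) (top_of_set {0..1::real}) = top_of_set ({0..1} \<times> {0..1})"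
  by (simp add: subtopology_Times)

text \<open>The unit square is compact, so the homotopy runs in a single \<open>U_mat n\<close>,
  where entrywise continuity becomes norm continuity and the grid argument applies.\<close>

lemma loop_homotopy_log_trace_sum:
  fixes g g' :: "real \<Rightarrow> 'a::cstar_algebra nmat"
  assumes \<tau>: "\<tau> \<in> tracial_states" and gg': "(g, g') \<in> loop_homotopy U_inf_top mone"
  shows "eventually (\<lambda>N.
      (\<Sum>j<N. log_trace (umat_trace \<tau>) (to_umat (mstar (g (j / N))) * to_umat (g (Suc j / N)))) =
      (\<Sum>j<N. log_trace (umat_trace \<tau>) (to_umat (mstar (g' (j / N))) * to_umat (g' (Suc j / N))))) sequentially"
proof -
  interpret T: bounded_trace "umat_trace \<tau>"
    by (rule bounded_trace_umat_trace[OF bounded_trace_tracial_state[OF \<tau>]])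
  let ?II = "{0..1::real} \<times> {0..1::real}"
  obtain h where h: "continuous_map (top_of_set ?II) U_inf_top h" "\<And>t. h (0, t) = g t" "\<And>t. h (1, t) = g' t"
    "\<And>s. s \<in> {0..1} \<Longrightarrow> h (s, 0) = mone \<and> h (s, 1) = mone"
    using gg' unfolding loop_homotopy_def homotopic_with_def prod_topology_unit_square by auto
  have "compact_space (top_of_set ?II)"
    by (rule compact_space_subtopology) (auto intro!: compact_Times)
  then obtain n where "continuous_map (top_of_set ?II) (top_of_set (U_mat n)) h"
    using compact_continuous_map_U_inf h(1) by blast
  then have cont: "continuous_on ?II h" and hU: "\<And>z. z \<in> ?II \<Longrightarrow> h z \<in> U_mat n"
    by (auto simp: continuous_map_in_subtopology)
  have hs: "h ` ?II \<subseteq> stable n" using hU U_mat_stable by blast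
  have "eventually (\<lambda>N. (\<Sum>j<N. log_trace (umat_trace \<tau>) (to_umat (mstar (h (0, j / N))) * to_umat (h (0, Suc j / N)))) =
    (\<Sum>j<N. log_trace (umat_trace \<tau>) (to_umat (mstar (h (1, j / N))) * to_umat (h (1, Suc j / N))))) sequentially"
  proof (rule T.log_trace_sum_homotopy_invariant[where h = "\<lambda>z. to_umat (h z)" and k = "\<lambda>z. to_umat (mstar (h z))"])
    show "continuous_on ?II (\<lambda>z. to_umat (h z))"
      by (rule continuous_on_compose2[OF continuous_on_to_umat cont hs])
    show "continuous_on ?II (\<lambda>z. to_umat (mstar (h z)))"
    proof (rule continuous_on_compose2[OF continuous_on_to_umat])
      show "continuous_on ?II (\<lambda>z. mstar (h z))"
        by (rule continuous_on_compose2[OF continuous_on_mstar cont]) auto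
      show "(\<lambda>z. mstar (h z)) ` ?II \<subseteq> stable n" using hs mstar_stable by blast
    qed
    show "to_umat (h z) * to_umat (mstar (h z)) = 1" "to_umat (mstar (h z)) * to_umat (h z) = 1" if "z \<in> ?II" for z
      using hU[OF that] by (auto simp: U_mat_iff)
    show "to_umat (h (s, 0)) = 1" "to_umat (h (s, 1)) = 1" if "s \<in> {0..1}" for s
      using h(4)[OF that] by auto
  qed
  then show ?thesis by (simp add: h(2,3))
qed

text \<open>With an even number of steps the midpoint is a point of the partition, and no step
  straddles the two paths.\<close>

lemma sum_joinpaths:
  fixes f :: "'a::topological_space \<Rightarrow> 'a \<Rightarrow> 'b::comm_monoid_add"
  assumes "g 1 = h 0" "M > 0"
  shows "(\<Sum>j<2 * M. f ((g +++ h) (real j / real (2 * M))) ((g +++ h) (real (Suc j) / real (2 * M)))) =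
    (\<Sum>j<M. f (g (j / M)) (g (Suc j / M))) + (\<Sum>j<M. f (h (j / M)) (h (Suc j / M)))"
proof -
  have 1: "(g +++ h) (real j / real (2 * M)) = g (j / M)" if "j \<le> M" for j
  proof -
    have "real j / real (2 * M) \<le> 1/2" "2 * (real j / real (2 * M)) = real j / real M"
      using that assms(2) by (auto simp: field_simps)
    then show ?thesis by (simp add: joinpaths_def)
  qed
  have 2: "(g +++ h) (real (M + j) / real (2 * M)) = h (j / M)" for j
  \<comment> \<open>At the midpoint itself \<open>+++\<close> still follows g, whose end is the
    start of h.\<close>
  proof (cases "j = 0")
    case True
    then show ?thesis using 1[of M] assms by simp
  next
    case False
    then have "\<not> real (M + j) / real (2 * M) \<le> 1/2" "2 * (real (M + j) / real (2 * M)) - 1 = real j / real M"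
      using assms(2) by (auto simp: field_simps)
    then show ?thesis by (simp add: joinpaths_def)
  qed
  have "(\<Sum>j<M + M. f ((g +++ h) (real j / real (2 * M))) ((g +++ h) (real (Suc j) / real (2 * M)))) =
    (\<Sum>j<M. f (g (j / M)) (g (Suc j / M))) + (\<Sum>j<M. f (h (j / M)) (h (Suc j / M)))"
    unfolding sum_lessThan_add
  proof (intro arg_cong2[of _ _ _ _ "(+)"] sum.cong refl)
    fix j assume "j \<in> {..<M}"
    then show "f ((g +++ h) (real j / real (2 * M))) ((g +++ h) (real (Suc j) / real (2 * M))) = f (g (j / M)) (g (Suc j / M))"
      by (subst (1 2) 1) auto
    show "f ((g +++ h) (real (M + j) / real (2 * M))) ((g +++ h) (real (Suc (M + j)) / real (2 * M))) = f (h (j / M)) (h (Suc j / M))"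
      using 2[of j] 2[of "Suc j"] by simp
  qed
  then show ?thesis by (simp only: mult_2)
qed

lemma eventually_sequentially_double:
  assumes "eventually P sequentially"
  shows "eventually (\<lambda>M. P (2 * M)) sequentially"
proof -
  obtain N where "\<And>n. n \<ge> N \<Longrightarrow> P n" using assms unfolding eventually_sequentially by blast
  then show ?thesis by (intro eventually_sequentiallyI[of N]) simp
qed

text \<open>The sums are the determinant of de la Harpe and Skandalis, evaluated on fine partitions.\<close>

lemma canonical_pi1_pairing:
  fixes u :: "real \<Rightarrow> 'a::cstar_algebra"
  assumes \<tau>: "\<tau> \<in> tracial_states" and k: "is_canonical_pi1 k" and u: "u \<in> loops unitary_top 1"
  shows "eventually (\<lambda>M. (\<Sum>j<M. log_trace \<tau> (star (u (j / M)) * u (Suc j / M))) =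
    2 * pi * \<i> * of_real (rho (k (loop_class unitary_top 1 u)) \<tau>)) sequentially"
proof -
  let ?\<pi> = "pi1 U_inf_top (mone :: 'a nmat)"
  let ?L = "loop_class U_inf_top (mone :: 'a nmat)"
  obtain b where b: "b \<in> iso ?\<pi> K0"
    and b_proj: "\<And>n p. p \<in> projections n \<Longrightarrow> b (?L (projection_loop p)) = K0_class (n, p)"
    and kb: "\<And>c. c \<in> carrier pi1_U \<Longrightarrow> k c = b (pi1_map U_inf_top mone U_embed c)"
    using k unfolding is_canonical_pi1_def bott_identification_def by blast
  have b_hom: "b \<in> hom ?\<pi> K0" and b_inj: "inj_on b (carrier ?\<pi>)" using b by (auto simp: iso_def bij_betw_def)
  define g where "g = U_embed \<circ> u"
  have g: "g \<in> loops U_inf_top mone"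
    using loops_compose[OF continuous_map_U_embed u] by (simp add: g_def U_embed_one)
  define x where "x = k (loop_class unitary_top 1 u)"
  have xb: "x = b (?L g)"
    unfolding x_def kb[OF loop_class_carrier[OF u]] pi1_map_loop_class[OF continuous_map_U_embed u U_embed_one] g_def ..
  have "x \<in> carrier K0" unfolding xb by (rule hom_in_carrier[OF b_hom loop_class_carrier[OF g]])
  then obtain P Q where PQ: "P \<in> P_inf" "Q \<in> P_inf" "x = K0_diff P Q" by (rule K0_carrierE)
  obtain n p where P: "P = (n, p)" "p \<in> projections n" using PQ(1) by (auto simp: P_inf_def)
  obtain m q where Q: "Q = (m, q)" "q \<in> projections m" using PQ(2) by (auto simp: P_inf_def)
  note lp = projection_loop_loops[OF P(2)] and lq = projection_loop_loops[OF Q(2)]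
  \<comment> \<open>Moving [Q] to the other side avoids inverses, so the equation can be read as one
    between a concatenated loop and the loop of p.\<close>
  have "x \<otimes>\<^bsub>K0\<^esub> K0_class Q = K0_class P"
  proof -
    have "((dsum P Q, dsum Q zero_proj), (P, zero_proj)) \<in> K0_rel"
      unfolding K0_rel_iff using PQ
      by (intro conjI exI[of _ "[]"]) (auto simp: dsum_zero_right dsum_zero_left dsum_P_inf intro!: mvn_equiv_refl)
    then show ?thesis using PQ by (simp add: K0_class_def K0_mult K0_diff_eq_iff dsum_P_inf)
  qed
  then have "b (?L (g +++ projection_loop q)) = b (?L (projection_loop p))"
    using hom_mult[OF b_hom loop_class_carrier[OF g] loop_class_carrier[OF lq]] b_proj[OF P(2)] b_proj[OF Q(2)]
    by (simp add: xb P(1) Q(1) pi1_mult g lq)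
  \<comment> \<open>Injectivity of the Bott identification turns the equation in K_0 into a
    homotopy.\<close>
  then have "?L (g +++ projection_loop q) = ?L (projection_loop p)"
    using inj_onD[OF b_inj] loop_class_carrier loops_join[OF g lq] lp by metis
  then have hom: "(g +++ projection_loop q, projection_loop p) \<in> loop_homotopy U_inf_top mone"
    by (simp add: loop_class_eq_iff loops_join g lq lp)
  define F where "F v w = log_trace (umat_trace \<tau>) (to_umat (mstar v) * to_umat w)" for v w
  have F_embed: "F (g s) (g t) = log_trace \<tau> (star (u s) * u t)" for s t
    by (simp add: F_def g_def mstar_U_embed log_trace_U_embed[OF bounded_trace_tracial_state[OF \<tau>]])
  have end_points: "g 1 = projection_loop q 0"
    using g by (simp add: loops_def projection_loop_zero[OF Q(2)])
  \<comment> \<open>Only even partitions are used, so that the sum over the concatenation splits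
    into sums with M steps for g and for the loop of q.\<close>
  have "eventually (\<lambda>M. (\<Sum>j<2 * M. F ((g +++ projection_loop q) (real j / real (2 * M))) ((g +++ projection_loop q) (real (Suc j) / real (2 * M))))
     = (\<Sum>j<2 * M. F (projection_loop p (real j / real (2 * M))) (projection_loop p (real (Suc j) / real (2 * M))))) sequentially"
    using loop_homotopy_log_trace_sum[OF \<tau> hom] unfolding F_def
    by (rule eventually_sequentially_double)
  moreover have "eventually (\<lambda>M. (\<Sum>j<2 * M. F (projection_loop p (real j / real (2 * M))) (projection_loop p (real (Suc j) / real (2 * M))))
     = 2 * pi * \<i> * matrix_trace \<tau> P) sequentially"
    using log_trace_sum_projection_loop[OF P(2) \<tau>] unfolding F_def P(1)
    by (rule eventually_sequentially_double)
  moreover have "eventually (\<lambda>M. (\<Sum>j<M. F (projection_loop q (real j / real M)) (projection_loop q (real (Suc j) / real M)))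
     = 2 * pi * \<i> * matrix_trace \<tau> Q) sequentially"
    using log_trace_sum_projection_loop[OF Q(2) \<tau>] unfolding F_def Q(1) .
  ultimately have "eventually (\<lambda>M. (\<Sum>j<M. F (g (j / M)) (g (Suc j / M))) =
      2 * pi * \<i> * (matrix_trace \<tau> P - matrix_trace \<tau> Q)) sequentially"
    using eventually_gt_at_top[of 0]
  proof eventually_elim
    case (elim M)
    then show ?case
      unfolding sum_joinpaths[of g "projection_loop q" M F, OF end_points elim(4)] by (simp add: algebra_simps)
  qed
  then show ?thesis
    unfolding F_embed x_def[symmetric] PQ(3) rho_K0_diff[OF \<tau> PQ(1,2)] .
qed

section \<open>Generators of one-parameter unitary groups\<close>

lemma one_selfadjoint: "1 \<in> (selfadjoint :: 'c::cstar_algebra set)"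
  by (simp add: selfadjoint_def)

lemma exp_scalar: "exp (t *\<^sub>R scaleC \<i> 1) = scaleC (cis t) (1 :: 'c::cstar_algebra)"
proof -
  have pow: "scaleC z 1 ^ n = scaleC (z ^ n) (1 :: 'c)" for z n
    by (induction n) (simp_all add: scaleC_mult_left scaleC_scaleC)
  have bl: "bounded_linear (\<lambda>c. scaleC c (1 :: 'c))"
    by (rule bounded_linear_intro[of _ 1])
      (simp_all add: scaleC_add_left norm_scaleC scaleR_conv_of_real[where 'a = complex] mult.commute[of "of_real _"] scaleC_of_real_mult)
  have "(\<lambda>n. scaleC ((\<i> * of_real t) ^ n /\<^sub>R fact n) (1 :: 'c)) sums scaleC (exp (\<i> * of_real t)) 1"
    by (rule bounded_linear.sums[OF bl exp_converges])
  moreover have "scaleC ((\<i> * of_real t) ^ n /\<^sub>R fact n) (1 :: 'c) = (t *\<^sub>R scaleC \<i> 1) ^ n /\<^sub>R fact n" for n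
  proof -
    have "t *\<^sub>R scaleC \<i> (1 :: 'c) = scaleC (\<i> * of_real t) 1" by (simp add: scaleC_of_real_mult)
    then show ?thesis
      by (simp add: pow linear_scale[OF bounded_linear.linear[OF bl]])
  qed
  ultimately show ?thesis
    using sums_unique2[OF _ exp_converges[of "t *\<^sub>R scaleC \<i> (1 :: 'c)"]] by (simp add: cis_conv_exp)
qed

lemma scaleC_one_eq_iff: "scaleC z 1 = scaleC w (1 :: 'c::cstar_algebra) \<longleftrightarrow> z = w"
proof
  assume "scaleC z 1 = scaleC w (1 :: 'c)"
  then have "norm (scaleC (z - w) (1 :: 'c)) = 0" by (simp add: scaleC_diff_left)
  then show "z = w" by (simp add: norm_scaleC)
qed simp

lemma scaleC_one_eq_one_iff: "scaleC z 1 = (1 :: 'c::cstar_algebra) \<longleftrightarrow> z = 1"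
  using scaleC_one_eq_iff[of z 1, where 'c = 'c] by simp

lemma re_part_add: "re_part (x + y) = re_part x + re_part y"
  and im_part_add: "im_part (x + y) = im_part x + im_part y"
  by (simp_all add: re_part_def im_part_def star_add scaleR_right_distrib scaleC_add_right scaleC_diff algebra_simps)

lemma re_part_scaleR: "re_part (r *\<^sub>R x) = r *\<^sub>R re_part x"
  and im_part_scaleR: "im_part (r *\<^sub>R x) = r *\<^sub>R im_part x"
  by (simp_all add: re_part_def im_part_def star_scaleR scaleR_right_distrib scaleC_scaleR_commute scaleC_diff scaleR_right_diff_distrib mult.commute)

lemma re_part_i: "re_part (scaleC \<i> x) = - im_part x"
  and im_part_i: "im_part (scaleC \<i> x) = re_part x"
  by (simp_all add: re_part_def im_part_def star_scaleC scaleC_scaleC scaleC_minus_left scaleC_diff scaleC_add_right scaleC_neg scaleR_right_diff_distrib scaleR_right_distrib)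

lemma re_part_of_selfadjoint: "a \<in> selfadjoint \<Longrightarrow> re_part a = a"
  and im_part_of_selfadjoint: "a \<in> selfadjoint \<Longrightarrow> im_part a = 0"
  by (simp_all add: re_part_def im_part_def selfadjoint_def flip: scaleR_2)

lemma scaleC_i_inj: "scaleC \<i> x = scaleC \<i> y \<Longrightarrow> x = (y :: 'c::cstar_algebra)"
  by (metis scaleC_scaleC scaleC_one mult_minus_left i_squared minus_minus mult.commute)

section \<open>The map S on selfadjoint elements\<close>

locale contractive_unitary_hom =
  fixes \<theta> :: "'a::cstar_algebra \<Rightarrow> 'b::cstar_algebra"
  assumes maps: "u \<in> unitaries \<Longrightarrow> \<theta> u \<in> unitaries"
    and mult: "u \<in> unitaries \<Longrightarrow> v \<in> unitaries \<Longrightarrow> \<theta> (u * v) = \<theta> u * \<theta> v"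
    and contractive: "u \<in> unitaries \<Longrightarrow> v \<in> unitaries \<Longrightarrow> norm (\<theta> u - \<theta> v) \<le> norm (u - v)"
begin

lemma hom_one: "\<theta> 1 = 1"
proof -
  have u: "\<theta> 1 \<in> unitaries" by (rule maps[OF unitaries_one])
  have "\<theta> 1 * \<theta> 1 = \<theta> 1" using mult[OF unitaries_one unitaries_one] by simp
  then have "star (\<theta> 1) * \<theta> 1 * \<theta> 1 = star (\<theta> 1) * \<theta> 1" by (simp add: mult.assoc)
  then show ?thesis using u by (simp add: unitaries_def)
qed

lemma hom_star:
  assumes u: "u \<in> unitaries"
  shows "\<theta> (star u) = star (\<theta> u)"
proof -
  have "\<theta> u * \<theta> (star u) = 1"
    using mult[OF u unitaries_star[OF u]] u hom_one by (simp add: unitaries_def)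
  then have "star (\<theta> u) * \<theta> u * \<theta> (star u) = star (\<theta> u)" by (simp add: mult.assoc)
  then show ?thesis using maps[OF u] by (simp add: unitaries_def)
qed

lemma continuous_on_hom: "continuous_on unitaries \<theta>"
proof (rule continuous_onI)
  fix x :: 'a and e :: real assume "x \<in> unitaries" "e > 0"
  then show "\<exists>d>0. \<forall>x'\<in>unitaries. dist x' x < d \<longrightarrow> dist (\<theta> x') (\<theta> x) \<le> e"
    using contractive by (intro exI[of _ e]) (force simp: dist_norm)
qed

text \<open>Contractivity makes the image of t -> exp(ita) norm continuous, hence of the form
  exp(tX). As \<open>\<theta>\<close> commutes with \<open>star\<close>, both \<open>star X\<close>
  and \<open>- X\<close> generate the adjoint group, so X is skew by uniqueness.\<close>

lemma ex_generator:
  assumes a: "a \<in> selfadjoint"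
  shows "\<exists>b\<in>selfadjoint. \<forall>t. \<theta> (exp (t *\<^sub>R scaleC \<i> a)) = exp (t *\<^sub>R scaleC \<i> b)"
proof -
  define f where "f t = \<theta> (exp (t *\<^sub>R scaleC \<i> a))" for t :: real
  note eu = exp_selfadjoint_unitary[OF a]
  have "f (s + t) = f s * f t" for s t
    unfolding f_def mult[OF eu eu, symmetric] scaleR_left_distrib by (subst exp_add_commuting) simp_all
  moreover have "f 0 = 1" by (simp add: f_def hom_one)
  moreover have "continuous_on UNIV f"
    unfolding f_def
  proof (rule continuous_on_compose2[OF continuous_on_hom])
    show "continuous_on UNIV (\<lambda>t. exp (t *\<^sub>R scaleC \<i> a))"
      using has_vector_derivative_continuous[OF exp_scaleR_has_vector_derivative_right]
      by (intro continuous_at_imp_continuous_on) blast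
  qed (use eu in auto)
  ultimately obtain X where X: "\<And>t. f t = exp (t *\<^sub>R X)" by (rule one_parameter_group_is_exp) (rule that)
  have "exp (t *\<^sub>R star X) = exp (t *\<^sub>R (- X))" for t
  proof -
    have "exp (t *\<^sub>R star X) = star (f t)" by (simp add: X star_exp star_scaleR)
    also have "\<dots> = \<theta> (star (exp (t *\<^sub>R scaleC \<i> a)))" unfolding f_def hom_star[OF eu] ..
    also have "star (exp (t *\<^sub>R scaleC \<i> a)) = exp ((- t) *\<^sub>R scaleC \<i> a)"
      using skew_of_selfadjoint[OF a, of t] by (simp add: star_exp)
    also have "\<theta> \<dots> = f (- t)" by (simp add: f_def)
    finally show ?thesis by (simp add: X)
  qed
  then have sX: "star X = - X" by (rule exp_generator_unique)
  let ?b = "scaleC (- \<i>) X"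
  have "?b \<in> selfadjoint" by (simp add: selfadjoint_def star_scaleC star_neg sX scaleC_minus_left scaleC_neg)
  moreover have "scaleC \<i> ?b = X" by (simp add: scaleC_scaleC)
  ultimately show ?thesis using X by (intro bexI[of _ ?b]) (auto simp: f_def)
qed

definition generator :: "'a \<Rightarrow> 'b" where
  "generator a = (SOME b. b \<in> selfadjoint \<and> (\<forall>t. \<theta> (exp (t *\<^sub>R scaleC \<i> a)) = exp (t *\<^sub>R scaleC \<i> b)))"

lemma generator:
  assumes "a \<in> selfadjoint"
  shows "generator a \<in> selfadjoint" "\<theta> (exp (t *\<^sub>R scaleC \<i> a)) = exp (t *\<^sub>R scaleC \<i> (generator a))"
  using someI_ex[OF ex_generator[OF assms, unfolded Bex_def]] unfolding generator_def by blast+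

lemma generator_unique:
  assumes "a \<in> selfadjoint" "\<And>t. \<theta> (exp (t *\<^sub>R scaleC \<i> a)) = exp (t *\<^sub>R scaleC \<i> b)"
  shows "generator a = b"
proof (rule scaleC_i_inj, rule exp_generator_unique)
  show "exp (t *\<^sub>R scaleC \<i> (generator a)) = exp (t *\<^sub>R scaleC \<i> b)" for t
    using assms(2)[of t] generator(2)[OF assms(1), of t] by simp
qed

lemma generator_scaleR:
  assumes "a \<in> selfadjoint"
  shows "generator (r *\<^sub>R a) = r *\<^sub>R generator a"
proof (rule generator_unique[OF selfadjoint_scaleR[OF assms]])
  show "\<theta> (exp (t *\<^sub>R scaleC \<i> (r *\<^sub>R a))) = exp (t *\<^sub>R scaleC \<i> (r *\<^sub>R generator a))" for t
    using generator(2)[OF assms, of "t * r"] by (simp add: scaleC_scaleR_commute)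
qed

text \<open>The estimate for the distances to 1 of \<open>\<theta>\<close>(exp(ita)) and exp(ita),
  differentiated at t = 0.\<close>

lemma norm_generator_le:
  assumes a: "a \<in> selfadjoint"
  shows "norm (generator a) \<le> norm a"
proof -
  have d: "((\<lambda>t. exp (t *\<^sub>R X) - 1) has_vector_derivative X) (at 0)" for X :: "'c::cstar_algebra"
    using has_vector_derivative_diff[OF exp_scaleR_has_vector_derivative_right[of X 0] has_vector_derivative_const[of 1]] by simp
  have "norm (scaleC \<i> (generator a)) \<le> norm (scaleC \<i> a)"
  proof (rule norm_derivative_mono[OF d d])
    show "norm (exp (t *\<^sub>R scaleC \<i> (generator a)) - 1) \<le> norm (exp (t *\<^sub>R scaleC \<i> a) - 1)" for t
      using contractive[OF exp_selfadjoint_unitary[OF a] unitaries_one, of t]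
      by (simp add: generator(2)[OF a] hom_one)
  qed simp_all
  then show ?thesis by (simp add: norm_scaleC)
qed

text \<open>Contractivity turns \<open>exp(ita) exp(itb) - exp(it(a + b)) = o(t)\<close> into the same estimate for the generators.\<close>

lemma generator_add:
  assumes a: "a \<in> selfadjoint" and b: "b \<in> selfadjoint"
  shows "generator (a + b) = generator a + generator b"
proof -
  note ab = selfadjoint_add[OF a b]
  have d: "((\<lambda>t. exp (t *\<^sub>R X) * exp (t *\<^sub>R Y) - exp (t *\<^sub>R Z)) has_vector_derivative (X + Y - Z)) (at 0)" for X Y Z :: "'c::cstar_algebra"
    using has_vector_derivative_diff[OF has_vector_derivative_mult[OF exp_scaleR_has_vector_derivative_right[of X 0] exp_scaleR_has_vector_derivative_right[of Y 0]]
        exp_scaleR_has_vector_derivative_right[of Z 0]] by (simp add: add.commute)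
  have "norm (scaleC \<i> (generator a) + scaleC \<i> (generator b) - scaleC \<i> (generator (a + b)))
    \<le> norm (scaleC \<i> a + scaleC \<i> b - scaleC \<i> (a + b))"
  proof (rule norm_derivative_mono[OF d d])
    show "norm (exp (t *\<^sub>R scaleC \<i> (generator a)) * exp (t *\<^sub>R scaleC \<i> (generator b)) - exp (t *\<^sub>R scaleC \<i> (generator (a + b))))
      \<le> norm (exp (t *\<^sub>R scaleC \<i> a) * exp (t *\<^sub>R scaleC \<i> b) - exp (t *\<^sub>R scaleC \<i> (a + b)))" for t
    proof -
      note eu = exp_selfadjoint_unitary[OF a, of t] exp_selfadjoint_unitary[OF b, of t]
      show ?thesis
        using contractive[OF unitaries_mult[OF eu] exp_selfadjoint_unitary[OF ab, of t]]
        by (simp only: mult[OF eu] generator(2)[OF a] generator(2)[OF b] generator(2)[OF ab])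
    qed
  qed simp_all
  then have "scaleC \<i> (generator a + generator b) = scaleC \<i> (generator (a + b))"
    by (simp add: scaleC_add_right)
  then show ?thesis by (metis scaleC_i_inj)
qed

text \<open>S is only real linear; compatibility with conjugation by unitaries is the multiplicative
  information from which the trace property of \<open>pullback\<close> is obtained.\<close>

lemma generator_conjugate:
  assumes a: "a \<in> selfadjoint" and u: "u \<in> unitaries"
  shows "generator (u * a * star u) = \<theta> u * generator a * star (\<theta> u)"
proof (rule generator_unique)
  have conj: "t *\<^sub>R scaleC \<i> (v * x * w) = v * (t *\<^sub>R scaleC \<i> x) * w" for v x w :: "'c::cstar_algebra" and t
    by (simp add: scaleC_mult_left scaleC_mult_right)
  show "u * a * star u \<in> selfadjoint"
    using a by (simp add: selfadjoint_def star_mult star_star mult.assoc)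
  fix t
  note eu = exp_selfadjoint_unitary[OF a, of t]
  have "exp (t *\<^sub>R scaleC \<i> (u * a * star u)) = u * exp (t *\<^sub>R scaleC \<i> a) * star u"
    unfolding conj using u by (intro exp_conjugate) (auto simp: unitaries_def)
  then have "\<theta> (exp (t *\<^sub>R scaleC \<i> (u * a * star u))) = \<theta> u * exp (t *\<^sub>R scaleC \<i> (generator a)) * star (\<theta> u)"
    by (simp add: mult u eu unitaries_mult unitaries_star hom_star generator(2)[OF a])
  also have "\<dots> = exp (t *\<^sub>R scaleC \<i> (\<theta> u * generator a * star (\<theta> u)))"
    unfolding conj using maps[OF u] by (intro exp_conjugate[symmetric]) (auto simp: unitaries_def)
  finally show "\<theta> (exp (t *\<^sub>R scaleC \<i> (u * a * star u))) = exp (t *\<^sub>R scaleC \<i> (\<theta> u * generator a * star (\<theta> u)))" .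
qed

end

section \<open>The sign and the pullback of traces\<close>

locale circle_preserving_hom = contractive_unitary_hom \<theta>
  for \<theta> :: "'a::cstar_algebra \<Rightarrow> 'b::cstar_algebra" +
  assumes inj: "inj_on \<theta> unitaries" and circle: "\<theta> ` scalar_circle \<subseteq> scalar_circle"
begin

text \<open>i S(1) is a limit of difference quotients of scalar unitaries, and the scalars are
  closed, being a complete isometric copy of the complex numbers. Selfadjointness makes the scalar
  real.\<close>

lemma generator_one_scalar: "\<exists>l. generator 1 = l *\<^sub>R 1"
proof -
  have "\<exists>z. cmod z = 1 \<and> \<theta> (exp (t *\<^sub>R scaleC \<i> 1)) = scaleC z 1" for t
  proof -
    have "exp (t *\<^sub>R scaleC \<i> 1) \<in> (scalar_circle :: 'a set)"
      unfolding exp_scalar scalar_circle_def by auto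
    then show ?thesis using circle by (auto simp: scalar_circle_def)
  qed
  then obtain z where z: "\<And>t. exp (t *\<^sub>R scaleC \<i> (generator 1)) = scaleC (z t) 1"
    unfolding generator(2)[OF one_selfadjoint] by metis
  define X where "X = scaleC \<i> (generator 1)"
  define S where "S = range (\<lambda>c. scaleC c (1 :: 'b))"
  have "closed S"
  proof -
    have "complete S"
      unfolding complete_def
    proof (intro allI impI, elim conjE)
      fix f :: "nat \<Rightarrow> 'b" assume f: "\<forall>n. f n \<in> S" "Cauchy f"
      from f(1) have "\<forall>n. \<exists>c. f n = scaleC c 1" unfolding S_def by blast
      then obtain c where c: "\<And>n. f n = scaleC (c n) 1" by (auto dest: choice)
      have "dist (c m) (c n) = dist (f m) (f n)" for m n
        unfolding c dist_norm scaleC_diff_left[symmetric] by (simp add: norm_scaleC)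
      then have "Cauchy c" using f(2) by (simp add: Cauchy_def)
      then obtain l where l: "c \<longlonglongrightarrow> l" using Cauchy_convergent convergent_def by blast
      have "(\<lambda>n. scaleC (c n) (1 :: 'b)) \<longlonglongrightarrow> scaleC l 1"
      proof (rule Lim_null_comparison[THEN LIM_zero_cancel])
        show "eventually (\<lambda>n. norm (scaleC (c n) (1 :: 'b) - scaleC l 1) \<le> cmod (c n - l)) sequentially"
          unfolding scaleC_diff_left[symmetric] by (simp add: norm_scaleC)
        show "(\<lambda>n. cmod (c n - l)) \<longlonglongrightarrow> 0" using l LIM_zero tendsto_norm_zero by blast
      qed
      then have "f \<longlonglongrightarrow> scaleC l 1" using c by presburger
      then show "\<exists>l\<in>S. f \<longlonglongrightarrow> l" unfolding S_def by blast
    qed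
    then show ?thesis by (rule complete_imp_closed)
  qed
  moreover have "(\<lambda>n. real (Suc n) *\<^sub>R (exp ((1 / real (Suc n)) *\<^sub>R X) - 1)) \<longlonglongrightarrow> X"
    by (rule has_vector_derivative_quotient_LIMSEQ[of "\<lambda>t. exp (t *\<^sub>R X) - 1"])
      (use has_vector_derivative_diff[OF exp_scaleR_has_vector_derivative_right[of X 0] has_vector_derivative_const[of 1]] in simp_all)
  moreover have "real (Suc n) *\<^sub>R (exp ((1 / real (Suc n)) *\<^sub>R X) - 1) \<in> S" for n
  proof -
    have "real (Suc n) *\<^sub>R (exp ((1 / real (Suc n)) *\<^sub>R X) - 1) = scaleC ((z (1 / real (Suc n)) - 1) * of_real (real (Suc n))) 1"
      unfolding scaleC_of_real_mult scaleC_diff_left X_def z by simp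
    then show ?thesis unfolding S_def by blast
  qed
  ultimately have "X \<in> S" by (meson closed_sequentially)
  then obtain c where "scaleC \<i> (generator 1) = scaleC c 1" unfolding S_def X_def by blast
  then have "scaleC (- \<i>) (scaleC \<i> (generator 1)) = scaleC (- \<i>) (scaleC c 1)" by simp
  then have g: "generator 1 = scaleC (- \<i> * c) 1" by (simp add: scaleC_scaleC)
  moreover have "star (generator 1) = generator 1" by (rule selfadjointD[OF generator(1)[OF one_selfadjoint]])
  ultimately have "cnj (- \<i> * c) = - \<i> * c" by (simp only: star_scaleC star_one scaleC_one_eq_iff)
  then have "- \<i> * c = of_real (Re (- \<i> * c))" by (simp add: complex_eq_iff)
  then show ?thesis using g scaleC_of_real by metis
qed

text \<open>On the circle \<open>\<theta>\<close> is z -> z^l. The period 2 pi makes l an integer;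
  injectivity excludes l = 0, and applied to the angle 2 pi / l, which is mapped to 1, it makes 1/l
  an integer too.\<close>

lemma generator_one: "generator 1 = 1 \<or> generator 1 = - 1"
proof -
  obtain l where l: "generator 1 = l *\<^sub>R 1" using generator_one_scalar ..
  have \<theta>: "\<theta> (scaleC (cis t) 1) = scaleC (cis (l * t)) 1" for t
    using generator(2)[OF one_selfadjoint, of t] unfolding exp_scalar l scaleC_scaleR_commute
    by (simp add: exp_scalar mult.commute)
  have unit: "scaleC (cis t) 1 \<in> (unitaries :: 'a set)" for t
    unfolding exp_scalar[symmetric] by (rule exp_selfadjoint_unitary[OF one_selfadjoint])
  have "scaleC (cis (l * (2 * pi))) (1 :: 'b) = 1" using \<theta>[of "2 * pi"] by (simp add: hom_one)
  then have "cis (l * (2 * pi)) = 1" by (simp only: scaleC_one_eq_one_iff)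
  then have "cos (2 * pi * l) = 1" by (simp add: complex_eq_iff algebra_simps)
  then obtain m :: int where "2 * pi * l = of_int m * 2 * pi" by (auto simp: cos_one_2pi_int)
  then have lm: "l = of_int m" by simp
  have inj': "cis t = 1" if "cis (l * t) = 1" for t
  proof -
    have "\<theta> (scaleC (cis t) 1) = \<theta> 1" using \<theta>[of t] that by (simp add: hom_one)
    then have "scaleC (cis t) (1 :: 'a) = 1" using inj_onD[OF inj _ unit unitaries_one] by blast
    then show ?thesis by (simp only: scaleC_one_eq_one_iff)
  qed
  have "m \<noteq> 0"
  proof
    assume "m = 0"
    have "cis pi = 1" by (rule inj') (simp add: lm \<open>m = 0\<close>)
    then show False by (simp add: complex_eq_iff)
  qed
  define t where "t = 2 * pi / l"
  have "l \<noteq> 0" using \<open>m \<noteq> 0\<close> lm by simp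
  have "cis t = 1" by (rule inj') (use \<open>l \<noteq> 0\<close> in \<open>simp add: t_def\<close>)
  then have "cos t = 1" by (simp add: complex_eq_iff)
  then obtain k :: int where "t = of_int k * 2 * pi" by (auto simp: cos_one_2pi_int)
  then have "1 = of_int k * l" using \<open>l \<noteq> 0\<close> by (simp add: t_def field_simps)
  then have "1 = k * m" unfolding lm by (metis of_int_1 of_int_eq_iff of_int_mult)
  then have "m = 1 \<or> m = - 1" by (metis zmult_eq_1_iff mult.commute)
  then show ?thesis using l lm by auto
qed

definition sign :: int where
  "sign = (if generator 1 = 1 then 1 else - 1)"

lemma sign_cases: "sign = 1 \<or> sign = - 1"
  by (simp add: sign_def)

lemma generator_one_sign: "generator 1 = of_int sign *\<^sub>R 1"
  using generator_one by (auto simp: sign_def)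

lemma hom_circle: "\<theta> (scaleC (cis t) 1) = scaleC (cis (of_int sign * t)) 1"
  using generator(2)[OF one_selfadjoint, of t] unfolding exp_scalar generator_one_sign scaleC_scaleR_commute
  by (simp add: exp_scalar mult.commute)

text \<open>The complex linear extension of s \<tau> S, which is defined on selfadjoint elements
  only.\<close>

definition pullback :: "('b \<Rightarrow> complex) \<Rightarrow> 'a \<Rightarrow> complex" where
  "pullback \<tau> x = of_int sign * (\<tau> (generator (re_part x)) + \<i> * \<tau> (generator (im_part x)))"

lemma generator_zero: "generator 0 = 0"
  using generator_scaleR[of 0 0] by (simp add: selfadjoint_def)

lemma generator_minus: "a \<in> selfadjoint \<Longrightarrow> generator (- a) = - generator a"
  using generator_scaleR[of a "-1"] by simp

lemma pullback_selfadjoint: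
  assumes "\<tau> \<in> tracial_states" "a \<in> selfadjoint"
  shows "pullback \<tau> a = of_int sign * \<tau> (generator a)"
  using assms tracial_state_scaleC[OF assms(1), of 0 0]
  by (simp add: pullback_def re_part_of_selfadjoint im_part_of_selfadjoint generator_zero)

lemma pullback_add:
  assumes \<tau>: "\<tau> \<in> tracial_states"
  shows "pullback \<tau> (x + y) = pullback \<tau> x + pullback \<tau> y"
  by (simp add: pullback_def re_part_add im_part_add generator_add re_part_selfadjoint im_part_selfadjoint
      tracial_state_add[OF \<tau>] algebra_simps)

lemma pullback_scaleR:
  assumes \<tau>: "\<tau> \<in> tracial_states"
  shows "pullback \<tau> (r *\<^sub>R x) = of_real r * pullback \<tau> x"
  by (simp add: pullback_def re_part_scaleR im_part_scaleR generator_scaleR re_part_selfadjoint im_part_selfadjoint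
      tracial_state_scaleR[OF \<tau>] algebra_simps)

lemma pullback_i:
  assumes \<tau>: "\<tau> \<in> tracial_states"
  shows "pullback \<tau> (scaleC \<i> x) = \<i> * pullback \<tau> x"
  by (simp add: pullback_def re_part_i im_part_i generator_minus im_part_selfadjoint
      tracial_state_minus[OF \<tau>] algebra_simps)

lemma pullback_scaleC:
  assumes \<tau>: "\<tau> \<in> tracial_states"
  shows "pullback \<tau> (scaleC c x) = c * pullback \<tau> x"
proof -
  have c: "c = of_real (Re c) + of_real (Im c) * \<i>" by (simp add: complex_eq_iff)
  have "scaleC c x = Re c *\<^sub>R x + Im c *\<^sub>R scaleC \<i> x"
    unfolding scaleC_of_real[symmetric] scaleC_scaleC scaleC_add_left[symmetric] using c by simp
  then have "pullback \<tau> (scaleC c x) = (of_real (Re c) + \<i> * of_real (Im c)) * pullback \<tau> x"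
    by (simp add: pullback_add[OF \<tau>] pullback_scaleR[OF \<tau>] pullback_i[OF \<tau>] algebra_simps)
  then show ?thesis using c by (simp only: mult.commute)
qed

lemma norm_pullback_le:
  assumes \<tau>: "\<tau> \<in> tracial_states" and a: "a \<in> selfadjoint"
  shows "norm (pullback \<tau> a) \<le> norm a"
proof -
  have "norm (pullback \<tau> a) = \<bar>Re (\<tau> (generator a))\<bar>"
    using tracial_state_selfadjoint_real[OF \<tau> generator(1)[OF a]] sign_cases
    by (auto simp: pullback_selfadjoint[OF \<tau> a]) (metis norm_of_real)+
  then show ?thesis
    using tracial_state_abs_le[OF \<tau> generator(1)[OF a]] norm_generator_le[OF a] by linarith
qed

lemma norm_pullback_le_2:
  assumes \<tau>: "\<tau> \<in> tracial_states"
  shows "norm (pullback \<tau> x) \<le> 2 * norm x"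
proof -
  have "pullback \<tau> x = pullback \<tau> (re_part x) + \<i> * pullback \<tau> (im_part x)"
    by (metis re_im_parts pullback_add[OF \<tau>] pullback_i[OF \<tau>])
  then have "norm (pullback \<tau> x) \<le> norm (pullback \<tau> (re_part x)) + norm (pullback \<tau> (im_part x))"
    by (metis norm_triangle_ineq norm_mult norm_ii mult_1)
  then show ?thesis
    using norm_pullback_le[OF \<tau> re_part_selfadjoint, of x] norm_pullback_le[OF \<tau> im_part_selfadjoint, of x]
      norm_re_part_le[of x] norm_im_part_le[of x] by linarith
qed

text \<open>Traciality: differentiate the invariance under conjugation by \<open>exp(ith)\<close> at \<open>t = 0\<close>.\<close>

lemma pullback_commute:
  assumes \<tau>: "\<tau> \<in> tracial_states"
  shows "pullback \<tau> (x * y) = pullback \<tau> (y * x)"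
proof -
  have minus: "pullback \<tau> (- z) = - pullback \<tau> z" for z using pullback_scaleR[OF \<tau>, of "-1" z] by simp
  have diff: "pullback \<tau> (w - z) = pullback \<tau> w - pullback \<tau> z" for w z
    using pullback_add[OF \<tau>, of w "- z"] by (simp add: minus)
  have bl: "bounded_linear (pullback \<tau>)"
    by (rule bounded_linear_intro[of _ 2])
      (use pullback_add[OF \<tau>] pullback_scaleR[OF \<tau>] norm_pullback_le_2[OF \<tau>] in \<open>simp_all add: scaleR_conv_of_real[where 'a = complex] mult.commute\<close>)
  have sa: "pullback \<tau> (h * a) = pullback \<tau> (a * h)" if h: "h \<in> selfadjoint" and a: "a \<in> selfadjoint" for h a
  proof -
    define X where "X = scaleC \<i> h"
    define e where "e t = exp (t *\<^sub>R X)" for t :: real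
    have const: "pullback \<tau> (e t * a * e (- t)) = pullback \<tau> a" for t
    proof -
      have u: "e t \<in> unitaries" unfolding e_def X_def by (rule exp_selfadjoint_unitary[OF h])
      have su: "star (e t) = e (- t)"
        using skew_of_selfadjoint[OF h, of t] by (simp add: e_def X_def star_exp)
      have sa: "e t * a * star (e t) \<in> selfadjoint"
        using a by (simp add: selfadjoint_def star_mult star_star mult.assoc)
      have "\<tau> (\<theta> (e t) * generator a * star (\<theta> (e t))) = \<tau> (star (\<theta> (e t)) * (\<theta> (e t) * generator a))"
        by (rule tracial_state_commute[OF \<tau>])
      also have "\<dots> = \<tau> (star (\<theta> (e t)) * \<theta> (e t) * generator a)" by (simp only: mult.assoc)
      also have "\<dots> = \<tau> (generator a)" using maps[OF u] by (simp add: unitaries_def)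
      finally show ?thesis
        unfolding su[symmetric] pullback_selfadjoint[OF \<tau> sa] pullback_selfadjoint[OF \<tau> a] generator_conjugate[OF a u] by simp
    qed
    have d1: "(e has_vector_derivative X) (at 0)"
      unfolding e_def using exp_scaleR_has_vector_derivative_right[of X 0] by simp
    have d2: "((\<lambda>t. e (- t)) has_vector_derivative - X) (at 0)"
      unfolding e_def using exp_scaleR_has_vector_derivative_right[of "- X" 0] by simp
    have "((\<lambda>t. e t * a * e (- t)) has_vector_derivative (X * a - a * X)) (at 0)"
      using has_vector_derivative_mult[OF has_vector_derivative_mult[OF d1 has_vector_derivative_const[of a]] d2]
      by (simp add: e_def)
    then have "((\<lambda>t. pullback \<tau> (e t * a * e (- t))) has_vector_derivative pullback \<tau> (X * a - a * X)) (at 0)"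
      by (rule bounded_linear.has_vector_derivative[OF bl])
    then have "((\<lambda>t :: real. pullback \<tau> a) has_vector_derivative pullback \<tau> (X * a - a * X)) (at 0)"
      unfolding const .
    then have "pullback \<tau> (X * a - a * X) = 0"
      using vector_derivative_unique_at has_vector_derivative_const by blast
    then have "\<i> * (pullback \<tau> (h * a) - pullback \<tau> (a * h)) = 0"
      by (simp add: X_def scaleC_mult_left scaleC_mult_right diff pullback_i[OF \<tau>] algebra_simps)
    then show ?thesis by simp
  qed
  let ?h = "re_part x" and ?k = "im_part x" and ?a = "re_part y" and ?b = "im_part y"
  have "x * y = ?h * ?a + scaleC \<i> (?h * ?b) + (scaleC \<i> (?k * ?a) + scaleC (\<i> * \<i>) (?k * ?b))"
    by (subst (1) re_im_parts[of x], subst (1) re_im_parts[of y])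
      (simp only: distrib_left distrib_right scaleC_mult_left scaleC_mult_right scaleC_scaleC scaleC_add_right add_ac)
  moreover have "y * x = ?a * ?h + scaleC \<i> (?a * ?k) + (scaleC \<i> (?b * ?h) + scaleC (\<i> * \<i>) (?b * ?k))"
    by (subst (1) re_im_parts[of x], subst (1) re_im_parts[of y])
      (simp only: distrib_left distrib_right scaleC_mult_left scaleC_mult_right scaleC_scaleC scaleC_add_right add_ac)
  ultimately show ?thesis
    using sa[of ?h ?a] sa[of ?h ?b] sa[of ?k ?a] sa[of ?k ?b]
    by (simp add: pullback_add[OF \<tau>] pullback_scaleC[OF \<tau>] re_part_selfadjoint im_part_selfadjoint)
qed

lemma pullback_tracial_state:
  assumes \<tau>: "\<tau> \<in> tracial_states"
  shows "pullback \<tau> \<in> tracial_states"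
proof (rule tracial_stateI)
  show "pullback \<tau> 1 = 1"
    unfolding pullback_selfadjoint[OF \<tau> one_selfadjoint] generator_one_sign tracial_state_scaleR[OF \<tau>] tracial_state_one[OF \<tau>]
    using sign_cases by auto
  show "pullback \<tau> a \<in> \<real>" if a: "a \<in> selfadjoint" for a
  proof -
    have "pullback \<tau> a = of_real (of_int sign * Re (\<tau> (generator a)))"
      by (simp add: pullback_selfadjoint[OF \<tau> a] tracial_state_selfadjoint_real[OF \<tau> generator(1)[OF a]])
    then show ?thesis by (metis Reals_of_real)
  qed
qed (use pullback_add[OF \<tau>] pullback_scaleC[OF \<tau>] pullback_commute[OF \<tau>] norm_pullback_le[OF \<tau>] in auto)

end

section \<open>The induced morphism\<close>

lemma group_unitary_group: "group (unitary_group :: 'a::cstar_algebra monoid)"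
proof (rule groupI)
  fix u :: 'a assume "u \<in> carrier unitary_group"
  then show "\<exists>v\<in>carrier unitary_group. v \<otimes>\<^bsub>unitary_group\<^esub> u = \<one>\<^bsub>unitary_group\<^esub>"
    by (intro bexI[of _ "star u"]) (simp_all add: unitary_group_def unitaries_star, simp add: unitaries_def)
qed (auto simp: unitary_group_def unitaries_mult unitaries_one mult.assoc)

lemma inv_unitary_group: "u \<in> unitaries \<Longrightarrow> inv\<^bsub>unitary_group\<^esub> u = star u"
  by (rule group.inv_equality[OF group_unitary_group]) (auto simp: unitary_group_def unitaries_star, simp add: unitaries_def)

lemma connected_component_of_map:
  assumes f: "continuous_map X Y f" and xy: "connected_component_of X x y"
  shows "connected_component_of Y (f x) (f y)"
  using xy connectedin_continuous_map_image[OF f] unfolding connected_component_of_def by blast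

lemma continuous_map_unitary_top:
  assumes "continuous_on unitaries f" "\<And>u. u \<in> unitaries \<Longrightarrow> f u \<in> unitaries"
  shows "continuous_map unitary_top unitary_top f"
  using assms by (auto simp: continuous_map_in_subtopology)

abbreviation unitary_component :: "'a::cstar_algebra set" where
  "unitary_component \<equiv> connected_component_of_set unitary_top 1"

lemma unitary_component_subset: "unitary_component \<subseteq> unitaries"
  using connected_component_of_subset_topspace[of unitary_top 1] by simp

lemma normal_unitary_component: "(unitary_component :: 'a::cstar_algebra set) \<lhd> unitary_group"
proof -
  interpret group "unitary_group :: 'a monoid" by (rule group_unitary_group)
  let ?C = "connected_component_of unitary_top :: 'a \<Rightarrow> 'a \<Rightarrow> bool"
  have U: "u \<in> unitaries" if "?C 1 u" for u using that unitary_component_subset by blast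
  have left: "?C (u * v) (u * w)" if "u \<in> unitaries" "?C v w" for u v w
    by (rule connected_component_of_map[OF continuous_map_unitary_top that(2)])
      (use that(1) in \<open>auto intro!: continuous_intros unitaries_mult\<close>)
  have "subgroup (unitary_component :: 'a set) unitary_group"
  proof (rule subgroup.intro)
    show "(unitary_component :: 'a set) \<subseteq> carrier unitary_group" using unitary_component_subset by (simp add: unitary_group_def)
    show "\<one>\<^bsub>unitary_group\<^esub> \<in> (unitary_component :: 'a set)"
      by (simp add: unitary_group_def connected_component_of_refl unitaries_one)
  next
    fix u v :: 'a assume "u \<in> unitary_component" "v \<in> unitary_component"
    then have uv: "?C 1 u" "?C 1 v" by auto
    have "?C u (u * v)" using left[OF U[OF uv(1)] uv(2)] by simp
    then show "u \<otimes>\<^bsub>unitary_group\<^esub> v \<in> unitary_component"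
      using connected_component_of_trans[OF uv(1)] by (simp add: unitary_group_def)
  next
    fix u :: 'a assume "u \<in> unitary_component"
    then have u: "?C 1 u" by auto
    have "?C (star u) 1" using left[OF unitaries_star[OF U[OF u]] u] U[OF u] by (simp add: unitaries_def)
    then show "inv\<^bsub>unitary_group\<^esub> u \<in> unitary_component"
      using U[OF u] by (simp add: inv_unitary_group connected_component_of_sym)
  qed
  moreover have "x \<otimes>\<^bsub>unitary_group\<^esub> u \<otimes>\<^bsub>unitary_group\<^esub> inv\<^bsub>unitary_group\<^esub> x \<in> unitary_component"
    if x: "x \<in> carrier unitary_group" and u: "u \<in> unitary_component" for x u :: 'a
  proof -
    have xU: "x \<in> unitaries" using x by (simp add: unitary_group_def)
    have "?C (x * 1 * star x) (x * u * star x)"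
      by (rule connected_component_of_map[OF continuous_map_unitary_top, of "\<lambda>u. x * u * star x"])
        (use xU u in \<open>auto intro!: continuous_intros unitaries_mult unitaries_star\<close>)
    then show ?thesis using xU by (simp add: inv_unitary_group) (simp add: unitary_group_def unitaries_def)
  qed
  ultimately show ?thesis unfolding normal_inv_iff by blast
qed

lemma coset_map_rcos:
  assumes N: "N \<lhd> G" and N': "N' \<lhd> H" and f: "f \<in> hom G H" and fN: "f ` N \<subseteq> N'" and u: "u \<in> carrier G"
  shows "coset_map H N' f (N #>\<^bsub>G\<^esub> u) = N' #>\<^bsub>H\<^esub> f u"
proof -
  interpret N: normal N G by fact
  interpret N': normal N' H by fact
  have fu: "f u \<in> carrier H" by (rule hom_in_carrier[OF f u])
  have "N' #>\<^bsub>H\<^esub> f v = N' #>\<^bsub>H\<^esub> f u" if v: "v \<in> N #>\<^bsub>G\<^esub> u" for v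
  proof -
    obtain n where n: "n \<in> N" "v = n \<otimes>\<^bsub>G\<^esub> u" using v by (auto simp: r_coset_def)
    have nG: "n \<in> carrier G" using n(1) N.subset by blast
    have fn: "f n \<in> N'" using fN n(1) by blast
    then have fnH: "f n \<in> carrier H" using N'.subset by blast
    have "N' #>\<^bsub>H\<^esub> f v = (N' #>\<^bsub>H\<^esub> f n) #>\<^bsub>H\<^esub> f u"
      unfolding n(2) hom_mult[OF f nG u] by (rule N'.coset_mult_assoc[symmetric, OF N'.subset fnH fu])
    also have "N' #>\<^bsub>H\<^esub> f n = N'" by (rule N'.coset_join2[OF fnH N'.subgroup_axioms fn])
    finally show ?thesis .
  qed
  moreover have "u \<in> N #>\<^bsub>G\<^esub> u" by (rule N.rcos_self[OF u N.subgroup_axioms])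
  ultimately show ?thesis unfolding coset_map_def by blast
qed

lemma coset_map_hom:
  assumes N: "N \<lhd> G" and N': "N' \<lhd> H" and f: "f \<in> hom G H" and fN: "f ` N \<subseteq> N'"
  shows "coset_map H N' f \<in> hom (G Mod N) (H Mod N')"
proof -
  interpret N: normal N G by fact
  interpret N': normal N' H by fact
  note rcos = coset_map_rcos[OF N N' f fN]
  show ?thesis
  proof (rule homI)
    fix C assume "C \<in> carrier (G Mod N)"
    then obtain u where u: "u \<in> carrier G" "C = N #>\<^bsub>G\<^esub> u" by (auto simp: FactGroup_def RCOSETS_def)
    then show "coset_map H N' f C \<in> carrier (H Mod N')"
      using hom_in_carrier[OF f u(1)] by (auto simp: rcos FactGroup_def RCOSETS_def)
    fix D assume "D \<in> carrier (G Mod N)"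
    then obtain v where v: "v \<in> carrier G" "D = N #>\<^bsub>G\<^esub> v" by (auto simp: FactGroup_def RCOSETS_def)
    show "coset_map H N' f (C \<otimes>\<^bsub>G Mod N\<^esub> D) = coset_map H N' f C \<otimes>\<^bsub>H Mod N'\<^esub> coset_map H N' f D"
      using u v hom_in_carrier[OF f u(1)] hom_in_carrier[OF f v(1)]
      by (simp add: FactGroup_def rcos N.rcos_sum N'.rcos_sum hom_mult[OF f])
  qed
qed

text \<open>G is assumed to be closed under its operation and no more; for \<open>pi1\<close> this
  is what has been established.\<close>

lemma hom_transport_iso:
  assumes a: "a \<in> iso G G'" and h: "h \<in> hom G H"
    and closed: "\<And>x y. x \<in> carrier G \<Longrightarrow> y \<in> carrier G \<Longrightarrow> x \<otimes>\<^bsub>G\<^esub> y \<in> carrier G"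
  shows "h \<circ> inv_into (carrier G) a \<in> hom G' H"
    and "c \<in> carrier G \<Longrightarrow> (h \<circ> inv_into (carrier G) a) (a c) = h c"
proof -
  have inj: "inj_on a (carrier G)" and im: "a ` carrier G = carrier G'" and a_hom: "a \<in> hom G G'"
    using a by (auto simp: iso_def bij_betw_def)
  show inv: "(h \<circ> inv_into (carrier G) a) (a c) = h c" if "c \<in> carrier G" for c
    using inv_into_f_f[OF inj that] by simp
  show "h \<circ> inv_into (carrier G) a \<in> hom G' H"
  proof (rule homI)
    fix x assume "x \<in> carrier G'"
    then obtain c where c: "c \<in> carrier G" "x = a c" using im by blast
    show "(h \<circ> inv_into (carrier G) a) x \<in> carrier H"
      unfolding c(2) inv[OF c(1)] by (rule hom_in_carrier[OF h c(1)])
    fix y assume "y \<in> carrier G'"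
    then obtain d where d: "d \<in> carrier G" "y = a d" using im by blast
    show "(h \<circ> inv_into (carrier G) a) (x \<otimes>\<^bsub>G'\<^esub> y) =
        (h \<circ> inv_into (carrier G) a) x \<otimes>\<^bsub>H\<^esub> (h \<circ> inv_into (carrier G) a) y"
      unfolding c(2) d(2) hom_mult[OF a_hom c(1) d(1), symmetric] inv[OF c(1)] inv[OF d(1)] inv[OF closed[OF c(1) d(1)]]
      by (rule hom_mult[OF h c(1) d(1)])
  qed
qed

text \<open>Inversion is a homomorphism because the group is commutative; this permits the sign
  correction of \<alpha>0.\<close>

lemma (in comm_group) hom_int_pow_sign:
  assumes h: "h \<in> hom H G" and s: "s = 1 \<or> s = (- 1 :: int)"
  shows "(\<lambda>x. h x [^] s) \<in> hom H G"
proof (rule homI)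
  fix x assume x: "x \<in> carrier H"
  note hx = hom_in_carrier[OF h x]
  show "h x [^] s \<in> carrier G" using hx by simp
  fix y assume y: "y \<in> carrier H"
  note hy = hom_in_carrier[OF h y]
  show "h (x \<otimes>\<^bsub>H\<^esub> y) [^] s = h x [^] s \<otimes> h y [^] s"
    using s hx hy by (auto simp: hom_mult[OF h x y] int_pow_1 int_pow_neg inv_mult)
qed

text \<open>For norm x at most 1/4, the contraction estimate keeps exp(tx) within 1/8 + 1/4 of 1
  along the whole segment, well inside the range of \<open>log_trace_curve\<close>.\<close>

lemma log_trace_exp:
  fixes x :: "'a::cstar_algebra"
  assumes "bounded_trace \<tau>" and x: "norm x \<le> 1/4"
  shows "log_trace \<tau> (exp x) = \<tau> x"
proof -
  interpret bounded_trace \<tau> by fact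
  have "log_trace \<tau> (exp (1 *\<^sub>R x)) = \<tau> x"
  proof (rule log_trace_curve)
    fix t :: real assume t: "t \<in> {0..1}"
    show "((\<lambda>t. exp (t *\<^sub>R x)) has_vector_derivative exp (t *\<^sub>R x) * x) (at t)"
      by (rule exp_scaleR_has_vector_derivative_right)
    have "norm (t *\<^sub>R x) \<le> 1 * (1/4)" unfolding norm_scaleR using t x by (intro mult_mono) auto
    then have n: "norm (t *\<^sub>R x) \<le> 1/4" by simp
    have "norm ((exp (t *\<^sub>R x) - t *\<^sub>R x) - 1) \<le> norm (t *\<^sub>R x) / 2"
      using exp_minus_id_contraction[OF n, of 0] by simp
    moreover have "norm (1 - exp (t *\<^sub>R x)) \<le> norm ((exp (t *\<^sub>R x) - t *\<^sub>R x) - 1) + norm (t *\<^sub>R x)"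
      using norm_triangle_ineq[of "(exp (t *\<^sub>R x) - t *\<^sub>R x) - 1" "t *\<^sub>R x"] by (simp add: norm_minus_commute)
    ultimately show "norm (1 - exp (t *\<^sub>R x)) \<le> 1/2" using n by linarith
  qed simp_all
  then show ?thesis by simp
qed

section \<open>The loop of scalars and the class of the unit\<close>

definition circle_loop :: "real \<Rightarrow> 'a::cstar_algebra" where
  "circle_loop t = scaleC (cis (2 * pi * t)) 1"

lemma circle_loop_eq_exp: "circle_loop t = exp ((2 * pi * t) *\<^sub>R scaleC \<i> 1)"
  by (simp add: circle_loop_def exp_scalar)

lemma circle_loop_loops: "(circle_loop :: real \<Rightarrow> 'a::cstar_algebra) \<in> loops unitary_top 1"
proof -
  have "continuous_on {0..1} (\<lambda>t. exp ((2 * pi * t) *\<^sub>R scaleC \<i> (1 :: 'a)))"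
  proof (rule continuous_on_compose2[of UNIV "\<lambda>t. exp (t *\<^sub>R scaleC \<i> (1 :: 'a))" "{0..1}" "\<lambda>t. 2 * pi * t"])
    show "continuous_on UNIV (\<lambda>t. exp (t *\<^sub>R scaleC \<i> (1 :: 'a)))"
      using has_vector_derivative_continuous[OF exp_scaleR_has_vector_derivative_right]
      by (intro continuous_at_imp_continuous_on) blast
    show "continuous_on {0..1} (\<lambda>t. 2 * pi * t)" by (intro continuous_intros)
  qed simp
  then have "continuous_on {0..1} (circle_loop :: real \<Rightarrow> 'a)" by (simp add: circle_loop_eq_exp)
  moreover have "circle_loop t \<in> (unitaries :: 'a set)" for t
    unfolding circle_loop_eq_exp by (rule exp_selfadjoint_unitary[OF one_selfadjoint])
  ultimately show ?thesis
    by (auto simp: loops_def pathin_def continuous_map_in_subtopology) (simp_all add: circle_loop_def)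
qed

text \<open>In \<open>U_inf\<close> the circle loop is literally the projection loop of the unit of
  the corner. This ties preservation of the class of the unit to the action of
  \<open>\<theta>\<close> on scalars.\<close>

lemma canonical_pi1_circle_loop:
  assumes k: "is_canonical_pi1 (k :: (real \<Rightarrow> 'a::cstar_algebra) set \<Rightarrow> 'a k0)"
  shows "k (loop_class unitary_top 1 circle_loop) = K0_class one_proj"
proof -
  obtain b where bott: "bott_identification b"
    and kb: "\<And>c. c \<in> carrier pi1_U \<Longrightarrow> k c = b (pi1_map U_inf_top mone U_embed c)"
    using k unfolding is_canonical_pi1_def by blast
  have b: "b (loop_class U_inf_top (mone :: 'a nmat) (projection_loop p)) = K0_class (n, p)"
    if "p \<in> projections n" for n p
    using bott that unfolding bott_identification_def by simp
  define e :: "'a nmat" where "e = (\<lambda>i j. if i = 0 \<and> j = 0 then 1 else 0)"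
  have "e \<in> corner 1 1" by (auto simp: e_def corner_def)
  moreover have "mstar e = e" by (auto simp: e_def mstar_def fun_eq_iff)
  moreover have "mmult e e = e"
    using mmult_corner_eq[of e 1 1 e 1] \<open>e \<in> corner 1 1\<close> by (intro ext) (auto simp: e_def)
  ultimately have "e \<in> projections 1" by (simp add: projections_def)
  moreover have "U_embed \<circ> circle_loop = projection_loop e"
    by (auto simp: fun_eq_iff U_embed_def circle_loop_def projection_loop_def e_def mone_def)
  moreover have "one_proj = (1, e)" by (simp add: one_proj_def e_def)
  ultimately show ?thesis
    unfolding kb[OF loop_class_carrier[OF circle_loop_loops]]
      pi1_map_loop_class[OF continuous_map_U_embed circle_loop_loops U_embed_one]
    using b[of e 1] by simp
qed

text \<open>The constant loop is idempotent under concatenation, and the only idempotent of a group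
  is its identity.\<close>

lemma hom_pi1_const:
  assumes h: "h \<in> hom (pi1 X x) K" and K: "group K" and x: "x \<in> topspace X"
  shows "h (loop_class X x (\<lambda>_. x)) = \<one>\<^bsub>K\<^esub>"
proof -
  interpret group K by fact
  have c: "(\<lambda>_. x) \<in> loops X x" using x by (simp add: loops_def pathin_def)
  have "(\<lambda>_. x) +++ (\<lambda>_. x) = (\<lambda>_. x)" by (simp add: joinpaths_def)
  then have "h (loop_class X x (\<lambda>_. x)) \<otimes>\<^bsub>K\<^esub> h (loop_class X x (\<lambda>_. x)) = h (loop_class X x (\<lambda>_. x))"
    using hom_mult[OF h loop_class_carrier[OF c] loop_class_carrier[OF c]] by (simp add: pi1_mult[OF c c])
  then show ?thesis using hom_in_carrier[OF h loop_class_carrier[OF c]] by simp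
qed

text \<open>Used for s = -1, where \<open>\<theta>\<close> reverses the circle loop. Inverses are
  computed in the target K, from the null homotopy of the reversed loop followed by the
  loop.\<close>

lemma hom_pi1_reverse:
  fixes S :: "'a::real_normed_vector set"
  assumes h: "h \<in> hom (pi1 (top_of_set S) x) K" and K: "group K" and g: "g \<in> loops (top_of_set S) x"
  shows "reversepath g \<in> loops (top_of_set S) x"
    and "h (loop_class (top_of_set S) x (reversepath g)) = inv\<^bsub>K\<^esub> (h (loop_class (top_of_set S) x g))"
proof -
  interpret group K by fact
  have p: "path g" "path_image g \<subseteq> S" "g 0 = x" "g 1 = x"
    using g by (auto simp: loops_def pathin_def continuous_map_in_subtopology path_def path_image_def)
  then have r: "path (reversepath g)" "path_image (reversepath g) \<subseteq> S" by simp_all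
  show rl: "reversepath g \<in> loops (top_of_set S) x"
    using r p by (auto simp: loops_def pathin_def continuous_map_in_subtopology path_def path_image_def reversepath_def)
  have xS: "x \<in> S" using p by (metis atLeastAtMost_iff image_subset_iff path_image_def order_refl zero_le_one)
  have const: "(\<lambda>_. x) \<in> loops (top_of_set S) x" using xS by (simp add: loops_def pathin_def)
  have "homotopic_paths S (reversepath g +++ g) (linepath (pathfinish g) (pathfinish g))"
    by (rule homotopic_paths_linv[OF p(1,2)])
  then have "homotopic_with (\<lambda>k. k 0 = x \<and> k 1 = x) (top_of_set {0..1}) (top_of_set S) (reversepath g +++ g) (\<lambda>_. x)"
    using p by (simp add: homotopic_paths_def pathstart_def pathfinish_def joinpaths_def reversepath_def linepath_def flip: scaleR_left_distrib)
  then have "(reversepath g +++ g, (\<lambda>_. x)) \<in> loop_homotopy (top_of_set S) x"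
    using loops_join[OF rl g] const by (simp add: loop_homotopy_def)
  then have "loop_class (top_of_set S) x (reversepath g +++ g) = loop_class (top_of_set S) x (\<lambda>_. x)"
    by (simp add: loop_class_eq_iff loops_join[OF rl g] const)
  then have "h (loop_class (top_of_set S) x (reversepath g)) \<otimes>\<^bsub>K\<^esub> h (loop_class (top_of_set S) x g) = \<one>\<^bsub>K\<^esub>"
    using hom_mult[OF h loop_class_carrier[OF rl] loop_class_carrier[OF g]] hom_pi1_const[OF h K] xS
    by (simp add: pi1_mult[OF rl g])
  then show "h (loop_class (top_of_set S) x (reversepath g)) = inv\<^bsub>K\<^esub> (h (loop_class (top_of_set S) x g))"
    using hom_in_carrier[OF h loop_class_carrier[OF rl]] hom_in_carrier[OF h loop_class_carrier[OF g]]
    by (simp add: inv_equality)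
qed

text \<open>Membership of the mixture decides which branch of \<open>AffT_pullback\<close> applies
  to it.\<close>

lemma tracial_states_convex:
  assumes s: "\<sigma> \<in> (tracial_states :: ('c::cstar_algebra \<Rightarrow> complex) set)" and t: "\<tau> \<in> tracial_states" and r: "r \<in> {0..1::real}"
  shows "(\<lambda>a. of_real (1 - r) * \<sigma> a + of_real r * \<tau> a) \<in> tracial_states"
proof (rule tracial_stateI)
  fix a :: 'c assume a: "a \<in> selfadjoint"
  have *: "of_real (1 - r) * \<sigma> a + of_real r * \<tau> a = of_real ((1 - r) * Re (\<sigma> a) + r * Re (\<tau> a))"
    using tracial_state_selfadjoint_real[OF s a] tracial_state_selfadjoint_real[OF t a] by simp
  then show "of_real (1 - r) * \<sigma> a + of_real r * \<tau> a \<in> \<real>" by (metis Reals_of_real)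
  have "\<bar>(1 - r) * Re (\<sigma> a) + r * Re (\<tau> a)\<bar> \<le> (1 - r) * \<bar>Re (\<sigma> a)\<bar> + r * \<bar>Re (\<tau> a)\<bar>"
    using r abs_triangle_ineq[of "(1 - r) * Re (\<sigma> a)" "r * Re (\<tau> a)"] by (simp add: abs_mult)
  also have "\<dots> \<le> (1 - r) * norm a + r * norm a"
    using r tracial_state_abs_le[OF s a] tracial_state_abs_le[OF t a] by (intro add_mono mult_left_mono) auto
  finally show "norm (of_real (1 - r) * \<sigma> a + of_real r * \<tau> a) \<le> norm a"
    unfolding * norm_of_real by (simp add: algebra_simps)
qed (simp_all add: tracial_state_add[OF s] tracial_state_add[OF t] tracial_state_scaleC[OF s] tracial_state_scaleC[OF t]
    tracial_state_one[OF s] tracial_state_one[OF t] tracial_state_commute[OF s] tracial_state_commute[OF t] algebra_simps)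

section \<open>Compatibility with the pairing\<close>

context circle_preserving_hom
begin

lemma continuous_map_hom: "continuous_map unitary_top unitary_top \<theta>"
  by (rule continuous_map_unitary_top[OF continuous_on_hom maps])

lemma loops_hom: "u \<in> loops unitary_top 1 \<Longrightarrow> \<theta> \<circ> u \<in> loops unitary_top 1"
  using loops_compose[OF continuous_map_hom, of u 1] by (simp add: hom_one)

text \<open>Here \<open>\<theta>\<close> meets the determinant: w = exp(ih) is sent to exp(i S(h))
  with S(h) no larger than h, so \<open>log_trace_exp\<close> evaluates both sides.\<close>

lemma log_trace_hom:
  assumes \<tau>: "\<tau> \<in> tracial_states" and w: "w \<in> unitaries" "norm (w - 1) \<le> 1/16"
  shows "log_trace (pullback \<tau>) w = of_int sign * log_trace \<tau> (\<theta> w)"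
proof -
  obtain h where h: "h \<in> selfadjoint" "exp (scaleC \<i> h) = w" "norm h \<le> 2 * norm (w - 1)"
    by (rule unitary_near_one_log[OF w(1)]) (use w(2) in auto)
  have nh: "norm h \<le> 1/4" using h(3) w(2) by linarith
  have "norm (scaleC \<i> h) \<le> 1/4" using nh by (simp add: norm_scaleC)
  then have "log_trace (pullback \<tau>) w = pullback \<tau> (scaleC \<i> h)"
    unfolding h(2)[symmetric] by (rule log_trace_exp[OF bounded_trace_tracial_state[OF pullback_tracial_state[OF \<tau>]]])
  also have "\<dots> = of_int sign * \<tau> (scaleC \<i> (generator h))"
    by (simp add: pullback_i[OF \<tau>] pullback_selfadjoint[OF \<tau> h(1)] tracial_state_scaleC[OF \<tau>])
  also have "\<tau> (scaleC \<i> (generator h)) = log_trace \<tau> (exp (scaleC \<i> (generator h)))"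
    using norm_generator_le[OF h(1)] nh
    by (intro log_trace_exp[symmetric] bounded_trace_tracial_state[OF \<tau>]) (simp add: norm_scaleC)
  also have "exp (scaleC \<i> (generator h)) = \<theta> w"
    using generator(2)[OF h(1), of 1] h(2) by simp
  finally show ?thesis .
qed

text \<open>Both pairings are determinants over the same partition. When it is so fine that all
  increments of u are within 1/16 of 1, the two sums agree term by term up to the sign.\<close>

lemma rho_pi1_map:
  assumes \<tau>: "\<tau> \<in> tracial_states" and kA: "is_canonical_pi1 kA" and kB: "is_canonical_pi1 kB"
    and u: "u \<in> loops unitary_top 1"
  shows "rho (kA (loop_class unitary_top 1 u)) (pullback \<tau>) =
    of_int sign * rho (kB (loop_class unitary_top 1 (\<theta> \<circ> u))) \<tau>"
proof -
  have cont: "continuous_on {0..1} u" and uU: "\<And>t. t \<in> {0..1} \<Longrightarrow> u t \<in> unitaries"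
    using u by (auto simp: loops_def pathin_def continuous_map_in_subtopology)
  have "uniformly_continuous_on {0..1} u" by (rule compact_uniformly_continuous[OF cont]) simp
  then obtain d where d: "d > 0" "\<And>s t. s \<in> {0..1} \<Longrightarrow> t \<in> {0..1} \<Longrightarrow> dist t s < d \<Longrightarrow> dist (u t) (u s) < 1/16"
    unfolding uniformly_continuous_on_def by (meson zero_less_divide_1_iff zero_less_numeral)
  obtain N0 :: nat where N0: "N0 > 1 / d" using reals_Archimedean2 by blast
  have "eventually (\<lambda>M. 2 * pi * \<i> * of_real (rho (kA (loop_class unitary_top 1 u)) (pullback \<tau>)) =
      of_int sign * (2 * pi * \<i> * of_real (rho (kB (loop_class unitary_top 1 (\<theta> \<circ> u))) \<tau>))) sequentially"
    using canonical_pi1_pairing[OF pullback_tracial_state[OF \<tau>] kA u]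
      canonical_pi1_pairing[OF \<tau> kB loops_hom[OF u]] eventually_ge_at_top[of "Suc N0"]
  proof eventually_elim
    case (elim M)
    have "1 / d < M" using N0 elim(3) by linarith
    then have Md: "1 / M < d" "M > 0" using d(1) elim(3) by (auto simp: field_simps)
    have "log_trace (pullback \<tau>) (star (u (j / M)) * u (Suc j / M)) =
        of_int sign * log_trace \<tau> (star ((\<theta> \<circ> u) (j / M)) * (\<theta> \<circ> u) (Suc j / M))" if "j < M" for j
    proof -
      have I: "j / M \<in> {0..1}" "Suc j / M \<in> {0..1}" using that by auto
      note U = uU[OF I(1)] uU[OF I(2)]
      have "real (Suc j) / M - j / M = 1 / M" using Md(2) by (simp add: field_simps)
      then have "dist (real (Suc j) / M) (j / M) < d" using Md(1) by (simp add: dist_real_def)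
      then have "norm (u (Suc j / M) - u (j / M)) < 1/16" using d(2)[OF I] by (simp add: dist_norm)
      moreover have "star (u (j / M)) * u (Suc j / M) - 1 = star (u (j / M)) * (u (Suc j / M) - u (j / M))"
        using U(1) by (simp add: right_diff_distrib unitaries_def)
      then have "norm (star (u (j / M)) * u (Suc j / M) - 1) \<le> norm (u (Suc j / M) - u (j / M))"
        using norm_mult_ineq[of "star (u (j / M))" "u (Suc j / M) - u (j / M)"] norm_unitary[OF U(1)] by simp
      ultimately have "norm (star (u (j / M)) * u (Suc j / M) - 1) \<le> 1/16" by linarith
      from log_trace_hom[OF \<tau> unitaries_mult[OF unitaries_star[OF U(1)] U(2)] this]
      show ?thesis by (simp add: mult[OF unitaries_star[OF U(1)] U(2)] hom_star[OF U(1)] del: of_nat_Suc)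
    qed
    then have "(\<Sum>j<M. log_trace (pullback \<tau>) (star (u (j / M)) * u (Suc j / M))) =
      of_int sign * (\<Sum>j<M. log_trace \<tau> (star ((\<theta> \<circ> u) (j / M)) * (\<theta> \<circ> u) (Suc j / M)))"
      unfolding sum_distrib_left by (intro sum.cong) auto
    then show ?case unfolding elim(1,2) .
  qed
  \<comment> \<open>Neither side depends on M, so one sufficiently large M is enough.\<close>
  then have "2 * pi * \<i> * of_real (rho (kA (loop_class unitary_top 1 u)) (pullback \<tau>)) =
      of_int sign * (2 * pi * \<i> * of_real (rho (kB (loop_class unitary_top 1 (\<theta> \<circ> u))) \<tau>))"
    by (simp add: eventually_sequentially) blast
  then have "(2 * pi * \<i>) * of_real (rho (kA (loop_class unitary_top 1 u)) (pullback \<tau>)) =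
      (2 * pi * \<i>) * of_real (of_int sign * rho (kB (loop_class unitary_top 1 (\<theta> \<circ> u))) \<tau>)"
    by (simp add: algebra_simps)
  then have "complex_of_real (rho (kA (loop_class unitary_top 1 u)) (pullback \<tau>)) =
      of_real (of_int sign * rho (kB (loop_class unitary_top 1 (\<theta> \<circ> u))) \<tau>)"
    by (subst (asm) mult_cancel_left) simp
  then show ?thesis by (simp only: of_real_eq_iff)
qed

definition AffT_pullback :: "(('a \<Rightarrow> complex) \<Rightarrow> real) \<Rightarrow> (('b \<Rightarrow> complex) \<Rightarrow> real)" where
  "AffT_pullback f = (\<lambda>\<tau>. if \<tau> \<in> tracial_states then f (pullback \<tau>) else 0)"

lemma unital_positive_AffT_pullback: "unital_positive_map AffT_pullback"
  unfolding unital_positive_map_def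
proof (intro conjI)
  show "AffT_pullback \<in> AffT \<rightarrow> AffT"
  proof
    fix f :: "('a \<Rightarrow> complex) \<Rightarrow> real" assume f: "f \<in> AffT"
    have "continuous_on tracial_states (\<lambda>\<tau>. f (pullback \<tau>))"
    proof (rule continuous_on_compose2[of tracial_states f tracial_states pullback])
      show "continuous_on tracial_states f" using f by (simp add: AffT_def)
      have ev: "continuous_on tracial_states (\<lambda>\<tau> :: 'b \<Rightarrow> complex. \<tau> x)" for x
        by (rule continuous_on_subset[OF continuous_on_product_coordinates subset_UNIV])
      \<comment> \<open>Continuity is tested pointwise: for fixed x the value is a combination of
        the values of \<tau> at two fixed elements.\<close>
      show "continuous_on tracial_states pullback"
        unfolding pullback_def
        by (intro continuous_on_coordinatewise_then_product continuous_intros ev)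
      show "pullback ` tracial_states \<subseteq> tracial_states" using pullback_tracial_state by blast
    qed
    then have "continuous_on tracial_states (AffT_pullback f)"
      by (rule continuous_on_cong[THEN iffD1, rotated 2]) (simp_all add: AffT_pullback_def)
    moreover have "AffT_pullback f (\<lambda>a. of_real (1 - t) * \<sigma> a + of_real t * \<tau> a) = (1 - t) * AffT_pullback f \<sigma> + t * AffT_pullback f \<tau>"
      if st: "\<sigma> \<in> tracial_states" "\<tau> \<in> tracial_states" and t: "t \<in> {0..1}" for \<sigma> \<tau> t
    proof -
      have "pullback (\<lambda>a. of_real (1 - t) * \<sigma> a + of_real t * \<tau> a) = (\<lambda>a. of_real (1 - t) * pullback \<sigma> a + of_real t * pullback \<tau> a)"
        by (simp add: pullback_def fun_eq_iff algebra_simps)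
      then show ?thesis
        using f pullback_tracial_state st t tracial_states_convex[OF st t] by (simp add: AffT_pullback_def AffT_def)
    qed
    ultimately show "AffT_pullback f \<in> AffT" by (simp add: AffT_def AffT_pullback_def)
  qed
qed (auto simp: AffT_pullback_def fun_eq_iff AffT_unit_def pullback_tracial_state)

lemma unitary_component_hom: "\<theta> ` unitary_component \<subseteq> unitary_component"
  using connected_component_of_map[OF continuous_map_hom, of 1] hom_one by auto

text \<open>\<open>\<theta>\<close> maps the circle loop to itself or to its reverse, with class [1]
  or -[1]; the exponent undoes the sign.\<close>

lemma canonical_pi1_hom_circle_loop:
  assumes kB: "is_canonical_pi1 kB" and kB_iso: "kB \<in> iso pi1_U K0"
  shows "kB (loop_class unitary_top 1 (\<theta> \<circ> circle_loop)) [^]\<^bsub>K0\<^esub> sign = K0_class one_proj"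
proof -
  interpret K0: comm_group "K0 :: 'b k0 monoid" by (rule comm_group_K0)
  have kB_hom: "kB \<in> hom pi1_U K0" using kB_iso by (simp add: iso_def)
  note one = canonical_pi1_circle_loop[OF kB]
  have carr: "kB (loop_class unitary_top 1 circle_loop) \<in> carrier K0"
    by (rule hom_in_carrier[OF kB_hom loop_class_carrier[OF circle_loop_loops]])
  show ?thesis
  proof (cases "sign = 1")
    case True
    have "\<theta> \<circ> circle_loop = circle_loop"
      by (simp add: fun_eq_iff circle_loop_def hom_circle True)
    then show ?thesis using carr by (simp add: True one K0.int_pow_1)
  next
    case False
    then have s: "sign = - 1" using sign_cases by blast
    have "\<theta> \<circ> circle_loop = reversepath circle_loop"
    proof
      fix t
      have "cis (- (2 * pi * t)) = cis (2 * pi * (1 - t))"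
        by (simp add: right_diff_distrib cis_divide[symmetric] flip: cis_inverse) (simp add: divide_inverse)
      then show "(\<theta> \<circ> circle_loop) t = reversepath circle_loop t"
        by (simp add: circle_loop_def hom_circle s reversepath_def)
    qed
    then have "kB (loop_class unitary_top 1 (\<theta> \<circ> circle_loop)) = inv\<^bsub>K0\<^esub> (kB (loop_class unitary_top 1 circle_loop))"
      using hom_pi1_reverse(2)[OF kB_hom K0.group_axioms circle_loop_loops] by simp
    then show ?thesis using carr by (simp add: s one K0.int_pow_neg K0.int_pow_1)
  qed
qed

lemma hom_circle_powi: "cmod z = 1 \<Longrightarrow> \<theta> (scaleC z 1) = scaleC (z powi sign) 1"
proof -
  assume z: "cmod z = 1"
  then have "z \<noteq> 0" by auto
  then have "z = cis (Arg z)" using cis_Arg[of z] z by (simp add: sgn_eq)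
  then obtain t where t: "z = cis t" by blast
  show ?thesis using sign_cases hom_circle[of t] by (auto simp: t cis_inverse)
qed

end

theorem theorem4p8:
  fixes \<theta> :: "'a::cstar_algebra \<Rightarrow> 'b::cstar_algebra"
    and kA :: "(real \<Rightarrow> 'a) set \<Rightarrow> 'a k0"
    and kB :: "(real \<Rightarrow> 'b) set \<Rightarrow> 'b k0"
  assumes hom: "\<theta> \<in> hom unitary_group unitary_group"
    and inj: "inj_on \<theta> unitaries"
    and contractive: "\<forall>u \<in> unitaries. \<forall>v \<in> unitaries. norm (\<theta> u - \<theta> v) \<le> norm (u - v)"
    and circle: "\<theta> ` scalar_circle = scalar_circle"
    and traces: "(tracial_states :: ('a \<Rightarrow> complex) set) \<noteq> {}"
    and pi0_A: "(canonical_pi0 :: 'a set \<Rightarrow> 'a nmat set) \<in> iso pi0_U K1"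
    and pi0_B: "(canonical_pi0 :: 'b set \<Rightarrow> 'b nmat set) \<in> iso pi0_U K1"
    and kA: "is_canonical_pi1 kA"
    and kB: "is_canonical_pi1 kB"
    and pi1_A: "kA \<in> iso pi1_U K0"
    and pi1_B: "kB \<in> iso pi1_U K0"
  shows "\<exists>\<alpha>0 \<alpha>1 \<gamma>. KTu_morphism \<alpha>0 \<alpha>1 \<gamma> \<and> KTu_induced_by \<theta> kA kB \<alpha>0 \<alpha>1 \<gamma>"
proof -
  interpret circle_preserving_hom \<theta>
  proof
    show "\<theta> u \<in> unitaries" if "u \<in> unitaries" for u
      using hom_in_carrier[OF hom, of u] that by (simp add: unitary_group_def)
    show "\<theta> (u * v) = \<theta> u * \<theta> v" if "u \<in> unitaries" "v \<in> unitaries" for u v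
      using hom_mult[OF hom, of u v] that by (simp add: unitary_group_def)
  qed (use contractive inj circle in auto)
  interpret K0: comm_group "K0 :: 'b k0 monoid" by (rule comm_group_K0)
  have kA_hom: "kA \<in> hom pi1_U K0" and kA_im: "kA ` carrier pi1_U = carrier K0"
    using pi1_A by (auto simp: iso_def bij_betw_def)
  have kB_hom: "kB \<in> hom pi1_U K0" using pi1_B by (simp add: iso_def)

  define h0 where "h0 c = kB (pi1_map unitary_top 1 \<theta> c) [^]\<^bsub>K0\<^esub> sign" for c
  define \<alpha>0 where "\<alpha>0 = h0 \<circ> inv_into (carrier pi1_U) kA"
  have "kB \<circ> pi1_map unitary_top 1 \<theta> \<in> hom pi1_U K0"
    by (rule hom_compose[OF pi1_map_hom[OF continuous_map_hom hom_one] kB_hom])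
  from K0.hom_int_pow_sign[OF this sign_cases] have h0: "h0 \<in> hom pi1_U K0"
    by (simp add: h0_def[abs_def])
  have \<alpha>0_hom: "\<alpha>0 \<in> hom K0 K0" and \<alpha>0: "\<And>c. c \<in> carrier pi1_U \<Longrightarrow> \<alpha>0 (kA c) = h0 c"
    unfolding \<alpha>0_def by (rule hom_transport_iso[OF pi1_A h0]; auto intro: pi1_mult_closed)+

  define h1 where "h1 = canonical_pi0 \<circ> coset_map unitary_group unitary_component \<theta>"
  define \<alpha>1 where "\<alpha>1 = h1 \<circ> inv_into (carrier pi0_U) canonical_pi0"
  have pi0_eq: "pi0_U = unitary_group Mod (unitary_component :: 'c::cstar_algebra set)"
    by (simp add: pi0_def unitary_group_def)
  have "coset_map unitary_group unitary_component \<theta> \<in> hom pi0_U pi0_U"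
    unfolding pi0_eq by (rule coset_map_hom[OF normal_unitary_component normal_unitary_component hom unitary_component_hom])
  then have h1: "h1 \<in> hom pi0_U K1"
    unfolding h1_def using pi0_B by (intro hom_compose[where H = pi0_U]) (auto simp: iso_def)
  have pi0_closed: "x \<otimes>\<^bsub>pi0_U\<^esub> y \<in> carrier pi0_U" if "x \<in> carrier pi0_U" "y \<in> carrier pi0_U" for x y :: "'a set"
    using that group.is_monoid[OF normal.factorgroup_is_group[OF normal_unitary_component]]
    unfolding pi0_eq by (intro monoid.m_closed)
  have \<alpha>1_hom: "\<alpha>1 \<in> hom K1 K1" and \<alpha>1: "\<And>c. c \<in> carrier pi0_U \<Longrightarrow> \<alpha>1 (canonical_pi0 c) = h1 c"
    unfolding \<alpha>1_def by (rule hom_transport_iso[OF pi0_A h1]; auto intro: pi0_closed)+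

  have "KTu_morphism \<alpha>0 \<alpha>1 AffT_pullback"
    unfolding KTu_morphism_def
  proof (intro conjI \<alpha>0_hom \<alpha>1_hom unital_positive_AffT_pullback ballI)
    have "\<alpha>0 (K0_class one_proj) = h0 (loop_class unitary_top 1 circle_loop)"
      using \<alpha>0[OF loop_class_carrier[OF circle_loop_loops]] canonical_pi1_circle_loop[OF kA] by simp
    then show "\<alpha>0 (K0_class one_proj) = K0_class one_proj"
      by (simp add: h0_def pi1_map_loop_class[OF continuous_map_hom circle_loop_loops hom_one] canonical_pi1_hom_circle_loop[OF kB pi1_B])
  next
    fix x :: "'a k0" assume "x \<in> carrier K0"
    \<comment> \<open>Surjectivity of \<open>kA\<close> represents an arbitrary class of K_0(A) by a
      loop in U(A), on which \<open>\<theta>\<close> can act.\<close>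
    then obtain c where c: "c \<in> carrier pi1_U" "x = kA c" using kA_im by blast
    obtain u where u: "u \<in> loops unitary_top 1" "c = loop_class unitary_top 1 u" by (rule pi1_carrierE[OF c(1)])
    define y where "y = kB (loop_class unitary_top 1 (\<theta> \<circ> u))"
    have y: "y \<in> carrier K0" unfolding y_def by (rule hom_in_carrier[OF kB_hom loop_class_carrier[OF loops_hom[OF u(1)]]])
    have ax: "\<alpha>0 x = y [^]\<^bsub>K0\<^esub> sign"
      unfolding c(2) \<alpha>0[OF c(1)] h0_def
      unfolding u(2) pi1_map_loop_class[OF continuous_map_hom u(1) hom_one] y_def ..
    show "AffT_pullback (rho x) = rho (\<alpha>0 x)"
    proof
      fix \<tau> :: "'b \<Rightarrow> complex"
      have "rho (y [^]\<^bsub>K0\<^esub> sign) \<tau> = of_int sign * rho y \<tau>"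
        using sign_cases y by (auto simp: K0.int_pow_1 K0.int_pow_neg rho_inv)
      \<comment> \<open>Off T(B) both sides are 0 by convention.\<close>
      then show "AffT_pullback (rho x) \<tau> = rho (\<alpha>0 x) \<tau>"
        unfolding ax AffT_pullback_def using rho_pi1_map[OF _ kA kB u(1), of \<tau>]
        by (simp add: rho_outside c(2) u(2) y_def)
    qed
  qed
  moreover have "KTu_induced_by \<theta> kA kB \<alpha>0 \<alpha>1 AffT_pullback"
    unfolding KTu_induced_by_def
  proof (intro exI[of _ sign] conjI allI impI ballI)
    show "sign \<in> {1, - 1}" using sign_cases by auto
    show "\<theta> (scaleC z 1) = scaleC (z powi sign) 1" if "cmod z = 1" for z by (rule hom_circle_powi[OF that])
    show "\<alpha>0 (kA c) = kB (pi1_map unitary_top 1 \<theta> c) [^]\<^bsub>K0\<^esub> sign" if "c \<in> carrier pi1_U" for c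
      using \<alpha>0[OF that] by (simp add: h0_def)
    show "\<alpha>1 (canonical_pi0 c) = canonical_pi0 (coset_map unitary_group unitary_component \<theta> c)"
      if "c \<in> carrier pi0_U" for c
      using \<alpha>1[OF that] by (simp add: h1_def)
    fix a :: 'a assume a: "a \<in> selfadjoint"
    show "\<exists>b\<in>selfadjoint. (\<forall>t::real. \<theta> (exp (scaleC (\<i> * of_real t) a)) = exp (scaleC (\<i> * of_real t) b)) \<and>
        AffT_pullback (AffT_hat a) = (\<lambda>\<tau>. of_int sign * AffT_hat b \<tau>)"
    proof (intro bexI[of _ "generator a"] conjI allI)
      show "generator a \<in> selfadjoint" by (rule generator(1)[OF a])
      show "\<theta> (exp (scaleC (\<i> * of_real t) a)) = exp (scaleC (\<i> * of_real t) (generator a))" for t :: real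
        unfolding scaleC_of_real_mult by (rule generator(2)[OF a])
      show "AffT_pullback (AffT_hat a) = (\<lambda>\<tau>. of_int sign * AffT_hat (generator a) \<tau>)"
        by (auto simp: fun_eq_iff AffT_pullback_def AffT_hat_def pullback_tracial_state pullback_selfadjoint a)
    qed
  qed
  ultimately show ?thesis by blast
qed

end
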